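(* Let $X$ be a separable Banach space over $\mathbb K\in\{\mathbb R,\mathbb C\}$, let $T:X\to X$ be a bounded linear operator and let $\omega:\mathbb N\to(1,+\infty)$ with $\omega(k)\to+\infty$. Suppose that for every function $\omega_0:[1,+\infty)\to(1,+\infty)$ tending to infinity, one can find a sequence $\mathcal D=(x_n)_{n\geq 1}\subset X$, a sequence $(\varepsilon_k)_{k\in\mathbb Z}\in\ell^1(\mathbb Z)$ and maps $S_n:\mathcal D\to X$, $n\geq 0$, such that: (i) for every $x\in\mathcal D$, $\sum_{n\geq 0}T^nx$ converges unconditionally; (ii) for every $x\in\mathcal D$, $\sum_{n\geq 0}S_nx$ converges unconditionally; (iii) for every $x\in\mathcal D$, $T^nS_nx=x$ for all $n$, and $T^mS_nx=S_{n-m}x$ for all $n>m$; (iv) for every sequence $(n_k)_{k\in\mathbb Z}\in\mathbb N^{\mathbb Z}$ such that $\sum_{k\geq 0}T^kx_{n_k}$ and $\sum_{k<0}S_{-k}x_{n_k}$ converge, $\left\|\sum_{k\geq0}T^kx_{n_k}\right\|+\left\|\sum_{k<0}S_{-k}x_{n_k}\right\|\leq\sum_{k\in\mathbb Z}\omega_0(n_k)\varepsilon_k$; (v) the linear span of $\{T^kx_n,\ S_kx_n:\ k\geq0,\ n\geq1\}$ is dense in $X$. Then there exists a $T$-invariant Borel probability measure $\mu$ on $X$ with full support, with respect to which $T$ is strongly mixing, such that $E_\omega\subset L^2(X,\mathcal B,\mu)$. Suppose moreover that there exists $\alpha>1/2$ such that (the sequence above also satisfies) $\|T^kx_n\|\leq\frac{\omega_0(n)}{(1+k)^\alpha}$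 and $\|S_kx_n\|\leq\frac{\omega_0(n)}{(1+k)^\alpha}$ for all $n\geq1$, $k\geq0$. Then for any $f,g\in E_\omega$ there is a constant $C_{f,g,\alpha}$ such that for all $n\geq1$, $|\mathrm{Cov}(f\circ T^n,g)|\leq C_{f,g,\alpha}\,n^{1-2\alpha}$ if $\alpha\in(1/2,1)$, $\leq C_{f,g,\alpha}\frac{\log(n+1)}{n}$ if $\alpha=1$, and $\leq C_{f,g,\alpha}\,n^{-\alpha}$ if $\alpha>1$. If $\alpha>1$, then for every $f\in E_\omega$ with $\int f\,d\mu=0$, the sequence $\frac1{\sqrt n}(f+f\circ T+\dots+f\circ T^{n-1})$ converges in distribution to a Gaussian random variable with zero mean and finite variance.
   Context: $E_\omega$ denotes the set of functions $f:X\to\mathbb R$ which are infinitely (Fréchet) differentiable at $0$, satisfy $f(x)=\sum_{\kappa=0}^{\infty}\frac{D^\kappa f(0)}{\kappa!}(x,\dots,x)$ for all $x\in X$, and satisfy $\sup_{\kappa\geq0}\|D^\kappa f(0)\|\,\omega(\kappa)^\kappa<+\infty$. A measure $\mu$ is $T$-invariant if $\mu(T^{-1}A)=\mu(A)$ for all Borel $A$; it has full support if $\mu(U)>0$ for every nonempty open $U$; $T$ is strongly mixing w.r.t. $\mu$ if $\mu(A\cap T^{-n}B)\to\mu(A)\mu(B)$ for all Borel $A,B$. For $f,g\in L^2(\mu)$, $\mathrm{Cov}(f,g)=\int fg\,d\mu-\int f\,d\mu\int g\,d\mu$. *)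

theory Defs
  imports "HOL-Probability.Probability"
begin

text \<open>A real k-linear form on 'a is represented as a function on lists of length k.\<close>

definition multilinear_form :: "nat \<Rightarrow> ('a::real_vector list \<Rightarrow> real) \<Rightarrow> bool" where
  "multilinear_form k A \<longleftrightarrow>
     (\<forall>us vs. length us + length vs + 1 = k \<longrightarrow> linear (\<lambda>v. A (us @ v # vs)))"

definition bounded_multilinear_form :: "nat \<Rightarrow> ('a::real_normed_vector list \<Rightarrow> real) \<Rightarrow> bool" where
  "bounded_multilinear_form k A \<longleftrightarrow> multilinear_form k A \<and>
     (\<exists>C. \<forall>hs. length hs = k \<longrightarrow> \<bar>A hs\<bar> \<le> C * prod_list (map norm hs))"

definition mnorm :: "nat \<Rightarrow> ('a::real_normed_vector list \<Rightarrow> real) \<Rightarrow> real" where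
  "mnorm k A = (SUP hs\<in>{hs. length hs = k \<and> (\<forall>h\<in>set hs. norm h \<le> 1)}. \<bar>A hs\<bar>)"

text \<open>B y is the Frechet derivative at y of the map y' \<mapsto> A y' (valued in bounded k-linear forms),
  written as the (k+1)-linear form (h, hs) \<mapsto> DA(y)(h)(hs).\<close>
definition frechet_step ::
  "nat \<Rightarrow> ('a::real_normed_vector \<Rightarrow> 'a list \<Rightarrow> real) \<Rightarrow> ('a \<Rightarrow> 'a list \<Rightarrow> real) \<Rightarrow> 'a \<Rightarrow> bool" where
  "frechet_step k A B y \<longleftrightarrow>
     bounded_multilinear_form k (A y) \<and> bounded_multilinear_form (Suc k) (B y) \<and>
     ((\<lambda>h. mnorm k (\<lambda>hs. A (y + h) hs - A y hs - B y (h # hs)) / norm h) \<longlongrightarrow> 0) (at 0)"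

text \<open>D is the family of iterated Frechet derivatives of f (D k y = D^k f(y)), and f is
  infinitely Frechet differentiable at x0: for every k, D^0,...,D^(k-1) are differentiable
  (with derivative the next one) on a neighbourhood of x0.\<close>
definition infinitely_frechet_at ::
  "('a::real_normed_vector \<Rightarrow> real) \<Rightarrow> (nat \<Rightarrow> 'a \<Rightarrow> 'a list \<Rightarrow> real) \<Rightarrow> 'a \<Rightarrow> bool" where
  "infinitely_frechet_at f D x0 \<longleftrightarrow> (\<forall>y. D 0 y [] = f y) \<and>
     (\<forall>k. \<exists>U. open U \<and> x0 \<in> U \<and> (\<forall>y\<in>U. \<forall>j<k. frechet_step j (D j) (D (Suc j)) y))"

definition E_omega :: "(nat \<Rightarrow> real) \<Rightarrow> ('a::real_normed_vector \<Rightarrow> real) set" where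
  "E_omega \<omega> = {f. \<exists>D. infinitely_frechet_at f D 0 \<and>
      (\<forall>x. (\<lambda>\<kappa>. D \<kappa> 0 (replicate \<kappa> x) / fact \<kappa>) sums f x) \<and>
      bdd_above (range (\<lambda>\<kappa>. mnorm \<kappa> (D \<kappa> 0) * \<omega> \<kappa> ^ \<kappa>))}"

text \<open>A complex Banach space is a real Banach space together with a complex structure J
  (multiplication by i) such that norm((a + i b) x) = |a + i b| norm x.\<close>
definition complex_structure :: "('a::real_normed_vector \<Rightarrow> 'a) \<Rightarrow> bool" where
  "complex_structure J \<longleftrightarrow> linear J \<and> (\<forall>x. J (J x) = - x) \<and>
     (\<forall>a b x. norm (a *\<^sub>R x + b *\<^sub>R J x) = sqrt (a\<^sup>2 + b\<^sup>2) * norm x)"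

text \<open>cplx = False: K = R; cplx = True: K = C with complex structure J.\<close>
definition K_span :: "bool \<Rightarrow> ('a::real_vector \<Rightarrow> 'a) \<Rightarrow> 'a set \<Rightarrow> 'a set" where
  "K_span cplx J V = (if cplx then span (V \<union> J ` V) else span V)"

definition K_bounded_linear :: "bool \<Rightarrow> ('a::real_normed_vector \<Rightarrow> 'a) \<Rightarrow> ('a \<Rightarrow> 'a) \<Rightarrow> bool" where
  "K_bounded_linear cplx J T \<longleftrightarrow> bounded_linear T \<and> (cplx \<longrightarrow> (\<forall>x. T (J x) = J (T x)))"

text \<open>x n (n \<ge> 1) is the sequence D, S n the maps S_n on D, \<epsilon> the l^1(Z) weight.\<close>
definition admissible_data ::
  "bool \<Rightarrow> ('a::banach \<Rightarrow> 'a) \<Rightarrow> ('a \<Rightarrow> 'a) \<Rightarrow> (real \<Rightarrow> real) \<Rightarrow> (nat \<Rightarrow> 'a) \<Rightarrow> (int \<Rightarrow> real)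
     \<Rightarrow> (nat \<Rightarrow> 'a \<Rightarrow> 'a) \<Rightarrow> bool" where
  "admissible_data cplx J T \<omega>0 x \<epsilon> S \<longleftrightarrow>
     (\<forall>k. \<epsilon> k \<ge> 0) \<and> \<epsilon> summable_on UNIV \<and>
     \<comment> \<open>(i)\<close>
     (\<forall>m\<ge>1. (\<lambda>n. (T ^^ n) (x m)) summable_on UNIV) \<and>
     \<comment> \<open>(ii)\<close>
     (\<forall>m\<ge>1. (\<lambda>n. S n (x m)) summable_on UNIV) \<and>
     \<comment> \<open>(iii)\<close>
     (\<forall>m\<ge>1. \<forall>n. (T ^^ n) (S n (x m)) = x m \<and>
        (\<forall>k<n. (T ^^ k) (S n (x m)) = S (n - k) (x m))) \<and>
     \<comment> \<open>(iv)\<close>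
     (\<forall>nk :: int \<Rightarrow> nat. (\<forall>k. nk k \<ge> 1) \<longrightarrow>
        summable (\<lambda>k. (T ^^ k) (x (nk (int k)))) \<longrightarrow>
        summable (\<lambda>k. S (Suc k) (x (nk (- int (Suc k))))) \<longrightarrow>
        (\<lambda>k. \<omega>0 (real (nk k)) * \<epsilon> k) summable_on UNIV \<longrightarrow>
        norm (\<Sum>k. (T ^^ k) (x (nk (int k)))) + norm (\<Sum>k. S (Suc k) (x (nk (- int (Suc k)))))
          \<le> (\<Sum>\<^sub>\<infinity>k. \<omega>0 (real (nk k)) * \<epsilon> k)) \<and>
     \<comment> \<open>(v)\<close>
     closure (K_span cplx J ({(T ^^ k) (x n) | k n. n \<ge> 1} \<union> {S k (x n) | k n. n \<ge> 1})) = UNIV"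

definition decay_bound ::
  "real \<Rightarrow> ('a::real_normed_vector \<Rightarrow> 'a) \<Rightarrow> (real \<Rightarrow> real) \<Rightarrow> (nat \<Rightarrow> 'a) \<Rightarrow> (nat \<Rightarrow> 'a \<Rightarrow> 'a) \<Rightarrow> bool" where
  "decay_bound \<alpha> T \<omega>0 x S \<longleftrightarrow>
     (\<forall>n\<ge>1. \<forall>k. norm ((T ^^ k) (x n)) \<le> \<omega>0 (real n) / (1 + real k) powr \<alpha> \<and>
                norm (S k (x n)) \<le> \<omega>0 (real n) / (1 + real k) powr \<alpha>)"

definition weight_function :: "(real \<Rightarrow> real) \<Rightarrow> bool" where
  "weight_function \<omega>0 \<longleftrightarrow> (\<forall>t\<ge>1. \<omega>0 t > 1) \<and> filterlim \<omega>0 at_top at_top"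

definition covariance :: "'a measure \<Rightarrow> ('a \<Rightarrow> real) \<Rightarrow> ('a \<Rightarrow> real) \<Rightarrow> real" where
  "covariance \<mu> f g = (\<integral>x. f x * g x \<partial>\<mu>) - (\<integral>x. f x \<partial>\<mu>) * (\<integral>x. g x \<partial>\<mu>)"

definition good_measure ::
  "(nat \<Rightarrow> real) \<Rightarrow> ('a::{banach,second_countable_topology} \<Rightarrow> 'a) \<Rightarrow> 'a measure \<Rightarrow> bool" where
  "good_measure \<omega> T \<mu> \<longleftrightarrow>
     prob_space \<mu> \<and> sets \<mu> = sets borel \<and>
     \<comment> \<open>T-invariant\<close>
     (\<forall>A\<in>sets borel. emeasure \<mu> (T -` A) = emeasure \<mu> A) \<and>
     \<comment> \<open>full support\<close>
     (\<forall>U. open U \<and> U \<noteq> {} \<longrightarrow> emeasure \<mu> U > 0) \<and>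
     \<comment> \<open>strongly mixing\<close>
     (\<forall>A\<in>sets borel. \<forall>B\<in>sets borel.
        (\<lambda>n. measure \<mu> (A \<inter> (T ^^ n) -` B)) \<longlonglongrightarrow> measure \<mu> A * measure \<mu> B) \<and>
     \<comment> \<open>E_omega \<subseteq> L^2(\<mu>)\<close>
     (\<forall>f\<in>E_omega \<omega>. f \<in> borel_measurable \<mu> \<and> integrable \<mu> (\<lambda>x. (f x)\<^sup>2))"

definition cov_rate :: "real \<Rightarrow> nat \<Rightarrow> real" where
  "cov_rate \<alpha> n = (if \<alpha> < 1 then real n powr (1 - 2 * \<alpha>)
                    else if \<alpha> = 1 then ln (real n + 1) / real n
                    else real n powr (- \<alpha>))"

definition centered_gaussian :: "real \<Rightarrow> real measure" where
  "centered_gaussian \<sigma> = (if \<sigma> = 0 then return borel 0 else density lborel (normal_density 0 \<sigma>))"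

end

(*
  The orbits x, T x, T^2 x, ... and S_1 x, S_2 x, ... glue to bi-infinite T-orbits v : Z -> X along which
  the sum converges unconditionally; these form a shift-invariant subspace whose values at 0 are
  dense, so countably many of them, v_0 = 0, v_1, v_2, ..., have dense values at 0.  Let the symbols
  w_k (k in Z) be i.i.d. natural numbers and Phi(w) = sum_k v_{w_k}(k).  If the probabilities of the
  symbols n >= 1 are chosen small enough in terms of the orbits v_n, the sum converges
  unconditionally almost surely and exp(4 |Phi|) is integrable.  Since T Phi(w) = Phi(shift w), the law of
  Phi is T-invariant and inherits mixing from the Bernoulli shift; it has full support because all symbols
  have positive probability and the tails of the series tend to 0.

  A function f in E_omega satisfies |f x - f y| <= M |x - y| (exp |x| + exp |y|), which already gives
  square integrability.  Resampling the symbol w_k changes f(T^n Phi) by O((1 + |k + n|)^-alpha) in L^2,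
  and Cov(F, G) <= sum_k |D_k F|_2 |D_k G|_2 for functions of independent variables, where D_k denotes
  the effect of resampling; summing the products gives the rates.  For alpha > 1 these
  influences are summable, f(Phi) is approximated by functions of finitely many symbols, and sums of the
  latter split into i.i.d. blocks separated by negligible gaps.
*)

theory Submission
  imports Defs
begin

text \<open>What drives the proof is the order of choices: the probabilities of the symbols are
  fixed after the orbits, so they can compensate any growth of the orbits with n. The outcome is one
  integrable function \<open>V\<close> that dominates exp (4 |s|) for every finite partial sum s at
  once, and also the fourth power of the size constant of the symbol at 0. It serves every
  truncation, every limit and every resampled sequence, because an injective reindexing of the
  symbols preserves its integral. The exponent 4 comes from squaring an increment of f, which is
  bounded by a size constant times an exponential: the square of such a product is controlled by
  fourth powers.

  The obstacle is that the series involves infinitely many symbols, while the covariance inequality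
  resamples one coordinate after another and so is proved for a function of finitely many. Estimates
  are therefore made for truncated observables, with constants that do not see the truncation, and
  then passed to the limit.\<close>

subsection \<open>Growth of the functions in E_omega\<close>

text \<open>Writing each argument as its norm times its \<open>sgn\<close> and pulling out the norms
  leaves arguments in the closed unit ball. Boundedness of the form is what makes the real supremum
  in \<open>mnorm\<close> an upper bound of its set.\<close>

lemma bounded_multilinear_form_le_mnorm:
  assumes A: "bounded_multilinear_form k A" and len: "length hs = k"
  shows "\<bar>A hs\<bar> \<le> mnorm k A * prod_list (map norm hs)"
proof -
  have ml: "linear (\<lambda>v. A (us @ v # vs))" if "length us + length vs + 1 = k" for us vs
    using A that unfolding bounded_multilinear_form_def multilinear_form_def by blast
  obtain C where C: "\<And>hs. length hs = k \<Longrightarrow> \<bar>A hs\<bar> \<le> C * prod_list (map norm hs)"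
    using A unfolding bounded_multilinear_form_def by blast
  \<comment> \<open>The prefix \<open>us\<close> holds arguments that stay untouched: the induction
    rescales the tail behind h first and then h itself, by linearity in a middle slot.\<close>
  have scale: "A (us @ hs) = prod_list (map norm hs) * A (us @ map sgn hs)"
    if "length us + length hs = k" for us hs
    using that
  proof (induction hs arbitrary: us)
    case (Cons h hs)
    have "A (us @ h # hs) = A ((us @ [h]) @ hs)" by simp
    also have "\<dots> = prod_list (map norm hs) * A (us @ h # map sgn hs)"
      using Cons.IH[of "us @ [h]"] Cons.prems by simp
    also have "A (us @ h # map sgn hs) = A (us @ (norm h *\<^sub>R sgn h) # map sgn hs)"
      by (cases "h = 0") (simp_all add: sgn_div_norm)
    also have "\<dots> = norm h * A (us @ sgn h # map sgn hs)"
      using linear_scale[OF ml[of us "map sgn hs"], of "norm h" "sgn h"] Cons.prems by simp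
    finally show ?case by simp
  qed simp
  have bdd: "bdd_above ((\<lambda>hs. \<bar>A hs\<bar>) ` {hs. length hs = k \<and> (\<forall>h\<in>set hs. norm h \<le> 1)})"
  proof (rule bdd_aboveI2)
    fix hs :: "'a list" assume hs: "hs \<in> {hs. length hs = k \<and> (\<forall>h\<in>set hs. norm h \<le> 1)}"
    have "\<bar>A hs\<bar> \<le> C * prod_list (map norm hs)" using C hs by auto
    also have "\<dots> \<le> \<bar>C\<bar> * 1"
    proof (rule mult_mono)
      have "prod_list (map norm gs) \<le> 1" if "\<forall>h\<in>set gs. norm h \<le> 1" for gs :: "'a list"
        using that by (induction gs) (auto intro!: mult_le_one prod_list_nonneg)
      then show "prod_list (map norm hs) \<le> 1" using hs by auto
    qed (auto intro!: prod_list_nonneg)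
    finally show "\<bar>A hs\<bar> \<le> \<bar>C\<bar> * 1" .
  qed
  have "\<bar>A (map sgn hs)\<bar> \<le> mnorm k A"
    unfolding mnorm_def by (rule cSUP_upper[OF _ bdd]) (use len in \<open>auto simp: norm_sgn\<close>)
  moreover have "prod_list (map norm hs) \<ge> 0" by (rule prod_list_nonneg) auto
  ultimately show ?thesis
    using scale[of "[]" hs] len
    by (simp add: abs_mult) (simp add: mult.commute[of "prod_list _"] mult_right_mono)
qed

lemma prod_list_norm_replicate:
  "prod_list (map norm (replicate i x @ replicate j y)) = norm x ^ i * norm y ^ j"
  by (simp add: prod_list_replicate)

text \<open>Turning the diagonal of y into that of x one argument at a time takes k steps. Each
  contributes one factor \<open>norm (x - y)\<close>, while the other k - 1 arguments have norm at
  most the maximum of the two norms.\<close>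

lemma multilinear_diagonal_diff_le:
  assumes A: "bounded_multilinear_form k A"
  shows "\<bar>A (replicate k x) - A (replicate k y)\<bar>
    \<le> mnorm k A * norm (x - y) * (real k * max (norm x) (norm y) ^ (k - 1))"
proof -
  define r where "r = max (norm x) (norm y)"
  define h where "h i = A (replicate i x @ replicate (k - i) y)" for i
  \<comment> \<open>The bound is tested on the diagonal of a nonzero vector. The trivial space,
    where the index set is a single list of zeros, is therefore treated apart.\<close>
  have mn: "mnorm k A \<ge> 0"
    using bounded_multilinear_form_le_mnorm[OF A, of "replicate k 0"]
  proof -
    have "\<bar>A []\<bar> \<le> mnorm k A" if "k = 0"
      using bounded_multilinear_form_le_mnorm[OF A, of "[]"] that by simp
    moreover have "mnorm k A \<ge> 0" if "\<exists>z::'a. z \<noteq> 0"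
    proof -
      from that obtain z :: 'a where "z \<noteq> 0" by blast
      have "0 \<le> \<bar>A (replicate k z)\<bar>" by simp
      also have "\<dots> \<le> mnorm k A * norm z ^ k"
        using bounded_multilinear_form_le_mnorm[OF A, of "replicate k z"]
          prod_list_norm_replicate[of 0 z k z] by simp
      finally show ?thesis using \<open>z \<noteq> 0\<close> zero_less_power[of "norm z" k]
        by (auto simp: zero_le_mult_iff simp del: zero_less_power)
    qed
    moreover have "mnorm k A \<ge> 0" if "\<And>z::'a. z = 0"
    proof -
      have "norm z = 0" for z :: 'a using that[of z] by simp
      then have eq: "{hs::'a list. length hs = k \<and> (\<forall>h\<in>set hs. norm h \<le> 1)} = {replicate k 0}"
        using that by (auto simp del: norm_eq_zero intro!: nth_equalityI)
      show ?thesis unfolding mnorm_def eq by simp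
    qed
    ultimately show ?thesis by blast
  qed
  have step: "\<bar>h (Suc i) - h i\<bar> \<le> mnorm k A * norm (x - y) * r ^ (k - 1)" if i: "i < k" for i
  proof -
    have k: "k - i = Suc (k - Suc i)" using i by simp
    have lin: "linear (\<lambda>v. A (replicate i x @ v # replicate (k - Suc i) y))"
      using A i unfolding bounded_multilinear_form_def multilinear_form_def by auto
    have "h (Suc i) - h i = A (replicate i x @ x # replicate (k - Suc i) y)
        - A (replicate i x @ y # replicate (k - Suc i) y)"
      unfolding h_def k by (simp add: replicate_app_Cons_same)
    also have "\<dots> = A (replicate i x @ (x - y) # replicate (k - Suc i) y)"
      using linear_diff[OF lin] by simp
    also have "\<bar>\<dots>\<bar> \<le> mnorm k A * prod_list (map norm (replicate i x @ (x - y) # replicate (k - Suc i) y))"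
      by (rule bounded_multilinear_form_le_mnorm[OF A]) (use i in simp)
    also have "\<dots> = mnorm k A * (norm (x - y) * (norm x ^ i * norm y ^ (k - Suc i)))"
      using prod_list_norm_replicate[of i x "k - Suc i" y] by (simp add: ac_simps)
    also have "\<dots> \<le> mnorm k A * (norm (x - y) * (r ^ i * r ^ (k - Suc i)))"
      using mn by (intro mult_left_mono mult_mono power_mono) (auto simp: r_def le_max_iff_disj)
    also have "r ^ i * r ^ (k - Suc i) = r ^ (k - 1)"
      using i by (simp flip: power_add)
    finally show ?thesis by (simp add: ac_simps)
  qed
  have "A (replicate k x) - A (replicate k y) = h k - h 0" by (simp add: h_def)
  also have "\<dots> = (\<Sum>i<k. h (Suc i) - h i)" by (rule sum_lessThan_telescope[symmetric])
  also have "\<bar>\<dots>\<bar> \<le> (\<Sum>i<k. \<bar>h (Suc i) - h i\<bar>)" by (rule sum_abs)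
  also have "\<dots> \<le> (\<Sum>i<k. mnorm k A * norm (x - y) * r ^ (k - 1))"
    by (rule sum_mono) (use step in auto)
  finally show ?thesis by (simp add: r_def ac_simps)
qed

text \<open>The exponential series differentiated term by term; it sums the factors produced by the
  diagonal estimate.\<close>

lemma sums_deriv_exp: "(\<lambda>k. real k * r ^ (k - 1) / fact k) sums exp (r::real)"
proof -
  have "(\<lambda>k. r ^ k / fact k) sums exp r"
    using exp_converges[of r] by (simp add: divide_inverse ac_simps)
  moreover have "real (Suc k) * r ^ (Suc k - 1) / fact (Suc k) = r ^ k / fact k" for k
    by (simp del: of_nat_Suc)
  ultimately show ?thesis
    using sums_Suc[of "\<lambda>k. real k * r ^ (k - 1) / fact k" "exp r"] by simp
qed

text \<open>Since \<open>\<omega> k > 1\<close>, the weights \<open>\<omega> k ^ k\<close> are at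
  least 1, and all derivatives at 0 have norm at most one constant M. The series of f and of its
  increments are then dominated by M times the exponential series and by its differentiated
  form.\<close>

lemma E_omega_growth:
  fixes f :: "'a::real_normed_vector \<Rightarrow> real"
  assumes f: "f \<in> E_omega \<omega>" and \<omega>: "\<forall>k. \<omega> k > 1"
  obtains M where "M > 0" "\<And>x. \<bar>f x\<bar> \<le> M * exp (norm x)"
    "\<And>x y. \<bar>f x - f y\<bar> \<le> M * norm (x - y) * (exp (norm x) + exp (norm y))"
proof -
  from f obtain D where D: "infinitely_frechet_at f D 0"
      "\<And>x. (\<lambda>k. D k 0 (replicate k x) / fact k) sums f x"
      "bdd_above (range (\<lambda>k. mnorm k (D k 0) * \<omega> k ^ k))"
    unfolding E_omega_def by blast
  have bml: "bounded_multilinear_form k (D k 0)" for k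
    using D(1) unfolding infinitely_frechet_at_def frechet_step_def by (meson lessI)
  from D(3) obtain M0 where M0: "\<And>k. mnorm k (D k 0) * \<omega> k ^ k \<le> M0"
    unfolding bdd_above_def by auto
  define M where "M = max M0 1"
  have mM: "mnorm k (D k 0) \<le> M" for k
  proof (cases "mnorm k (D k 0) \<ge> 0")
    case True
    have "mnorm k (D k 0) * 1 \<le> mnorm k (D k 0) * \<omega> k ^ k"
      using True \<omega> by (intro mult_left_mono one_le_power) (auto intro: less_imp_le)
    then show ?thesis using M0[of k] by (simp add: M_def)
  qed (simp add: M_def)
  have "M > 0" by (simp add: M_def)
  have exps: "(\<lambda>k. M * (r ^ k / fact k)) sums (M * exp r)" for r :: real
    using sums_mult[OF exp_converges[of r], of M] by (simp add: divide_inverse ac_simps)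
  have 1: "\<bar>f x\<bar> \<le> M * exp (norm x)" for x
  proof -
    have le: "norm (D k 0 (replicate k x) / fact k) \<le> M * (norm x ^ k / fact k)" for k
    proof -
      have "\<bar>D k 0 (replicate k x)\<bar> \<le> mnorm k (D k 0) * norm x ^ k"
        using bounded_multilinear_form_le_mnorm[OF bml, of "replicate k x" k]
          prod_list_norm_replicate[of 0 x k x] by simp
      also have "\<dots> \<le> M * norm x ^ k" by (intro mult_right_mono mM) auto
      finally show ?thesis by (simp add: divide_right_mono)
    qed
    have "norm (\<Sum>k. D k 0 (replicate k x) / fact k) \<le> (\<Sum>k. M * (norm x ^ k / fact k))"
      by (rule norm_suminf_le[OF le]) (use exps sums_summable in blast)
    then show ?thesis
      using sums_unique[OF D(2), of x] sums_unique[OF exps, of "norm x"] by simp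
  qed
  have 2: "\<bar>f x - f y\<bar> \<le> M * norm (x - y) * (exp (norm x) + exp (norm y))" for x y
  proof -
    define r where "r = max (norm x) (norm y)"
    define c where "c = M * norm (x - y)"
    have sm: "(\<lambda>k. c * (real k * r ^ (k - 1) / fact k)) sums (c * exp r)"
      by (rule sums_mult[OF sums_deriv_exp])
    have le: "norm (D k 0 (replicate k x) / fact k - D k 0 (replicate k y) / fact k)
        \<le> c * (real k * r ^ (k - 1) / fact k)" for k
    proof -
      have "\<bar>D k 0 (replicate k x) - D k 0 (replicate k y)\<bar>
          \<le> mnorm k (D k 0) * norm (x - y) * (real k * r ^ (k - 1))"
        using multilinear_diagonal_diff_le[OF bml] by (simp add: r_def)
      also have "\<dots> \<le> c * (real k * r ^ (k - 1))"
        unfolding c_def by (intro mult_right_mono mM) (auto simp: r_def le_max_iff_disj)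
      finally show ?thesis by (simp add: divide_right_mono flip: diff_divide_distrib)
    qed
    have "norm (\<Sum>k. D k 0 (replicate k x) / fact k - D k 0 (replicate k y) / fact k)
        \<le> (\<Sum>k. c * (real k * r ^ (k - 1) / fact k))"
      by (rule norm_suminf_le[OF le]) (use sm sums_summable in blast)
    then have "\<bar>f x - f y\<bar> \<le> c * exp r"
      using sums_unique[OF sums_diff[OF D(2)[of x] D(2)[of y]]] sums_unique[OF sm] by simp
    also have "exp r \<le> exp (norm x) + exp (norm y)"
      unfolding r_def max_def by (auto simp: add_increasing add_increasing2)
    finally show ?thesis using \<open>M > 0\<close> by (simp add: c_def mult_left_mono)
  qed
  show thesis using that[OF \<open>M > 0\<close> 1 2] .
qed

lemma continuous_of_exp_lipschitz:
  fixes f :: "'a::real_normed_vector \<Rightarrow> real"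
  assumes "\<And>x y. \<bar>f x - f y\<bar> \<le> M * norm (x - y) * (exp (norm x) + exp (norm y))"
  shows "continuous_on UNIV f"
proof (clarsimp simp: continuous_on_eq_continuous_within)
  fix x :: 'a
  have "((\<lambda>y. M * norm (y - x) * (exp (norm y) + exp (norm x)))
      \<longlongrightarrow> M * norm (x - x) * (exp (norm x) + exp (norm x))) (at x)"
    by (intro tendsto_intros)
  then have "((\<lambda>y. f y - f x) \<longlongrightarrow> 0) (at x)"
    by (intro Lim_null_comparison[where f="\<lambda>y. f y - f x"]) (auto intro!: always_eventually assms)
  then show "isCont f x" unfolding isCont_def by (simp add: LIM_zero_iff)
qed

subsection \<open>Bi-infinite orbits\<close>

text \<open>For \<open>\<alpha> = 0\<close> the decay condition already follows from summability.\<close>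

definition bi_orbits :: "('a::real_normed_vector \<Rightarrow> 'a) \<Rightarrow> real \<Rightarrow> (int \<Rightarrow> 'a) set" where
  "bi_orbits T \<alpha> = {w. (\<forall>k. T (w k) = w (k + 1)) \<and> w summable_on UNIV \<and>
     (\<exists>C. \<forall>k. norm (w k) \<le> C * (1 + \<bar>real_of_int k\<bar>) powr (- \<alpha>))}"

text \<open>Meant for real multiples and for multiplication by i, the two maps needed to make the
  values at 0 a space over the scalar field.\<close>

lemma bi_orbits_linear_image:
  assumes L: "bounded_linear L" and comm: "\<And>x. T (L x) = L (T x)" and w: "w \<in> bi_orbits T \<alpha>"
  shows "(\<lambda>k. L (w k)) \<in> bi_orbits T \<alpha>"
proof -
  from w obtain C where C: "\<And>k. norm (w k) \<le> C * (1 + \<bar>real_of_int k\<bar>) powr (- \<alpha>)"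
    unfolding bi_orbits_def by blast
  obtain B where B: "B > 0" "\<And>x. norm (L x) \<le> norm x * B"
    using bounded_linear.pos_bounded[OF L] by blast
  have "norm (L (w k)) \<le> (B * C) * (1 + \<bar>real_of_int k\<bar>) powr (- \<alpha>)" for k
    using order_trans[OF B(2)[of "w k"] mult_right_mono[OF C[of k], of B]] B(1)
    by (simp add: ac_simps)
  moreover have "(\<lambda>k. L (w k)) summable_on UNIV"
    by (rule summable_on_bounded_linear[OF L]) (use w in \<open>simp add: bi_orbits_def\<close>)
  ultimately show ?thesis using w comm unfolding bi_orbits_def by auto
qed

lemma bi_orbits_add:
  assumes T: "linear T" and w: "w \<in> bi_orbits T \<alpha>" and w': "w' \<in> bi_orbits T \<alpha>"
  shows "(\<lambda>k. w k + w' k) \<in> bi_orbits T \<alpha>"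
proof -
  from w obtain C where C: "\<And>k. norm (w k) \<le> C * (1 + \<bar>real_of_int k\<bar>) powr (- \<alpha>)"
    unfolding bi_orbits_def by blast
  from w' obtain C' where C': "\<And>k. norm (w' k) \<le> C' * (1 + \<bar>real_of_int k\<bar>) powr (- \<alpha>)"
    unfolding bi_orbits_def by blast
  have "norm (w k + w' k) \<le> (C + C') * (1 + \<bar>real_of_int k\<bar>) powr (- \<alpha>)" for k
    using norm_triangle_mono[OF C[of k] C'[of k]] by (simp add: algebra_simps)
  moreover have "(\<lambda>k. w k + w' k) summable_on UNIV"
    using w w' unfolding bi_orbits_def by (auto intro: summable_on_add)
  ultimately show ?thesis using w w' linear_add[OF T] unfolding bi_orbits_def by auto
qed

text \<open>From 1 + |k| \<le> (1 + |j|) (1 + |k + j|) a shift by j costs only the constant factor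
  (1 + |j|) powr \<alpha>.\<close>

lemma bi_orbits_shift:
  assumes w: "w \<in> bi_orbits T \<alpha>" and \<alpha>: "\<alpha> \<ge> 0"
  shows "(\<lambda>k. w (k + j)) \<in> bi_orbits T \<alpha>"
proof -
  from w obtain C where C: "\<And>k. norm (w k) \<le> C * (1 + \<bar>real_of_int k\<bar>) powr (- \<alpha>)"
    unfolding bi_orbits_def by blast
  have C0: "C \<ge> 0" using C[of 0] norm_ge_zero[of "w 0"] by (simp del: norm_ge_zero)
  have "norm (w (k + j)) \<le> (C * (1 + \<bar>real_of_int j\<bar>) powr \<alpha>) * (1 + \<bar>real_of_int k\<bar>) powr (- \<alpha>)" for k
  proof -
    have "1 + \<bar>real_of_int k\<bar> \<le> 1 + \<bar>real_of_int j\<bar> + \<bar>real_of_int (k + j)\<bar>" by simp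
    also have "\<dots> \<le> (1 + \<bar>real_of_int j\<bar>) * (1 + \<bar>real_of_int (k + j)\<bar>)"
      by (simp add: algebra_simps)
    finally have "(1 + \<bar>real_of_int k\<bar>) powr \<alpha>
        \<le> ((1 + \<bar>real_of_int j\<bar>) * (1 + \<bar>real_of_int (k + j)\<bar>)) powr \<alpha>"
      using \<alpha> by (intro powr_mono2) auto
    also have "\<dots> = (1 + \<bar>real_of_int j\<bar>) powr \<alpha> * (1 + \<bar>real_of_int (k + j)\<bar>) powr \<alpha>"
      by (rule powr_mult)
    finally have "(1 + \<bar>real_of_int (k + j)\<bar>) powr (- \<alpha>)
        \<le> (1 + \<bar>real_of_int j\<bar>) powr \<alpha> * (1 + \<bar>real_of_int k\<bar>) powr (- \<alpha>)"
      by (simp add: powr_minus field_simps)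
    from order_trans[OF C[of "k + j"] mult_left_mono[OF this C0]] show ?thesis
      by (simp only: mult.assoc)
  qed
  moreover have "(\<lambda>k. w (k + j)) summable_on UNIV"
  proof -
    have "bij_betw (\<lambda>k. k + j) UNIV (UNIV :: int set)"
      by (rule bij_betwI[where g="\<lambda>k. k - j"]) auto
    from summable_on_reindex_bij_betw[OF this, of w] show ?thesis
      using w unfolding bi_orbits_def by simp
  qed
  moreover have "T (w (k + j)) = w (k + 1 + j)" for k
  proof -
    have "T (w (k + j)) = w ((k + j) + 1)" using w unfolding bi_orbits_def by blast
    also have "(k + j) + 1 = k + 1 + j" by simp
    finally show ?thesis .
  qed
  ultimately show ?thesis unfolding bi_orbits_def by blast
qed

lemma subspace_bi_orbits_at_0:
  assumes T: "linear T"
  shows "subspace ((\<lambda>w. w 0) ` bi_orbits T \<alpha>)"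
proof (rule subspaceI)
  have "(\<lambda>_. 0) \<in> bi_orbits T \<alpha>"
    using linear_0[OF T] by (auto simp: bi_orbits_def intro!: exI[of _ 0])
  then show "0 \<in> (\<lambda>w. w 0) ` bi_orbits T \<alpha>" by force
next
  fix x y assume "x \<in> (\<lambda>w. w 0) ` bi_orbits T \<alpha>" "y \<in> (\<lambda>w. w 0) ` bi_orbits T \<alpha>"
  then obtain w w' where "w \<in> bi_orbits T \<alpha>" "w' \<in> bi_orbits T \<alpha>" "x = w 0" "y = w' 0" by blast
  then show "x + y \<in> (\<lambda>w. w 0) ` bi_orbits T \<alpha>"
    using bi_orbits_add[OF T, of w \<alpha> w'] by force
next
  fix c x assume "x \<in> (\<lambda>w. w 0) ` bi_orbits T \<alpha>"
  then obtain w where "w \<in> bi_orbits T \<alpha>" "x = w 0" by blast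
  then show "c *\<^sub>R x \<in> (\<lambda>w. w 0) ` bi_orbits T \<alpha>"
    using bi_orbits_linear_image[of "(*\<^sub>R) c" T w \<alpha>] linear_scale[OF T]
    by (force simp: bounded_linear_scaleR_right)
qed

lemma admissible_dataD:
  assumes "admissible_data cplx J T \<omega>0 x \<epsilon> S"
  shows "\<And>m. m \<ge> 1 \<Longrightarrow> (\<lambda>n. (T ^^ n) (x m)) summable_on UNIV"
    and "\<And>m. m \<ge> 1 \<Longrightarrow> (\<lambda>n. S n (x m)) summable_on UNIV"
    and "\<And>m n. m \<ge> 1 \<Longrightarrow> (T ^^ n) (S n (x m)) = x m"
    and "\<And>m n k. m \<ge> 1 \<Longrightarrow> k < n \<Longrightarrow> (T ^^ k) (S n (x m)) = S (n - k) (x m)"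
    and "closure (K_span cplx J ({(T ^^ k) (x n) | k n. n \<ge> 1} \<union> {S k (x n) | k n. n \<ge> 1})) = UNIV"
  using assms[unfolded admissible_data_def] by simp_all

text \<open>To the right of 0 the orbit relation is immediate. At the seam k = -1 it reads
  \<open>T (S 1 x) = x\<close>, the first half of (iii) with n = 1; further left it is the second
  half of (iii) for a single application of T.\<close>

lemma admissible_bi_orbit:
  assumes adm: "admissible_data cplx J T \<omega>0 x \<epsilon> S" and m: "m \<ge> 1"
    and C: "\<And>k. norm ((T ^^ k) (x m)) \<le> C / (1 + real k) powr \<alpha>"
      "\<And>k. norm (S k (x m)) \<le> C / (1 + real k) powr \<alpha>"
  shows "(\<lambda>k. if k \<ge> 0 then (T ^^ nat k) (x m) else S (nat (- k)) (x m)) \<in> bi_orbits T \<alpha>"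
    (is "?w \<in> _")
proof -
  note sT = admissible_dataD(1)[OF adm m] and sS = admissible_dataD(2)[OF adm m]
    and TS = admissible_dataD(3,4)[OF adm m]
  have "T (?w k) = ?w (k + 1)" for k
  proof (cases "k \<ge> 0")
    case True
    then have "nat (k + 1) = Suc (nat k)" by simp
    then show ?thesis using True by simp
  next
    case False
    show ?thesis
    proof (cases "k = -1")
      case True
      then show ?thesis using TS(1)[of 1] by simp
    next
      case neq: False
      with False have "1 < nat (- k)" "nat (- k) - 1 = nat (- (k + 1))" by auto
      then show ?thesis using TS(2)[of 1 "nat (- k)"] False neq by simp
    qed
  qed
  moreover have "norm (?w k) \<le> C * (1 + \<bar>real_of_int k\<bar>) powr (- \<alpha>)" for k
    using C[of "nat k"] C(2)[of "nat (- k)"] by (auto simp: powr_minus divide_inverse)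
  moreover have "?w summable_on UNIV"
  proof -
    have b1: "bij_betw int UNIV {0..}"
      by (rule bij_betwI[where g=nat]) auto
    have "(\<lambda>n. ?w (int n)) summable_on UNIV" using sT by simp
    then have 1: "?w summable_on {0..}" using summable_on_reindex_bij_betw[OF b1, of ?w] by (rule iffD1[rotated])
    have b2: "bij_betw (\<lambda>n. - int n) {1..} {..<0}"
      by (rule bij_betwI[where g="\<lambda>k. nat (- k)"]) auto
    have "(\<lambda>n. S n (x m)) summable_on {1..}"
      using summable_on_subset_banach[OF sS] by blast
    then have "(\<lambda>n. ?w (- int n)) summable_on {1..}"
      by (rule summable_on_cong[THEN iffD1, rotated]) auto
    then have 2: "?w summable_on {..<0}" using summable_on_reindex_bij_betw[OF b2, of ?w] by (rule iffD1[rotated])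
    have "?w summable_on ({0..} \<union> {..<0})" by (rule summable_on_Un_disjoint[OF 1 2]) auto
    also have "{0..} \<union> {..<0} = (UNIV :: int set)" by auto
    finally show ?thesis .
  qed
  ultimately show ?thesis unfolding bi_orbits_def by blast
qed

text \<open>Every generator is the value at 0 of a shifted glued orbit, and over the complex scalars
  so is its image under J. The values at 0 form a real subspace, hence contain the whole dense
  span.\<close>

lemma dense_bi_orbits:
  assumes K: "cplx \<Longrightarrow> complex_structure J" and T: "K_bounded_linear cplx J T"
    and adm: "admissible_data cplx J T \<omega>0 x \<epsilon> S" and \<alpha>: "\<alpha> \<ge> 0"
    and C: "\<And>m k. m \<ge> 1 \<Longrightarrow> norm ((T ^^ k) (x m)) \<le> C m / (1 + real k) powr \<alpha>"
      "\<And>m k. m \<ge> 1 \<Longrightarrow> norm (S k (x m)) \<le> C m / (1 + real k) powr \<alpha>"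
  shows "closure ((\<lambda>w. w 0) ` bi_orbits T \<alpha>) = UNIV"
proof -
  have bT: "bounded_linear T" using T unfolding K_bounded_linear_def by blast
  then have lT: "linear T" by (simp add: bounded_linear.linear)
  define V where "V = (\<lambda>w. w 0) ` bi_orbits T \<alpha>"
  define W where "W = {(T ^^ k) (x n) | k n. n \<ge> 1} \<union> {S k (x n) | k n. n \<ge> 1}"
  \<comment> \<open>The glued orbit reads its value at 0 from the branch of powers of T, so
    \<open>S 0 (x n)\<close> lies on it because it equals \<open>x n\<close>.\<close>
  have S0: "S 0 (x n) = x n" if "n \<ge> 1" for n
    using admissible_dataD(3)[OF adm that, of 0] by simp
  have WV: "W \<subseteq> V"
  proof
    fix y assume "y \<in> W"
    then obtain k n where n: "n \<ge> 1" and y: "y = (T ^^ k) (x n) \<or> y = S k (x n)"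
      unfolding W_def by blast
    define w where "w k = (if k \<ge> 0 then (T ^^ nat k) (x n) else S (nat (- k)) (x n))" for k :: int
    have w: "w \<in> bi_orbits T \<alpha>"
      using admissible_bi_orbit[OF adm n C(1)[OF n] C(2)[OF n]] unfolding w_def[abs_def] .
    have "w (int k) = (T ^^ k) (x n)" by (simp add: w_def)
    moreover have "w (- int k) = S k (x n)" using S0[OF n] by (cases "k = 0") (simp_all add: w_def)
    ultimately obtain j where j: "y = w (0 + j)" using y by (metis add_0)
    show "y \<in> V"
      unfolding V_def using bi_orbits_shift[OF w \<alpha>, of j] j
      by (intro image_eqI[where x="\<lambda>k. w (k + j)"])
  qed
  have JV: "J ` W \<subseteq> V" if cplx
  proof -
    have cs: "complex_structure J" using K that .
    have "norm (0 *\<^sub>R y + 1 *\<^sub>R J y) = sqrt (0\<^sup>2 + 1\<^sup>2) * norm y" for y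
      using cs unfolding complex_structure_def by blast
    then have "norm (J y) = norm y" for y by simp
    then have bJ: "bounded_linear J"
      using cs unfolding complex_structure_def
      by (intro bounded_linear_intro[where K=1]) (auto simp: linear_add linear_scale)
    have TJ: "T (J y) = J (T y)" for y
      using T that unfolding K_bounded_linear_def by blast
    have "(\<lambda>k. J (w k)) 0 \<in> V" if "w \<in> bi_orbits T \<alpha>" for w
      unfolding V_def by (rule imageI[OF bi_orbits_linear_image[OF bJ TJ that]])
    then have "J y \<in> V" if "y \<in> V" for y
      using that unfolding V_def by auto
    then show ?thesis using WV by blast
  qed
  have "subspace V" unfolding V_def by (rule subspace_bi_orbits_at_0[OF lT])
  then have "K_span cplx J W \<subseteq> V"
    unfolding K_span_def using WV JV by (cases cplx) (simp_all add: span_minimal)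
  moreover have "closure (K_span cplx J W) = UNIV"
    using admissible_dataD(5)[OF adm] unfolding W_def .
  ultimately show ?thesis
    using closure_mono[of "K_span cplx J W" V] unfolding V_def by auto
qed

text \<open>Picking one point of V in each basic open set that meets V keeps the countable set
  inside V.\<close>

lemma countable_dense_subset:
  fixes V :: "'a::second_countable_topology set"
  assumes V: "closure V = UNIV"
  obtains D where "countable D" "D \<subseteq> V" "closure D = UNIV"
proof -
  obtain B :: "'a set set" where B: "countable B" "topological_basis B"
    using ex_countable_basis by blast
  have "\<forall>b. \<exists>y. b \<inter> V \<noteq> {} \<longrightarrow> y \<in> b \<inter> V" by blast
  from choice[OF this] obtain h where h: "b \<inter> V \<noteq> {} \<Longrightarrow> h b \<in> b \<inter> V" for b by blast
  define D where "D = h ` {b \<in> B. b \<inter> V \<noteq> {}}"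
  have meet: "U \<inter> D \<noteq> {}" if U: "open U" "U \<noteq> {}" for U
  proof -
    have "U \<inter> V \<noteq> {}" using open_Int_closure_eq_empty[OF U(1), of V] V U(2) by simp
    then obtain y where y: "y \<in> U" "y \<in> V" by blast
    obtain b where b: "b \<in> B" "y \<in> b" "b \<subseteq> U"
      using topological_basisE[OF B(2) U(1) y(1)] by metis
    have "b \<inter> V \<noteq> {}" using b(2) y(2) by blast
    with h[OF this] b show ?thesis unfolding D_def by blast
  qed
  have "closure D = UNIV"
  proof (rule ccontr)
    assume "closure D \<noteq> UNIV"
    then have "- closure D \<noteq> {}" by blast
    moreover have "open (- closure D)" by (rule open_Compl[OF closed_closure])
    ultimately show False using meet closure_subset[of D] by blast
  qed
  moreover have "countable D" unfolding D_def using B(1) by simp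
  moreover have "D \<subseteq> V" unfolding D_def using h by blast
  ultimately show thesis using that by blast
qed

text \<open>Index 0 is reserved for the zero orbit: its symbol can carry most of the probability at
  no cost, so that all others may be as rare as needed. \<open>C 0 = 0\<close> records the same for
  the decay bound.\<close>

lemma countable_dense_bi_orbits:
  fixes T :: "'a::{banach, second_countable_topology} \<Rightarrow> 'a"
  assumes T: "linear T" and dense: "closure ((\<lambda>w. w 0) ` bi_orbits T \<alpha>) = UNIV"
  obtains v :: "nat \<Rightarrow> int \<Rightarrow> 'a" and C where "\<And>n k. T (v n k) = v n (k + 1)" "\<And>n. v n summable_on UNIV"
    "\<And>n k. norm (v n k) \<le> C n * (1 + \<bar>real_of_int k\<bar>) powr (- \<alpha>)" "\<And>n. C n \<ge> 0"
    "v 0 = (\<lambda>_. 0)" "C 0 = 0" "closure (range (\<lambda>n. v n 0)) = UNIV"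
proof -
  obtain D where D: "countable D" "D \<subseteq> (\<lambda>w. w 0) ` bi_orbits T \<alpha>" and clD: "closure D = UNIV"
    using countable_dense_subset[OF dense] by blast
  then have Dne: "D \<noteq> {}" by auto
  define v where "v n = (case n of 0 \<Rightarrow> (\<lambda>_. 0)
    | Suc i \<Rightarrow> (SOME w. w \<in> bi_orbits T \<alpha> \<and> w 0 = from_nat_into D i))" for n
  have vS: "v (Suc i) \<in> bi_orbits T \<alpha> \<and> v (Suc i) 0 = from_nat_into D i" for i
  proof -
    have "\<exists>w. w \<in> bi_orbits T \<alpha> \<and> w 0 = from_nat_into D i"
    proof -
      have "from_nat_into D i \<in> (\<lambda>w. w 0) ` bi_orbits T \<alpha>"
        using D(2) from_nat_into[OF Dne, of i] by blast
      then show ?thesis by (metis imageE)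
    qed
    from someI_ex[OF this] show ?thesis by (simp add: v_def)
  qed
  have v0: "v 0 = (\<lambda>_. 0)" by (simp add: v_def)
  have v: "v n \<in> bi_orbits T \<alpha>" for n
  proof (cases n)
    case 0
    then show ?thesis
      using linear_0[OF T] by (auto simp: v0 bi_orbits_def intro!: exI[of _ 0])
  qed (use vS in auto)
  then have "\<exists>C. \<forall>k. norm (v n k) \<le> C * (1 + \<bar>real_of_int k\<bar>) powr (- \<alpha>)" for n
    unfolding bi_orbits_def by blast
  then obtain C0 where C0: "norm (v n k) \<le> C0 n * (1 + \<bar>real_of_int k\<bar>) powr (- \<alpha>)" for n k
    by metis
  have C0n: "C0 n \<ge> 0" for n
    using C0[of n 0] norm_ge_zero[of "v n 0"] by (simp del: norm_ge_zero)
  have "D \<subseteq> range (\<lambda>n. v n 0)"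
  proof
    fix d assume "d \<in> D"
    then obtain i where "from_nat_into D i = d" using from_nat_into_surj[OF D(1)] by blast
    then have "d = v (Suc i) 0" using vS[of i] by simp
    then show "d \<in> range (\<lambda>n. v n 0)" by (rule range_eqI)
  qed
  then have "closure (range (\<lambda>n. v n 0)) = UNIV" using closure_mono[of D] clD by auto
  moreover have "norm (v n k) \<le> (C0(0 := 0)) n * (1 + \<bar>real_of_int k\<bar>) powr (- \<alpha>)" for n k
    using C0[of n k] by (auto simp: v0)
  ultimately show thesis
    using v C0n v0 by (intro that[of v "C0(0 := 0)"]) (simp_all add: bi_orbits_def)
qed

subsection \<open>Functions of independent variables\<close>

lemma integrable_mult_of_squares:
  fixes U V :: "'a \<Rightarrow> real"
  assumes [measurable]: "U \<in> borel_measurable M" "V \<in> borel_measurable M"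
    and U: "integrable M (\<lambda>x. (U x)\<^sup>2)" and V: "integrable M (\<lambda>x. (V x)\<^sup>2)"
  shows "integrable M (\<lambda>x. U x * V x)"
proof (rule Bochner_Integration.integrable_bound[where f="\<lambda>x. (U x)\<^sup>2 + (V x)\<^sup>2"])
  show "AE x in M. norm (U x * V x) \<le> norm ((U x)\<^sup>2 + (V x)\<^sup>2)"
  proof (intro AE_I2)
    fix x
    have "0 \<le> (\<bar>U x\<bar> - \<bar>V x\<bar>)\<^sup>2" by simp
    then have "2 * (\<bar>U x\<bar> * \<bar>V x\<bar>) \<le> (U x)\<^sup>2 + (V x)\<^sup>2"
      by (simp add: power2_eq_square algebra_simps)
    then have "\<bar>U x * V x\<bar> \<le> (U x)\<^sup>2 + (V x)\<^sup>2"
      using abs_ge_zero[of "U x * V x"] unfolding abs_mult by linarith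
    then show "norm (U x * V x) \<le> norm ((U x)\<^sup>2 + (V x)\<^sup>2)" by simp
  qed
qed (use U V in auto)

text \<open>Cauchy-Schwarz in terms of upper bounds for the two norms, from the weighted inequality
  |UV| \<le> b/(2a) U^2 + a/(2b) V^2. The slack s keeps a and b positive when a bound is 0, and is
  sent to 0 at the end.\<close>

lemma integral_mult_le_L2:
  fixes U V :: "'a \<Rightarrow> real"
  assumes [measurable]: "U \<in> borel_measurable M" "V \<in> borel_measurable M"
    and U: "integrable M (\<lambda>x. (U x)\<^sup>2)" and V: "integrable M (\<lambda>x. (V x)\<^sup>2)"
    and d: "(\<integral>x. (U x)\<^sup>2 \<partial>M) \<le> d\<^sup>2" "d \<ge> 0" and e: "(\<integral>x. (V x)\<^sup>2 \<partial>M) \<le> e\<^sup>2" "e \<ge> 0"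
  shows "\<bar>\<integral>x. U x * V x \<partial>M\<bar> \<le> d * e"
proof -
  have le: "\<bar>\<integral>x. U x * V x \<partial>M\<bar> \<le> (d + s) * (e + s)" if s: "s > 0" for s
  proof -
    define a b where "a = d + s" and "b = e + s"
    have ab: "a > 0" "b > 0" using d e s by (auto simp: a_def b_def)
    have "\<bar>\<integral>x. U x * V x \<partial>M\<bar> \<le> (\<integral>x. \<bar>U x * V x\<bar> \<partial>M)" by (rule integral_abs_bound)
    also have "\<dots> \<le> (\<integral>x. b / (2 * a) * (U x)\<^sup>2 + a / (2 * b) * (V x)\<^sup>2 \<partial>M)"
    proof (rule integral_mono)
      fix x
      have "0 \<le> (b * \<bar>U x\<bar> - a * \<bar>V x\<bar>)\<^sup>2" by simp
      then have "2 * (a * b) * \<bar>U x * V x\<bar> \<le> b\<^sup>2 * (U x)\<^sup>2 + a\<^sup>2 * (V x)\<^sup>2"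
        by (simp add: power2_diff power_mult_distrib abs_mult algebra_simps)
      then show "\<bar>U x * V x\<bar> \<le> b / (2 * a) * (U x)\<^sup>2 + a / (2 * b) * (V x)\<^sup>2"
        using ab by (simp add: field_simps power2_eq_square)
    qed (use U V integrable_mult_of_squares[OF assms(1-4)] in auto)
    also have "\<dots> = b / (2 * a) * (\<integral>x. (U x)\<^sup>2 \<partial>M) + a / (2 * b) * (\<integral>x. (V x)\<^sup>2 \<partial>M)"
      using U V by simp
    also have "\<dots> \<le> b / (2 * a) * a\<^sup>2 + a / (2 * b) * b\<^sup>2"
    proof (intro add_mono mult_left_mono)
      show "(\<integral>x. (U x)\<^sup>2 \<partial>M) \<le> a\<^sup>2"
        using d s by (intro order_trans[OF d(1)] power_mono) (auto simp: a_def)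
      show "(\<integral>x. (V x)\<^sup>2 \<partial>M) \<le> b\<^sup>2"
        using e s by (intro order_trans[OF e(1)] power_mono) (auto simp: b_def)
    qed (use ab in auto)
    also have "\<dots> = a * b" using ab by (simp add: power2_eq_square field_simps)
    finally show ?thesis by (simp add: a_def b_def)
  qed
  have "((\<lambda>s. (d + s) * (e + s)) \<longlongrightarrow> (d + 0) * (e + 0)) (at_right 0)"
    by (intro tendsto_intros)
  then have "\<bar>\<integral>x. U x * V x \<partial>M\<bar> \<le> (d + 0) * (e + 0)"
    by (rule tendsto_lowerbound) (auto intro!: eventually_at_right_less[THEN eventually_mono] le)
  then show ?thesis by simp
qed

section \<open>Product measures: reindexing, independence of disjoint blocks, covariance by
  resampling\<close>

abbreviation iid :: "'b measure \<Rightarrow> ('i \<Rightarrow> 'b) measure" where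
  "iid M \<equiv> PiM UNIV (\<lambda>_. M)"

definition depends_on :: "(('i \<Rightarrow> 'b) \<Rightarrow> 'c) \<Rightarrow> 'i set \<Rightarrow> bool" where
  "depends_on F A \<longleftrightarrow> (\<forall>w w'. (\<forall>i\<in>A. w i = w' i) \<longrightarrow> F w = F w')"

lemma depends_onD: "depends_on F A \<Longrightarrow> (\<And>i. i \<in> A \<Longrightarrow> w i = w' i) \<Longrightarrow> F w = F w'"
  unfolding depends_on_def by blast

lemma measurable_iid_reindex:
  "(\<lambda>w i. w (f i)) \<in> measurable (iid M) (iid M)"
  by (rule measurable_PiM_single') (auto simp: space_PiM)

lemma measurable_iid_component: "(\<lambda>w. w i) \<in> measurable (iid M) M"
  by (rule measurable_component_singleton) simp

lemma prob_space_iid: "prob_space M \<Longrightarrow> prob_space (iid M)"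
  by (rule prob_space_PiM)

text \<open>An injective f selects distinct coordinates, which are again i.i.d. The shift, the
  exchange of a coordinate with its copy and the choice of one version per coordinate all have this
  form.\<close>

lemma distr_iid_reindex:
  assumes "prob_space M" "inj f"
  shows "distr (iid M) (iid M) (\<lambda>w i. w (f i)) = iid M"
  using distr_PiM_reindex[of UNIV "\<lambda>_. M" f UNIV] assms by (simp add: restrict_def cong: if_cong)

lemma integral_iid_reindex:
  fixes F :: "('i \<Rightarrow> 'b) \<Rightarrow> 'c::{banach, second_countable_topology}"
  assumes M: "prob_space M" and f: "inj f" and F: "F \<in> borel_measurable (iid M)"
  shows "(\<integral>w. F (\<lambda>i. w (f i)) \<partial>(iid M)) = (\<integral>w. F w \<partial>(iid M))"
  using integral_distr[OF measurable_iid_reindex F, of f] distr_iid_reindex[OF M f] by simp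

lemma integrable_iid_reindex:
  fixes F :: "('i \<Rightarrow> 'b) \<Rightarrow> 'c::{banach, second_countable_topology}"
  assumes M: "prob_space M" and f: "inj f" and F: "F \<in> borel_measurable (iid M)"
  shows "integrable (iid M) (\<lambda>w. F (\<lambda>i. w (f i))) \<longleftrightarrow> integrable (iid M) F"
  using integrable_distr_eq[OF measurable_iid_reindex F, of f] distr_iid_reindex[OF M f] by simp

lemma indep_vars_iid_components:
  assumes M: "prob_space M"
  shows "prob_space.indep_vars (iid M) (\<lambda>_. M) (\<lambda>i w. w i) UNIV"
proof -
  interpret prob_space "iid M" by (rule prob_space_iid[OF M])
  have d: "distr (iid M) M (\<lambda>w. w i) = M" for i
    by (rule distr_PiM_component) (use M in auto)
  show ?thesis
    by (subst indep_vars_iff_distr_eq_PiM) (auto simp: d restrict_def distr_id2 cong: distr_cong)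
qed

text \<open>A function of the block \<open>A j\<close> is recovered from the restriction to
  \<open>A j\<close> by filling the other coordinates with a constant c, so the independence of
  restrictions to disjoint index sets carries over.\<close>

lemma indep_vars_iid_blocks:
  fixes F :: "'j \<Rightarrow> ('i \<Rightarrow> 'b) \<Rightarrow> real"
  assumes M: "prob_space M" and F: "\<And>j. F j \<in> borel_measurable (iid M)"
    and dep: "\<And>j. depends_on (F j) (A j)" and disj: "disjoint_family A"
  shows "prob_space.indep_vars (iid M) (\<lambda>_. borel) F UNIV"
proof -
  interpret prob_space "iid M" by (rule prob_space_iid[OF M])
  from prob_space.not_empty[OF M] obtain c where c: "c \<in> space M" by blast
  define ext where "ext j x = (\<lambda>i. if i \<in> A j then x i else c)" for j and x :: "'i \<Rightarrow> 'b"
  have ext: "ext j \<in> measurable (PiM (A j) (\<lambda>_. M)) (iid M)" for j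
  proof (rule measurable_PiM_single')
    show "(\<lambda>x. ext j x i) \<in> measurable (PiM (A j) (\<lambda>_. M)) M" for i
      unfolding ext_def using c by (cases "i \<in> A j") auto
    show "ext j \<in> space (PiM (A j) (\<lambda>_. M)) \<rightarrow> (\<Pi>\<^sub>E i\<in>UNIV. space M)"
      using c by (auto simp: ext_def space_PiM)
  qed
  have ind: "indep_vars (\<lambda>j. PiM (A j) (\<lambda>_. M)) (\<lambda>j w. restrict (\<lambda>i. w i) (A j)) UNIV"
    by (rule indep_vars_restrict[OF indep_vars_iid_components[OF M] _ disj]) auto
  have "indep_vars (\<lambda>_. borel) (\<lambda>j. (F j \<circ> ext j) \<circ> (\<lambda>w. restrict (\<lambda>i. w i) (A j))) UNIV"
    by (rule indep_vars_compose[OF ind measurable_comp[OF ext F]])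
  also have "(\<lambda>j. (F j \<circ> ext j) \<circ> (\<lambda>w. restrict (\<lambda>i. w i) (A j))) = F"
  proof (rule HOL.ext, rule HOL.ext)
    fix j w
    show "((F j \<circ> ext j) \<circ> (\<lambda>w. restrict (\<lambda>i. w i) (A j))) w = F j w"
      unfolding o_def by (rule depends_onD[OF dep[of j]]) (simp add: ext_def)
  qed
  finally show ?thesis .
qed

lemma indep_var_iid_blocks:
  fixes F G :: "('i \<Rightarrow> 'b) \<Rightarrow> real"
  assumes M: "prob_space M" and FG: "F \<in> borel_measurable (iid M)" "G \<in> borel_measurable (iid M)"
    and dep: "depends_on F A" "depends_on G B" and disj: "A \<inter> B = {}"
  shows "prob_space.indep_var (iid M) borel F borel G"
proof -
  interpret prob_space "iid M" by (rule prob_space_iid[OF M])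
  have m: "case_bool F G b \<in> borel_measurable (iid M)" for b
    by (cases b) (simp_all only: bool.case FG)
  have d: "depends_on (case_bool F G b) (case_bool A B b)" for b
    by (cases b) (simp_all only: bool.case dep)
  have dj: "disjoint_family (case_bool A B)"
    using disj by (simp add: disjoint_family_on_def UNIV_bool Int_commute)
  have y: "(\<lambda>_. borel) = (case_bool borel borel :: bool \<Rightarrow> real measure)"
    by (rule HOL.ext) (simp split: bool.split)
  show ?thesis unfolding indep_var_def using indep_vars_iid_blocks[OF M m d dj] unfolding y .
qed

text \<open>The pair \<open>(\<lambda>i. x (i, False), \<lambda>i. x (i, True))\<close> is a sequence together with an independent copy.
  Replacing the coordinates of the sequence by those of the copy one at a time interpolates between
  \<open>E (F G)\<close> and \<open>E F E G\<close>, and each step is antisymmetrized by exchanging the two versions of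
  the coordinate in question.\<close>

lemma iid_covariance_le:
  fixes F G :: "('i \<Rightarrow> 'b) \<Rightarrow> real"
  assumes M: "prob_space M"
    and F: "F \<in> borel_measurable (iid M)" and G: "G \<in> borel_measurable (iid M)"
    and F2: "integrable (iid M) (\<lambda>w. (F w)\<^sup>2)" and G2: "integrable (iid M) (\<lambda>w. (G w)\<^sup>2)"
    and A: "finite A" and dep: "depends_on G A"
    and d: "\<And>k. k \<in> A \<Longrightarrow> d k \<ge> 0" "\<And>k. k \<in> A \<Longrightarrow>
      (\<integral>x. (F (\<lambda>i. x (i, False)) - F (\<lambda>i. x (i, i = k)))\<^sup>2 \<partial>(iid M)) \<le> (d k)\<^sup>2"
    and e: "\<And>k. k \<in> A \<Longrightarrow> e k \<ge> 0" "\<And>k. k \<in> A \<Longrightarrow>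
      (\<integral>x. (G (\<lambda>i. x (i, False)) - G (\<lambda>i. x (i, i = k)))\<^sup>2 \<partial>(iid M)) \<le> (e k)\<^sup>2"
  shows "\<bar>(\<integral>w. F w * G w \<partial>(iid M)) - (\<integral>w. F w \<partial>(iid M)) * (\<integral>w. G w \<partial>(iid M))\<bar>
    \<le> (\<Sum>k\<in>A. d k * e k)"
proof -
  let ?Q = "iid M :: ('i \<times> bool \<Rightarrow> 'b) measure"
  interpret P: prob_space "iid M :: ('i \<Rightarrow> 'b) measure" by (rule prob_space_iid[OF M])
  interpret Q: prob_space ?Q by (rule prob_space_iid[OF M])
  define mrg where "mrg B x = (\<lambda>i. x (i, i \<in> B))" for B and x :: "'i \<times> bool \<Rightarrow> 'b"
  have inj: "inj (\<lambda>i. (i, i \<in> B))" for B :: "'i set" by (rule injI) simp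
  have mm: "mrg B \<in> measurable ?Q (iid M)" for B
    unfolding mrg_def by (rule measurable_iid_reindex)
  have [measurable]: "(\<lambda>x. F (mrg B x)) \<in> borel_measurable ?Q"
    "(\<lambda>x. G (mrg B x)) \<in> borel_measurable ?Q" for B
    using measurable_compose[OF mm F] measurable_compose[OF mm G] .
  \<comment> \<open>\<open>tw B\<close> exchanges the two versions of each coordinate in B. It is an
    injective reindexing, hence preserves the measure, and it changes the set of resampled
    coordinates by symmetric difference with B.\<close>
  define tw where "tw B = (\<lambda>(i, b). (i, if i \<in> B then \<not> b else b))" for B :: "'i set"
  have inj_tw: "inj (tw B)" for B by (rule injI) (auto simp: tw_def split: if_splits)
  have mrg_tw: "mrg B (\<lambda>z. x (tw C z)) = mrg ((B - C) \<union> (C - B)) x" for B C x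
    by (rule ext) (auto simp: mrg_def tw_def intro!: arg_cong[where f=x])
  have intQ: "(\<integral>x. H (mrg B x) \<partial>?Q) = (\<integral>w. H w \<partial>(iid M))"
    if "H \<in> borel_measurable (iid M)" for H :: "('i \<Rightarrow> 'b) \<Rightarrow> real" and B
    unfolding mrg_def by (rule integral_iid_reindex[OF M inj that])
  have itgQ: "integrable ?Q (\<lambda>x. H (mrg B x)) \<longleftrightarrow> integrable (iid M) H"
    if "H \<in> borel_measurable (iid M)" for H :: "('i \<Rightarrow> 'b) \<Rightarrow> real" and B
    unfolding mrg_def by (rule integrable_iid_reindex[OF M inj that])
  have FB2: "integrable ?Q (\<lambda>x. (F (mrg B x))\<^sup>2)" and GB2: "integrable ?Q (\<lambda>x. (G (mrg B x))\<^sup>2)" for B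
    using itgQ[OF borel_measurable_power[OF F, of 2], of B]
      itgQ[OF borel_measurable_power[OF G, of 2], of B] F2 G2 by simp_all
  have prodI: "integrable ?Q (\<lambda>x. F (mrg B x) * G (mrg C x))" for B C
    by (rule integrable_mult_of_squares[OF _ _ FB2 GB2]) measurable
  have prodI': "integrable ?Q (\<lambda>x. F (mrg B x) * (G (mrg C x) - G (mrg D x)))" for B C D
    unfolding right_diff_distrib by (intro Bochner_Integration.integrable_diff prodI)
  have sq: "integrable ?Q (\<lambda>x. (U x - V x)\<^sup>2)"
    if [measurable]: "U \<in> borel_measurable ?Q" "V \<in> borel_measurable ?Q"
      and "integrable ?Q (\<lambda>x. (U x)\<^sup>2)" "integrable ?Q (\<lambda>x. (V x)\<^sup>2)" for U V :: "_ \<Rightarrow> real"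
  proof -
    have "integrable ?Q (\<lambda>x. (U x)\<^sup>2 - 2 * (U x * V x) + (V x)\<^sup>2)"
      by (intro Bochner_Integration.integrable_add Bochner_Integration.integrable_diff
        integrable_mult_right integrable_mult_of_squares that)
    then show ?thesis by (simp add: power2_diff algebra_simps)
  qed
  \<comment> \<open>At the empty set this is the mean of FG; at A every coordinate that G reads
    comes from the copy, and the mean factors.\<close>
  define a where "a B = (\<integral>x. F (mrg {} x) * G (mrg B x) \<partial>?Q)" for B
  have step: "\<bar>a B - a (insert k B)\<bar> \<le> d k * e k" if k: "k \<in> A" "k \<notin> B" for k B
  proof -
    have "a B - a (insert k B) = (\<integral>x. F (mrg {} x) * (G (mrg B x) - G (mrg (insert k B) x)) \<partial>?Q)"
      unfolding a_def by (simp add: prodI right_diff_distrib)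
    moreover have "\<dots> = (\<integral>x. F (mrg {k} x) * (G (mrg (insert k B) x) - G (mrg B x)) \<partial>?Q)"
    proof -
      let ?H = "\<lambda>x. F (mrg {} x) * (G (mrg B x) - G (mrg (insert k B) x))"
      have "(\<integral>x. ?H x \<partial>?Q) = (\<integral>x. ?H (\<lambda>z. x (tw {k} z)) \<partial>?Q)"
        by (rule integral_iid_reindex[OF M inj_tw, symmetric]) measurable
      moreover have "B - {k} \<union> ({k} - B) = insert k B" "insert k B - {k} \<union> ({k} - insert k B) = B"
        using k by auto
      ultimately show ?thesis by (simp add: mrg_tw)
    qed
    \<comment> \<open>Exchanging the versions of coordinate k reverses the increment of G and
      resamples F. Adding the two expressions for the same quantity therefore leaves an increment of
      F times an increment of G.\<close>
    ultimately have "2 * (a B - a (insert k B)) =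
        (\<integral>x. F (mrg {} x) * (G (mrg B x) - G (mrg (insert k B) x)) \<partial>?Q)
        + (\<integral>x. F (mrg {k} x) * (G (mrg (insert k B) x) - G (mrg B x)) \<partial>?Q)" by simp
    also have "\<dots> = (\<integral>x. (F (mrg {} x) - F (mrg {k} x)) * (G (mrg B x) - G (mrg (insert k B) x)) \<partial>?Q)"
      unfolding Bochner_Integration.integral_add[OF prodI' prodI', symmetric]
      by (intro Bochner_Integration.integral_cong refl) (simp add: algebra_simps)
    finally have eq: "2 * (a B - a (insert k B)) = \<dots>" .
    have dF: "(\<integral>x. (F (mrg {} x) - F (mrg {k} x))\<^sup>2 \<partial>?Q) \<le> (d k)\<^sup>2"
      using d(2)[OF k(1)] by (simp add: mrg_def)
    \<comment> \<open>Exchanging the versions on B removes the base set, so the hypothesis on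
      resampling a single coordinate applies.\<close>
    have "(\<integral>x. (G (mrg B x) - G (mrg (insert k B) x))\<^sup>2 \<partial>?Q)
        = (\<integral>x. (G (mrg {} x) - G (mrg {k} x))\<^sup>2 \<partial>?Q)"
    proof -
      let ?H = "\<lambda>x. (G (mrg {} x) - G (mrg {k} x))\<^sup>2"
      have "(\<integral>x. ?H x \<partial>?Q) = (\<integral>x. ?H (\<lambda>z. x (tw B z)) \<partial>?Q)"
        by (rule integral_iid_reindex[OF M inj_tw, symmetric]) measurable
      moreover have "{k} - B \<union> (B - {k}) = insert k B" using k by auto
      ultimately show ?thesis by (simp add: mrg_tw)
    qed
    also have "\<dots> \<le> (e k)\<^sup>2" using e(2)[OF k(1)] by (simp add: mrg_def)
    finally have dG: "(\<integral>x. (G (mrg B x) - G (mrg (insert k B) x))\<^sup>2 \<partial>?Q) \<le> (e k)\<^sup>2" .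
    \<comment> \<open>The factor 1/2 gained by the symmetrization is given away.\<close>
    have "\<bar>a B - a (insert k B)\<bar> \<le> \<bar>2 * (a B - a (insert k B))\<bar>" by simp
    also have "\<dots> \<le> d k * e k"
      unfolding eq
      by (rule integral_mult_le_L2[OF _ _ _ _ dF d(1)[OF k(1)] dG e(1)[OF k(1)]])
        (measurable, (rule sq, measurable, (rule FB2 GB2)+)+)
    finally show ?thesis .
  qed
  have "\<bar>a {} - a B\<bar> \<le> (\<Sum>k\<in>B. d k * e k)" if "B \<subseteq> A" for B
    using finite_subset[OF that A] that
  proof (induction B rule: finite_induct)
    case (insert k B)
    then show ?case using step[of k B] by simp
  qed simp
  from this[of A] have "\<bar>a {} - a A\<bar> \<le> (\<Sum>k\<in>A. d k * e k)" by simp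
  moreover have "a {} = (\<integral>w. F w * G w \<partial>(iid M))"
    unfolding a_def by (rule intQ[OF borel_measurable_times[OF F G]])
  moreover have "a A = (\<integral>w. F w \<partial>(iid M)) * (\<integral>w. G w \<partial>(iid M))"
  proof -
    \<comment> \<open>G does not see the coordinates outside A, so it may be evaluated on the full
      copy, which is independent of the original sequence.\<close>
    have "G (mrg A x) = G (mrg UNIV x)" for x
      by (rule depends_onD[OF dep]) (simp add: mrg_def)
    then have "a A = (\<integral>x. F (mrg {} x) * G (mrg UNIV x) \<partial>?Q)" by (simp add: a_def)
    also have "\<dots> = (\<integral>x. F (mrg {} x) \<partial>?Q) * (\<integral>x. G (mrg UNIV x) \<partial>?Q)"
    proof (rule Q.indep_var_lebesgue_integral)
      have F1: "integrable (iid M) F"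
        by (rule P.square_integrable_imp_integrable[OF F F2])
      have G1: "integrable (iid M) G"
        by (rule P.square_integrable_imp_integrable[OF G G2])
      show "integrable ?Q (\<lambda>x. F (mrg {} x))" "integrable ?Q (\<lambda>x. G (mrg UNIV x))"
        using F1 G1 itgQ[OF F] itgQ[OF G] by auto
      have FD: "depends_on (\<lambda>x. F (mrg {} x)) (UNIV \<times> {False})"
        unfolding depends_on_def mrg_def by (auto intro!: arg_cong[where f=F])
      have GD: "depends_on (\<lambda>x. G (mrg UNIV x)) (UNIV \<times> {True})"
        unfolding depends_on_def mrg_def by (auto intro!: arg_cong[where f=G])
      show "Q.indep_var borel (\<lambda>x. F (mrg {} x)) borel (\<lambda>x. G (mrg UNIV x))"
        by (rule indep_var_iid_blocks[OF M _ _ FD GD])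
          (use measurable_compose[OF mm F] measurable_compose[OF mm G] in auto)
    qed
    also have "\<dots> = (\<integral>w. F w \<partial>(iid M)) * (\<integral>w. G w \<partial>(iid M))"
      using intQ[OF F] intQ[OF G] by simp
    finally show ?thesis .
  qed
  ultimately show ?thesis by simp
qed

subsection \<open>The law of the symbols\<close>

text \<open>Cauchy criterion for unordered sums: a sum over Y away from X is the difference of the
  sums over the union of X and Y and over X, both close to the limit.\<close>

lemma summable_on_imp_small_sums:
  fixes f :: "'i \<Rightarrow> 'a::real_normed_vector"
  assumes f: "f summable_on UNIV" and e: "e > 0"
  obtains X where "finite X" "\<And>Y. finite Y \<Longrightarrow> Y \<inter> X = {} \<Longrightarrow> norm (sum f Y) < e"
proof -
  from f obtain s where "(sum f \<longlongrightarrow> s) (finite_subsets_at_top UNIV)"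
    unfolding summable_on_def has_sum_def by blast
  then have "eventually (\<lambda>Y. dist (sum f Y) s < e / 2) (finite_subsets_at_top UNIV)"
    using e by (intro tendstoD) simp_all
  then obtain X where X: "finite X" "\<And>Y. finite Y \<Longrightarrow> X \<subseteq> Y \<Longrightarrow> dist (sum f Y) s < e / 2"
    unfolding eventually_finite_subsets_at_top by auto
  have "norm (sum f Y) < e" if Y: "finite Y" "Y \<inter> X = {}" for Y
  proof -
    have "sum f (X \<union> Y) = sum f X + sum f Y"
      using Y X(1) by (intro sum.union_disjoint) auto
    then have "norm (sum f Y) = dist (sum f (X \<union> Y)) (sum f X)" by (simp add: dist_norm)
    also have "\<dots> \<le> dist (sum f (X \<union> Y)) s + dist (sum f X) s" by (rule dist_triangle2)
    also have "\<dots> < e / 2 + e / 2" using X Y by (intro add_strict_mono) auto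
    finally show ?thesis by simp
  qed
  with X(1) show thesis by (rule that)
qed

text \<open>The converse half of the criterion: finite sets containing a common X have nearby sums,
  so the image of the filter of finite sets is Cauchy and converges by completeness.\<close>

lemma small_sums_imp_summable_on:
  fixes f :: "'i \<Rightarrow> 'a::banach"
  assumes small: "\<And>e. e > 0 \<Longrightarrow> \<exists>X. finite X \<and> (\<forall>Y. finite Y \<longrightarrow> Y \<inter> X = {} \<longrightarrow> norm (sum f Y) < e)"
  shows "f summable_on UNIV"
proof -
  have "\<exists>P. eventually P (finite_subsets_at_top UNIV) \<and>
      (\<forall>F F'. P F \<and> P F' \<longrightarrow> dist (sum f F) (sum f F') < e)" if e: "e > 0" for e
  proof -
    obtain X where X: "finite X" "\<And>Y. finite Y \<Longrightarrow> Y \<inter> X = {} \<Longrightarrow> norm (sum f Y) < e / 2"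
      using small[of "e / 2"] e by auto
    have near: "dist (sum f F) (sum f X) < e / 2" if "finite F" "X \<subseteq> F" for F
      using X(2)[of "F - X"] that X(1) by (simp add: dist_norm sum_diff Diff_disjoint Int_commute)
    have "dist (sum f F) (sum f F') < e" if "finite F \<and> X \<subseteq> F" "finite F' \<and> X \<subseteq> F'" for F F'
      using near[of F] near[of F'] that dist_triangle_half_r[of "sum f X" "sum f F" e "sum f F'"]
      by (auto simp: dist_commute)
    moreover have "eventually (\<lambda>F. finite F \<and> X \<subseteq> F) (finite_subsets_at_top UNIV)"
      unfolding eventually_finite_subsets_at_top using X(1) by (intro exI[of _ X]) simp
    ultimately show ?thesis by blast
  qed
  then have "cauchy_filter (filtermap (sum f) (finite_subsets_at_top UNIV))"
    by (simp add: cauchy_filter_metric_filtermap)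
  moreover have "uniform_space_class.complete (UNIV::'a set)"
    by (meson Cauchy_convergent UNIV_I complete_def convergent_def)
  ultimately obtain L where "(sum f \<longlongrightarrow> L) (finite_subsets_at_top UNIV)"
    using complete_uniform[where S=UNIV] by (force simp add: filterlim_def)
  then show ?thesis unfolding summable_on_def has_sum_def by blast
qed

lemma sum_half_powers_le:
  assumes "finite F" "F \<subseteq> {N..}"
  shows "(\<Sum>n\<in>F. (1/2::real) ^ n) \<le> 2 * (1/2) ^ N"
proof -
  have inj: "inj_on (\<lambda>n. n - N) F"
    by (rule inj_onI) (metis assms(2) atLeast_iff eq_diff_iff subsetD)
  have "(\<Sum>n\<in>F. (1/2::real) ^ n) = (\<Sum>n\<in>F. (1/2) ^ N * (1/2) ^ (n - N))"
    using assms(2) by (intro sum.cong refl) (auto simp flip: power_add)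
  also have "\<dots> = (1/2) ^ N * (\<Sum>i\<in>(\<lambda>n. n - N) ` F. (1/2) ^ i)"
    by (subst sum.reindex[OF inj]) (simp add: sum_distrib_left)
  also have "(\<Sum>i\<in>(\<lambda>n. n - N) ` F. (1/2::real) ^ i) \<le> (\<Sum>i. (1/2) ^ i)"
    using assms(1) by (intro sum_le_suminf) auto
  also have "(\<Sum>i. (1/2::real) ^ i) = 2" by (subst suminf_geometric) auto
  finally show ?thesis by simp
qed

lemma ex_pmf_below:
  fixes a :: "nat \<Rightarrow> real"
  assumes a: "\<And>n. a n > 0"
  obtains p :: "nat pmf" where "\<And>n. pmf p n > 0" "\<And>n. n \<ge> 1 \<Longrightarrow> pmf p n \<le> a n"
proof -
  \<comment> \<open>The cap keeps the total of the positive symbols at most 1/2, so that symbol 0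
    receives a positive rest.\<close>
  define b where "b n = min (a (Suc n)) ((1/2) ^ (n + 2))" for n
  have b: "b n > 0" "b n \<le> 1/2 * (1/2 * (1/2) ^ n)" for n using a by (auto simp: b_def)
  have h: "(\<lambda>n. 1/2 * (1/2 * (1/2::real) ^ n)) sums (1/2)"
    using sums_mult[OF power_half_series[unfolded power_Suc], of "1/2"] by simp
  have sb: "summable b"
    by (rule summable_comparison_test'[OF sums_summable[OF h]]) (use b in \<open>auto simp: less_imp_le\<close>)
  have le: "suminf b \<le> 1/2"
    using suminf_le[OF b(2) sb sums_summable[OF h]] sums_unique[OF h] by simp
  define q where "q n = (case n of 0 \<Rightarrow> 1 - suminf b | Suc i \<Rightarrow> b i)" for n
  have q: "q n > 0" for n using le b by (auto simp: q_def split: nat.split)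
  have qs: "q sums 1"
    using sums_Suc[of q "suminf b"] summable_sums[OF sb] by (simp add: q_def)
  have "(\<Sum>n. ennreal (q n)) = ennreal 1"
    by (rule suminf_ennreal_eq[OF less_imp_le[OF q] qs])
  then have one: "(\<integral>\<^sup>+x. q x \<partial>count_space UNIV) = 1"
    by (simp add: nn_integral_count_space_nat)
  have pm: "pmf (embed_pmf q) n = q n" for n
    by (rule pmf_embed_pmf[OF less_imp_le[OF q] one])
  have "q n \<le> a n" if "n \<ge> 1" for n using that by (cases n) (auto simp: q_def b_def)
  then show thesis using that[of "embed_pmf q"] q by (simp add: pm)
qed

text \<open>The Cauchy criterion gives a finite set X away from which sums are small. K is so large
  that the window contains X, and m adds the norms on X to the small remainder.\<close>

lemma orbit_tail_bounds:
  fixes w :: "int \<Rightarrow> 'a::real_normed_vector"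
  assumes w: "w summable_on UNIV" and e: "e > 0"
  shows "\<exists>K::nat. \<exists>m\<ge>0. (\<forall>A. finite A \<longrightarrow> norm (sum w A) \<le> m) \<and>
    (\<forall>A. finite A \<longrightarrow> A \<inter> {- int K..int K} = {} \<longrightarrow> norm (sum w A) \<le> e)"
proof -
  obtain X where X: "finite X" "\<And>Y. finite Y \<Longrightarrow> Y \<inter> X = {} \<Longrightarrow> norm (sum w Y) < e"
    using summable_on_imp_small_sums[OF w e] by blast
  define K where "K = (\<Sum>k\<in>X. nat \<bar>k\<bar>)"
  have "X \<subseteq> {- int K..int K}"
  proof
    fix k assume "k \<in> X"
    then have "nat \<bar>k\<bar> \<le> K" unfolding K_def using X(1) by (intro member_le_sum) auto
    then show "k \<in> {- int K..int K}" by auto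
  qed
  then have "norm (sum w A) \<le> e" if "finite A" "A \<inter> {- int K..int K} = {}" for A
    using X(2)[of A] that by force
  moreover have "norm (sum w A) \<le> (\<Sum>k\<in>X. norm (w k)) + e" if "finite A" for A
  proof -
    have "sum w A = sum w (A \<inter> X) + sum w (A - X)"
      using that by (metis sum.Int_Diff)
    also have "norm \<dots> \<le> (\<Sum>k\<in>A \<inter> X. norm (w k)) + norm (sum w (A - X))"
      by (intro norm_triangle_le add_mono norm_sum order_refl)
    also have "\<dots> \<le> (\<Sum>k\<in>X. norm (w k)) + e"
      using X(1) less_imp_le[OF X(2)[of "A - X"]] that by (intro add_mono sum_mono2) auto
    finally show ?thesis .
  qed
  moreover have "(\<Sum>k\<in>X. norm (w k)) + e \<ge> 0" using e by (simp add: add_nonneg_nonneg sum_nonneg)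
  ultimately show ?thesis by blast
qed

text \<open>The symbol \<open>n\<close> is bad when it occurs within distance \<open>K n\<close> of the origin; otherwise the \<open>n\<close>-th orbit
  contributes at most \<open>(1/2)^n\<close> to any partial sum. The probability of \<open>n\<close> is chosen so small that almost
  surely only finitely many symbols are bad, and \<open>V\<close> charges the bad ones enough to dominate their contribution.\<close>

lemma ex_symbol_law:
  fixes v :: "nat \<Rightarrow> int \<Rightarrow> 'a::{banach, second_countable_topology}" and C :: "nat \<Rightarrow> real"
  assumes v: "\<And>n. v n summable_on UNIV" "v 0 = (\<lambda>_. 0)" and C: "\<And>n. C n \<ge> 0" "C 0 = 0"
  obtains p V where "\<And>n. pmf p n > 0" "integrable (iid (measure_pmf p)) V"
    "AE w in iid (measure_pmf p). (\<lambda>k. v (w k) k) summable_on UNIV \<and>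
      (\<forall>A. finite A \<longrightarrow> exp (4 * norm (\<Sum>k\<in>A. v (w k) k)) \<le> V w) \<and> C (w 0) ^ 4 \<le> V w"
proof -
  have "\<forall>n. \<exists>K::nat. \<exists>m\<ge>0. (\<forall>A. finite A \<longrightarrow> norm (sum (v n) A) \<le> m) \<and>
    (\<forall>A. finite A \<longrightarrow> A \<inter> {- int K..int K} = {} \<longrightarrow> norm (sum (v n) A) \<le> (1/2) ^ n)"
    using orbit_tail_bounds[OF v(1)] by simp
  then obtain K :: "nat \<Rightarrow> nat" and m where m: "\<And>n. m n \<ge> 0"
    "\<And>n A. finite A \<Longrightarrow> norm (sum (v n) A) \<le> m n"
    "\<And>n A. finite A \<Longrightarrow> A \<inter> {- int (K n)..int (K n)} = {} \<Longrightarrow> norm (sum (v n) A) \<le> (1/2) ^ n"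
    by metis
  \<comment> \<open>2 bounds the joint contribution of the good symbols, a geometric series; the sum
    of m bounds that of all bad symbols when n is the largest of them; \<open>C n\<close> serves the
    claim about \<open>C (w 0)\<close>.\<close>
  define E where "E n = exp (4 * (2 + (\<Sum>i\<le>n. m i) + C n))" for n
  have E1: "E n \<ge> 1" for n
    unfolding E_def using m(1) C(1) by (simp add: sum_nonneg add_nonneg_nonneg)
  \<comment> \<open>There are 2 \<open>K n\<close> + 1 positions at which n is bad, so that happens
    with probability at most (1/2)^n / \<open>E n\<close>. Weighted by \<open>E n\<close> these
    probabilities are summable, which yields both the integrability of V and the Borel-Cantelli
    argument.\<close>
  define a where "a n = (1/2) ^ n / ((2 * real (K n) + 1) * E n)" for n
  have "a n > 0" for n using E1[of n] by (simp add: a_def)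
  then obtain p :: "nat pmf" where p: "\<And>n. pmf p n > 0" "\<And>n. n \<ge> 1 \<Longrightarrow> pmf p n \<le> a n"
    using ex_pmf_below by metis
  let ?P = "iid (measure_pmf p) :: (int \<Rightarrow> nat) measure"
  interpret P: prob_space ?P by (rule prob_space_iid) (rule measure_pmf.prob_space_axioms)
  interpret PP: product_prob_space "\<lambda>_::int. measure_pmf p" UNIV by unfold_locales
  define bad where "bad n = {w :: int \<Rightarrow> nat. n \<ge> 1 \<and> (\<exists>k\<in>{- int (K n)..int (K n)}. w k = n)}" for n
  have spP: "space ?P = UNIV" by (simp add: space_PiM)
  have single: "{w. w k = n} \<in> sets ?P" "measure ?P {w. w k = n} = pmf p n" for k :: int and n
  proof -
    have eq: "{w. w k = n} = (\<lambda>w. w k) -` {n} \<inter> space ?P" by (auto simp: spP)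
    show "{w. w k = n} \<in> sets ?P"
      unfolding eq by (rule measurable_sets[OF measurable_iid_component]) simp
    have "emeasure ?P {w \<in> space ?P. w k \<in> {n}} = emeasure (measure_pmf p) {n}"
      by (rule PP.emeasure_PiM_Collect_single) auto
    then show "measure ?P {w. w k = n} = pmf p n"
      by (simp add: spP measure_def pmf.rep_eq)
  qed
  have badU: "bad n = (\<Union>k\<in>{- int (K n)..int (K n)}. {w. w k = n})" if "n \<ge> 1" for n
    using that by (auto simp: bad_def)
  have bad0: "bad 0 = {}" by (auto simp: bad_def)
  have bad_meas [measurable]: "bad n \<in> sets ?P" for n
  proof (cases "n \<ge> 1")
    case True
    show ?thesis unfolding badU[OF True] by (intro sets.finite_UN single) simp
  qed (simp add: bad_def)
  have bad_prob: "E n * measure ?P (bad n) \<le> (1/2) ^ n" for n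
  proof (cases "n \<ge> 1")
    case True
    have "measure ?P (bad n) \<le> (\<Sum>k\<in>{- int (K n)..int (K n)}. measure ?P {w. w k = n})"
      unfolding badU[OF True] by (rule P.finite_measure_subadditive_finite) (auto simp: single)
    also have "\<dots> = (2 * real (K n) + 1) * pmf p n" by (simp add: single)
    also have "\<dots> \<le> (2 * real (K n) + 1) * a n" using p(2)[OF True] by (intro mult_left_mono) auto
    also have "\<dots> = (1/2) ^ n / E n"
    proof -
      have "c * (x / (c * y)) = x / y" if "c > 0" for c x y :: real using that by simp
      then show ?thesis unfolding a_def by simp
    qed
    finally have "E n * measure ?P (bad n) \<le> E n * ((1/2) ^ n / E n)"
      using E1[of n] by (intro mult_left_mono) auto
    then show ?thesis using E1[of n] by simp
  next
    case False
    then have "n = 0" by simp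
    then show ?thesis by (simp add: bad0)
  qed
  have sumE: "summable (\<lambda>n. E n * measure ?P (bad n))"
    by (rule summable_comparison_test'[OF complete_algebra_summable_geometric[of "1/2"]])
      (use bad_prob E1 in \<open>auto simp: abs_mult order_trans[OF zero_le_one]\<close>)
  have sumb: "summable (\<lambda>n. measure ?P (bad n))"
  proof (rule summable_comparison_test'[OF sumE])
    show "norm (measure ?P (bad n)) \<le> E n * measure ?P (bad n)" for n
      using mult_right_mono[OF E1[of n], of "measure ?P (bad n)"] by simp
  qed
  have evb: "AE w in ?P. eventually (\<lambda>n. w \<in> space ?P - bad n) sequentially"
    by (rule borel_cantelli_AE1) (auto simp: sumb P.emeasure_eq_measure)
  \<comment> \<open>exp 8 is the bound when no symbol is bad; otherwise the term of the largest bad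
    symbol alone suffices.\<close>
  define V where "V w = exp 8 + (\<Sum>n. E n * indicator (bad n) w)" for w
  have finsum: "finite {n. w \<in> bad n} \<Longrightarrow> summable (\<lambda>n. E n * indicator (bad n) w)" for w
    by (rule summable_finite[of "{n. w \<in> bad n}"]) (auto simp: indicator_def)
  have fin: "AE w in ?P. finite {n. w \<in> bad n}"
    using evb
  proof eventually_elim
    case (elim w)
    then obtain N where "\<And>n. n \<ge> N \<Longrightarrow> w \<notin> bad n" unfolding eventually_sequentially by auto
    then have "{n. w \<in> bad n} \<subseteq> {..<N}" by (auto simp: not_le[symmetric])
    then show ?case by (rule finite_subset) simp
  qed
  have "integrable ?P (\<lambda>w. \<Sum>n. E n * indicator (bad n) w)"
  proof (rule integrable_suminf)
    show "integrable ?P (\<lambda>w. E n * indicator (bad n) w)" for n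
      by (intro integrable_mult_right) (simp add: P.emeasure_eq_measure)
    show "AE w in ?P. summable (\<lambda>n. norm (E n * indicator (bad n) w))"
      using fin
    proof eventually_elim
      case (elim w)
      have "norm (E n * indicator (bad n) w) = E n * indicator (bad n) w" for n
        using E1[of n] by (simp add: abs_mult)
      then show ?case using finsum[OF elim] by simp
    qed
    have "(\<integral>w. norm (E n * indicator (bad n) w) \<partial>?P) = E n * measure ?P (bad n)" for n
      using E1[of n] by (simp add: abs_mult spP)
    then show "summable (\<lambda>n. \<integral>w. norm (E n * indicator (bad n) w) \<partial>?P)" using sumE by simp
  qed
  then have V_int: "integrable ?P V" unfolding V_def by simp
  have pw: "(\<lambda>k. v (w k) k) summable_on UNIV \<and>
      (\<forall>A. finite A \<longrightarrow> exp (4 * norm (\<Sum>k\<in>A. v (w k) k)) \<le> V w) \<and> C (w 0) ^ 4 \<le> V w"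
    if S: "finite {n. w \<in> bad n}" for w
  proof (intro conjI allI impI)
    \<comment> \<open>Grouping by symbol makes each group a finite partial sum of one orbit.\<close>
    define g where "g A n = (\<Sum>k\<in>{k\<in>A. w k = n}. v n k)" for A n
    have g_eq: "(\<Sum>k\<in>A. v (w k) k) = (\<Sum>n\<in>w ` A. g A n)" if "finite A" for A
      unfolding g_def by (subst sum.image_gen[OF that, of _ w]) (auto intro!: sum.cong)
    have g_good: "norm (g A n) \<le> (1/2) ^ n" if "finite A" "w \<notin> bad n" for A n
    proof (cases "n = 0")
      case False
      then show ?thesis
        unfolding g_def using that by (intro m(3)) (auto simp: bad_def)
    qed (simp add: g_def v(2))
    have g_bad: "norm (g A n) \<le> m n" if "finite A" for A n
      unfolding g_def using that by (intro m(2)) auto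
    have EV: "E n \<le> V w" if "w \<in> bad n" for n
    proof -
      have nn: "0 \<le> E i * indicator (bad i) w" for i
        using E1[of i] by (simp add: indicator_def)
      have "(\<Sum>i\<in>{n}. E i * indicator (bad i) w) \<le> (\<Sum>n. E n * indicator (bad n) w)"
        by (rule sum_le_suminf[OF finsum[OF S]]) (use nn in blast)+
      moreover have "(\<Sum>i\<in>{n}. E i * indicator (bad i) w) = E n" using that by simp
      moreover have "exp 8 \<ge> (0::real)" by simp
      ultimately show ?thesis unfolding V_def by linarith
    qed
    have V8: "exp 8 \<le> V w"
    proof -
      have "(\<Sum>n. E n * indicator (bad n) w) \<ge> 0"
        using E1 by (intro suminf_nonneg finsum[OF S]) (auto simp: indicator_def intro: order_trans[OF zero_le_one])
      then show ?thesis by (simp add: V_def)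
    qed
    show "exp (4 * norm (\<Sum>k\<in>A. v (w k) k)) \<le> V w" if A: "finite A" for A
    proof -
      have "norm (\<Sum>k\<in>A. v (w k) k) \<le> (\<Sum>n\<in>w ` A. norm (g A n))"
        unfolding g_eq[OF A] by (rule norm_sum)
      also have "\<dots> \<le> (\<Sum>n\<in>w ` A. (1/2) ^ n + (if w \<in> bad n then m n else 0))"
        using g_good[OF A] g_bad[OF A] by (intro sum_mono) (auto simp: add_increasing)
      also have "\<dots> = (\<Sum>n\<in>w ` A. (1/2) ^ n) + (\<Sum>n\<in>w ` A. if w \<in> bad n then m n else 0)"
        by (rule sum.distrib)
      also have "(\<Sum>n\<in>w ` A. (1/2::real) ^ n) \<le> 2"
        using sum_half_powers_le[of "w ` A" 0] A by simp
      also have "(\<Sum>n\<in>w ` A. if w \<in> bad n then m n else 0) = (\<Sum>n\<in>{n \<in> w ` A. w \<in> bad n}. m n)"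
        using A by (subst sum.inter_filter) auto
      also have "\<dots> \<le> (\<Sum>n\<in>{n. w \<in> bad n}. m n)"
        using S m(1) by (intro sum_mono2) auto
      finally have le: "norm (\<Sum>k\<in>A. v (w k) k) \<le> 2 + (\<Sum>n\<in>{n. w \<in> bad n}. m n)" by simp
      show ?thesis
      proof (cases "{n. w \<in> bad n} = {}")
        case True
        then have "exp (4 * norm (\<Sum>k\<in>A. v (w k) k)) \<le> exp 8" using le by simp
        then show ?thesis using V8 by linarith
      next
        case False
        define N where "N = Max {n. w \<in> bad n}"
        have N: "w \<in> bad N" using Max_in[OF S False] unfolding N_def by simp
        have "(\<Sum>n\<in>{n. w \<in> bad n}. m n) \<le> (\<Sum>n\<le>N. m n)"
          using S m(1) unfolding N_def by (intro sum_mono2) auto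
        then have "exp (4 * norm (\<Sum>k\<in>A. v (w k) k)) \<le> E N"
          using le C(1)[of N] unfolding E_def by simp
        then show ?thesis using EV[OF N] by linarith
      qed
    qed
    show "C (w 0) ^ 4 \<le> V w"
    proof (cases "w 0 = 0")
      case True
      then show ?thesis using C(2) V8 exp_ge_zero[of "8::real"] by (simp del: exp_ge_zero)
    next
      case False
      \<comment> \<open>Position 0 lies in every window, so a nonzero symbol there is bad.\<close>
      then have bd: "w \<in> bad (w 0)" by (auto simp: bad_def intro!: bexI[of _ 0])
      have "C (w 0) \<le> exp (C (w 0))" using exp_ge_add_one_self[of "C (w 0)"] by linarith
      then have "C (w 0) ^ 4 \<le> exp (C (w 0)) ^ 4" using C(1) by (intro power_mono)
      also have "\<dots> = exp (4 * C (w 0))" by (simp flip: exp_of_nat_mult)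
      also have "\<dots> \<le> E (w 0)"
        unfolding E_def using m(1) by (simp add: sum_nonneg add_nonneg_nonneg)
      also have "\<dots> \<le> V w" by (rule EV[OF bd])
      finally show ?thesis .
    qed
    show "(\<lambda>k. v (w k) k) summable_on UNIV"
    proof (rule small_sums_imp_summable_on)
      fix e :: real assume e: "e > 0"
      obtain N0 where N0: "2 * (1/2) ^ N0 < e / 2"
      proof -
        obtain n where "(1/2) ^ n < e / 4" using real_arch_pow_inv[of "e / 4" "1/2"] e by auto
        then have "2 * (1/2) ^ n < e / 2" by linarith
        then show thesis by (rule that)
      qed
      \<comment> \<open>N exceeds all bad symbols and makes the geometric tail smaller than e/2. The
        N symbols below it share the other half of e, whence the choice of \<delta>.\<close>
      define N where "N = N0 + Suc (\<Sum>n\<in>{n. w \<in> bad n}. n)"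
      have N: "n < N" if "w \<in> bad n" for n
        using member_le_sum[of n "{n. w \<in> bad n}" "\<lambda>n. n"] that S unfolding N_def by simp
      have "(1/2::real) ^ N \<le> (1/2) ^ N0" by (rule power_decreasing) (auto simp: N_def)
      then have N2: "2 * (1/2::real) ^ N < e / 2" using N0 by linarith
      define \<delta> where "\<delta> = e / (2 * real N)"
      have "N > 0" by (simp add: N_def)
      then have "\<delta> > 0" using e by (simp add: \<delta>_def)
      then have "\<forall>n. \<exists>X. finite X \<and> (\<forall>Y. finite Y \<longrightarrow> Y \<inter> X = {} \<longrightarrow> norm (sum (v n) Y) < \<delta>)"
        using summable_on_imp_small_sums[OF v(1)] by metis
      then obtain X where X: "\<And>n. finite (X n)"
        "\<And>n Y. finite Y \<Longrightarrow> Y \<inter> X n = {} \<Longrightarrow> norm (sum (v n) Y) < \<delta>" by metis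
      have "norm (\<Sum>k\<in>A. v (w k) k) < e" if A: "finite A" "A \<inter> (\<Union>n<N. X n) = {}" for A
      proof -
        have small: "norm (g A n) \<le> \<delta>" if "n < N" for n
          unfolding g_def using A that by (intro less_imp_le[OF X(2)]) auto
        have "norm (\<Sum>k\<in>A. v (w k) k) \<le> (\<Sum>n\<in>w ` A. norm (g A n))"
          unfolding g_eq[OF A(1)] by (rule norm_sum)
        also have "\<dots> = (\<Sum>n\<in>w ` A \<inter> {..<N}. norm (g A n)) + (\<Sum>n\<in>w ` A - {..<N}. norm (g A n))"
          using A by (intro sum.Int_Diff) auto
        also have "\<dots> \<le> (\<Sum>n\<in>{..<N}. \<delta>) + (\<Sum>n\<in>w ` A - {..<N}. (1/2) ^ n)"
        proof (rule add_mono)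
          have "(\<Sum>n\<in>w ` A \<inter> {..<N}. norm (g A n)) \<le> (\<Sum>n\<in>w ` A \<inter> {..<N}. \<delta>)"
            using small by (intro sum_mono) auto
          also have "\<dots> \<le> (\<Sum>n\<in>{..<N}. \<delta>)" using \<open>\<delta> > 0\<close> by (intro sum_mono2) auto
          finally show "(\<Sum>n\<in>w ` A \<inter> {..<N}. norm (g A n)) \<le> (\<Sum>n\<in>{..<N}. \<delta>)" .
          show "(\<Sum>n\<in>w ` A - {..<N}. norm (g A n)) \<le> (\<Sum>n\<in>w ` A - {..<N}. (1/2) ^ n)"
            using N by (intro sum_mono g_good A) auto
        qed
        also have "(\<Sum>n\<in>{..<N}. \<delta>) = e / 2" using \<open>N > 0\<close> by (simp add: \<delta>_def)
        also have "(\<Sum>n\<in>w ` A - {..<N}. (1/2::real) ^ n) \<le> 2 * (1/2) ^ N"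
          using A by (intro sum_half_powers_le) auto
        also have "e / 2 + 2 * (1/2::real) ^ N < e" using N2 by linarith
        finally show ?thesis by simp
      qed
      moreover have "finite (\<Union>n<N. X n)" using X(1) by blast
      ultimately show "\<exists>X. finite X \<and> (\<forall>Y. finite Y \<longrightarrow> Y \<inter> X = {} \<longrightarrow> norm (\<Sum>k\<in>Y. v (w k) k) < e)"
        by (intro exI[of _ "\<Union>n<N. X n"]) auto
    qed
  qed
  have "AE w in ?P. (\<lambda>k. v (w k) k) summable_on UNIV \<and>
      (\<forall>A. finite A \<longrightarrow> exp (4 * norm (\<Sum>k\<in>A. v (w k) k)) \<le> V w) \<and> C (w 0) ^ 4 \<le> V w"
    using fin by eventually_elim (rule pw)
  with p(1) V_int show thesis by (rule that)
qed

subsection \<open>Mixing of the Bernoulli shift\<close>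

lemma measure_iid_Int_indep:
  fixes A B :: "('i \<Rightarrow> 'b) set"
  assumes M: "prob_space M" and A: "A \<in> sets (iid M)" "depends_on (\<lambda>w. w \<in> A) J"
    and B: "B \<in> sets (iid M)" "depends_on (\<lambda>w. w \<in> B) L" and disj: "J \<inter> L = {}"
  shows "measure (iid M) (A \<inter> B) = measure (iid M) A * measure (iid M) B"
proof -
  interpret P: prob_space "iid M" by (rule prob_space_iid[OF M])
  let ?F = "indicator A :: _ \<Rightarrow> real" and ?G = "indicator B :: _ \<Rightarrow> real"
  have dep: "depends_on (indicator X :: _ \<Rightarrow> real) K" if "depends_on (\<lambda>w. w \<in> X) K"
    for X :: "('i \<Rightarrow> 'b) set" and K
    unfolding depends_on_def
  proof (intro allI impI)
    fix w w' :: "'i \<Rightarrow> 'b" assume "\<forall>i\<in>K. w i = w' i"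
    then have "(w \<in> X) = (w' \<in> X)" using that unfolding depends_on_def by blast
    then show "indicator X w = (indicator X w' :: real)" by (simp add: indicator_def)
  qed
  have "P.indep_var borel ?F borel ?G"
    by (rule indep_var_iid_blocks[OF M borel_measurable_indicator[OF A(1)]
      borel_measurable_indicator[OF B(1)] dep[OF A(2)] dep[OF B(2)] disj])
  then have "(\<integral>w. ?F w * ?G w \<partial>(iid M)) = (\<integral>w. ?F w \<partial>(iid M)) * (\<integral>w. ?G w \<partial>(iid M))"
    by (rule P.indep_var_lebesgue_integral)
      (intro integrable_real_indicator A(1) B(1), simp add: P.emeasure_eq_measure)+
  also have "(\<lambda>w. ?F w * ?G w) = indicator (A \<inter> B)"
    by (simp add: indicator_inter_arith fun_eq_iff)
  finally show ?thesis using A B sets.sets_into_space[OF A(1)] sets.sets_into_space[OF B(1)]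
    by (simp add: Int_absorb2 inf.absorb1 le_infI1)
qed

text \<open>The masses of the pieces are bounded uniformly in n by a summable sequence, so Tannery's
  theorem exchanges limit and sum. This is the union step of both inductions for mixing.\<close>

lemma (in finite_measure) tendsto_measure_disjoint_UN:
  fixes D :: "nat \<Rightarrow> nat \<Rightarrow> 'a set"
  assumes disj: "\<And>n. disjoint_family (\<lambda>i. D i n)" and D: "\<And>i n. D i n \<in> sets M"
    and le: "\<And>i n. measure M (D i n) \<le> b i" and b: "summable b"
    and lim: "\<And>i. (\<lambda>n. measure M (D i n)) \<longlonglongrightarrow> l i"
  shows "(\<lambda>n. measure M (\<Union>i. D i n)) \<longlonglongrightarrow> (\<Sum>i. l i)"
proof -
  have "measure M (\<Union>i. D i n) = (\<Sum>i. measure M (D i n))" for n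
    by (rule sums_unique[OF finite_measure_UNION]) (use D disj in auto)
  moreover have "(\<lambda>n. \<Sum>i. measure M (D i n)) \<longlonglongrightarrow> (\<Sum>i. l i)"
    by (rule tannerys_theorem[THEN conjunct2, THEN conjunct2, OF lim _ b])
      (use le in \<open>auto intro!: always_eventually\<close>)
  ultimately show ?thesis by simp
qed

text \<open>The sign is chosen so that T acting on the series becomes this shift: T moves the symbol
  at position k to position k + 1.\<close>

definition shift_seq :: "nat \<Rightarrow> (int \<Rightarrow> 'b) \<Rightarrow> int \<Rightarrow> 'b" where
  "shift_seq n w = (\<lambda>k. w (k - int n))"

lemma inj_shift: "inj (\<lambda>k::int. k - int n)"
  by (rule injI) simp

lemma measurable_shift: "shift_seq n \<in> measurable (iid M) (iid M)"
  using measurable_iid_reindex[where f="\<lambda>k. k - int n"] unfolding shift_seq_def[abs_def] .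

lemma distr_shift: "prob_space M \<Longrightarrow> distr (iid M) (iid M) (shift_seq n) = iid M"
  using distr_iid_reindex[OF _ inj_shift, of M n] unfolding shift_seq_def[abs_def] .

lemma measure_shift_vimage:
  assumes M: "prob_space M" and B: "B \<in> sets (iid M)"
  shows "measure (iid M) (shift_seq n -` B \<inter> space (iid M)) = measure (iid M) B"
  using measure_distr[OF measurable_shift B, of n] distr_shift[OF M, of n] by simp

text \<open>Events that read finitely many coordinates are independent once the shift separates
  them. The limit is extended first to arbitrary left events against a cylinder on the right, then
  to arbitrary right events, each time through complements and disjoint unions.\<close>

lemma iid_shift_mixing:
  fixes p :: "'b pmf" and A B :: "(int \<Rightarrow> 'b) set"
  assumes A: "A \<in> sets (iid (measure_pmf p))" and B: "B \<in> sets (iid (measure_pmf p))"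
  shows "(\<lambda>n. measure (iid (measure_pmf p)) (A \<inter> shift_seq n -` B))
    \<longlonglongrightarrow> measure (iid (measure_pmf p)) A * measure (iid (measure_pmf p)) B"
proof -
  let ?P = "iid (measure_pmf p) :: (int \<Rightarrow> 'b) measure"
  let ?G = "prod_algebra (UNIV :: int set) (\<lambda>_. measure_pmf p)"
  have Mp: "prob_space (measure_pmf p)" by (rule measure_pmf.prob_space_axioms)
  interpret P: prob_space ?P by (rule prob_space_iid[OF Mp])
  have sp: "space ?P = UNIV" by (simp add: space_PiM)
  have spE: "(\<Pi>\<^sub>E i\<in>(UNIV::int set). space (measure_pmf p)) = UNIV" by simp
  have sets_eq: "sets ?P = sigma_sets UNIV ?G" unfolding sets_PiM spE ..
  have GPow: "?G \<subseteq> Pow UNIV" by simp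
  have sv: "shift_seq n -` X \<in> sets ?P" if "X \<in> sets ?P" for n X
    using measurable_sets[OF measurable_shift that, of n] by (simp add: sp)
  have mv: "measure ?P (shift_seq n -` X) = measure ?P X" if "X \<in> sets ?P" for n X
    using measure_shift_vimage[OF Mp that, of n] by (simp add: sp)
  have cyl: "\<exists>J. finite J \<and> depends_on (\<lambda>w. w \<in> X) J" if "X \<in> ?G" for X
  proof -
    from prod_algebraE[OF that] obtain J E where
      J: "X = prod_emb UNIV (\<lambda>_. measure_pmf p) J (\<Pi>\<^sub>E j\<in>J. E j)" "finite J" by metis
    have "depends_on (\<lambda>w. w \<in> X) J"
      unfolding depends_on_def J(1) prod_emb_def by (auto simp: PiE_iff restrict_def extensional_def)
    with J(2) show ?thesis by blast
  qed
  define Q where "Q X Y \<longleftrightarrow> (\<lambda>n. measure ?P (X \<inter> shift_seq n -` Y)) \<longlonglongrightarrow> measure ?P X * measure ?P Y" for X Y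
  have Gs: "X \<in> sets ?P" if "X \<in> ?G" for X using that unfolding sets_eq by (rule sigma_sets.Basic)
  have base: "Q X Y" if X: "X \<in> ?G" and Y: "Y \<in> ?G" for X Y
  proof -
    obtain J L where J: "finite J" "depends_on (\<lambda>w. w \<in> X) J"
      and L: "finite L" "depends_on (\<lambda>w. w \<in> Y) L" using cyl[OF X] cyl[OF Y] by metis
    \<comment> \<open>A shift by more than twice a bound for the moduli of the coordinates involved
      separates J from the shifted L.\<close>
    define N where "N = nat (\<Sum>k\<in>J \<union> L. \<bar>k\<bar>) * 2 + 1"
    have bd: "\<bar>k\<bar> \<le> (\<Sum>k\<in>J \<union> L. \<bar>k\<bar>)" if "k \<in> J \<union> L" for k
      using that J L by (intro member_le_sum) auto
    have "measure ?P (X \<inter> shift_seq n -` Y) = measure ?P X * measure ?P Y" if n: "n \<ge> N" for n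
    proof -
      have dL: "depends_on (\<lambda>w. w \<in> shift_seq n -` Y) ((\<lambda>k. k - int n) ` L)"
        unfolding depends_on_def
      proof (intro allI impI)
        fix w w' :: "int \<Rightarrow> 'b" assume eq: "\<forall>i\<in>(\<lambda>k. k - int n) ` L. w i = w' i"
        show "(w \<in> shift_seq n -` Y) = (w' \<in> shift_seq n -` Y)"
          unfolding vimage_eq by (rule depends_onD[OF L(2)]) (use eq in \<open>auto simp: shift_seq_def\<close>)
      qed
      have dj: "J \<inter> (\<lambda>k. k - int n) ` L = {}"
      proof (rule ccontr)
        assume "J \<inter> (\<lambda>k. k - int n) ` L \<noteq> {}"
        then obtain k where "k \<in> L" "k - int n \<in> J" by blast
        then have "\<bar>k\<bar> \<le> (\<Sum>k\<in>J \<union> L. \<bar>k\<bar>)" "\<bar>k - int n\<bar> \<le> (\<Sum>k\<in>J \<union> L. \<bar>k\<bar>)"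
          using bd by blast+
        moreover have "int n \<ge> 2 * (\<Sum>k\<in>J \<union> L. \<bar>k\<bar>) + 1" using n unfolding N_def by linarith
        ultimately show False by linarith
      qed
      show ?thesis
        using measure_iid_Int_indep[OF Mp Gs[OF X] J(2) sv[OF Gs[OF Y]] dL dj] mv[OF Gs[OF Y]] by simp
    qed
    then show ?thesis unfolding Q_def
      by (intro tendsto_eventually) (auto simp: eventually_sequentially)
  qed
  have first: "Q X Y" if Y: "Y \<in> ?G" and X: "X \<in> sets ?P" for X Y
    using Int_stable_prod_algebra GPow X[unfolded sets_eq]
  proof (induction rule: sigma_sets_induct_disjoint)
    case (basic X)
    then show ?case by (rule base[OF _ Y])
  next
    case empty
    then show ?case by (simp add: Q_def)
  next
    case (compl X)
    have X: "X \<in> sets ?P" using compl(1) unfolding sets_eq .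
    have "measure ?P ((UNIV - X) \<inter> shift_seq n -` Y) = measure ?P Y - measure ?P (X \<inter> shift_seq n -` Y)" for n
    proof -
      have "measure ?P (shift_seq n -` Y - X) = measure ?P (shift_seq n -` Y) - measure ?P (shift_seq n -` Y \<inter> X)"
        by (rule P.finite_measure_Diff') (rule sv[OF Gs[OF Y]] X)+
      moreover have "(UNIV - X) \<inter> shift_seq n -` Y = shift_seq n -` Y - X" by blast
      ultimately show ?thesis using mv[OF Gs[OF Y]] by (simp add: Int_commute)
    qed
    moreover have "measure ?P (UNIV - X) = 1 - measure ?P X"
      using P.prob_compl[OF X] by (simp add: sp)
    ultimately show ?case
      using tendsto_diff[OF tendsto_const[of "measure ?P Y"] compl(2)[unfolded Q_def]]
      unfolding Q_def by (simp add: left_diff_distrib right_diff_distrib)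
  next
    case (union X)
    have X: "X i \<in> sets ?P" for i using union(2) unfolding sets_eq by blast
    have sm: "(\<lambda>i. measure ?P (X i)) sums measure ?P (\<Union>i. X i)"
      by (rule P.finite_measure_UNION) (use X union(1) in auto)
    have "(\<lambda>n. measure ?P (\<Union>i. X i \<inter> shift_seq n -` Y)) \<longlonglongrightarrow> (\<Sum>i. measure ?P (X i) * measure ?P Y)"
    proof (rule P.tendsto_measure_disjoint_UN[where b="\<lambda>i. measure ?P (X i)"])
      show "disjoint_family (\<lambda>i. X i \<inter> shift_seq n -` Y)" for n
        using union(1) unfolding disjoint_family_on_def by blast
      show "X i \<inter> shift_seq n -` Y \<in> sets ?P" for i n by (intro sets.Int X sv Gs Y)
      show "measure ?P (X i \<inter> shift_seq n -` Y) \<le> measure ?P (X i)" for i n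
        by (intro P.finite_measure_mono X) blast
      show "summable (\<lambda>i. measure ?P (X i))" using sm by (rule sums_summable)
      show "(\<lambda>n. measure ?P (X i \<inter> shift_seq n -` Y)) \<longlonglongrightarrow> measure ?P (X i) * measure ?P Y" for i
        using union(3)[of i] unfolding Q_def .
    qed
    moreover have "(\<Sum>i. measure ?P (X i) * measure ?P Y) = measure ?P (\<Union>i. X i) * measure ?P Y"
      using sums_unique[OF sums_mult2[OF sm, of "measure ?P Y"]] by simp
    moreover have "(\<Union>i. X i \<inter> shift_seq n -` Y) = (\<Union>i. X i) \<inter> shift_seq n -` Y" for n by blast
    ultimately show ?case unfolding Q_def by simp
  qed
  have "Q A Y" if "Y \<in> sets ?P" for Y
    using Int_stable_prod_algebra GPow that[unfolded sets_eq]
  proof (induction rule: sigma_sets_induct_disjoint)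
    case (basic Y)
    then show ?case by (rule first[OF _ A])
  next
    case empty
    then show ?case by (simp add: Q_def)
  next
    case (compl Y)
    have Y: "Y \<in> sets ?P" using compl(1) unfolding sets_eq .
    have "measure ?P (A \<inter> shift_seq n -` (UNIV - Y)) = measure ?P A - measure ?P (A \<inter> shift_seq n -` Y)" for n
    proof -
      have "measure ?P (A - shift_seq n -` Y) = measure ?P A - measure ?P (A \<inter> shift_seq n -` Y)"
        by (rule P.finite_measure_Diff') (rule sv[OF Y] A)+
      moreover have "A \<inter> shift_seq n -` (UNIV - Y) = A - shift_seq n -` Y" by blast
      ultimately show ?thesis by simp
    qed
    moreover have "measure ?P (UNIV - Y) = 1 - measure ?P Y"
      using P.prob_compl[OF Y] by (simp add: sp)
    ultimately show ?case
      using tendsto_diff[OF tendsto_const[of "measure ?P A"] compl(2)[unfolded Q_def]]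
      unfolding Q_def by (simp add: left_diff_distrib right_diff_distrib)
  next
    case (union Y)
    have Y: "Y i \<in> sets ?P" for i using union(2) unfolding sets_eq by blast
    have sm: "(\<lambda>i. measure ?P (Y i)) sums measure ?P (\<Union>i. Y i)"
      by (rule P.finite_measure_UNION) (use Y union(1) in auto)
    have "(\<lambda>n. measure ?P (\<Union>i. A \<inter> shift_seq n -` Y i)) \<longlonglongrightarrow> (\<Sum>i. measure ?P A * measure ?P (Y i))"
    proof (rule P.tendsto_measure_disjoint_UN[where b="\<lambda>i. measure ?P (Y i)"])
      show "disjoint_family (\<lambda>i. A \<inter> shift_seq n -` Y i)" for n
        using union(1) unfolding disjoint_family_on_def by blast
      show "A \<inter> shift_seq n -` Y i \<in> sets ?P" for i n by (intro sets.Int A sv Y)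
      \<comment> \<open>Invariance under the shift makes this bound independent of n.\<close>
      show "measure ?P (A \<inter> shift_seq n -` Y i) \<le> measure ?P (Y i)" for i n
        using P.finite_measure_mono[OF _ sv[OF Y], of "A \<inter> shift_seq n -` Y i" n i] mv[OF Y] by simp
      show "summable (\<lambda>i. measure ?P (Y i))" using sm by (rule sums_summable)
      show "(\<lambda>n. measure ?P (A \<inter> shift_seq n -` Y i)) \<longlonglongrightarrow> measure ?P A * measure ?P (Y i)" for i
        using union(3)[of i] unfolding Q_def .
    qed
    moreover have "(\<Sum>i. measure ?P A * measure ?P (Y i)) = measure ?P A * measure ?P (\<Union>i. Y i)"
      using sums_unique[OF sums_mult[OF sm, of "measure ?P A"]] by simp
    moreover have "(\<Union>i. A \<inter> shift_seq n -` Y i) = A \<inter> shift_seq n -` (\<Union>i. Y i)" for n by blast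
    ultimately show ?case unfolding Q_def by simp
  qed
  from this[OF B] show ?thesis unfolding Q_def .
qed

subsection \<open>The invariant measure\<close>

text \<open>Symmetric intervals eventually contain every finite set, so an unordered sum is also the
  limit of its symmetric partial sums.\<close>

lemma filterlim_symmetric_intervals:
  "filterlim (\<lambda>N. {- int N..int N}) (finite_subsets_at_top UNIV) sequentially"
  unfolding filterlim_finite_subsets_at_top
proof (intro allI impI)
  fix X :: "int set" assume "finite X \<and> X \<subseteq> UNIV"
  then have X: "finite X" by blast
  have "X \<subseteq> {- int N..int N}" if N: "N \<ge> (\<Sum>k\<in>X. nat \<bar>k\<bar>)" for N
  proof
    fix k assume "k \<in> X"
    then have "nat \<bar>k\<bar> \<le> (\<Sum>k\<in>X. nat \<bar>k\<bar>)" using X by (intro member_le_sum) auto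
    then show "k \<in> {- int N..int N}" using N by auto
  qed
  then show "\<forall>\<^sub>F N in sequentially. finite {- int N..int N} \<and> X \<subseteq> {- int N..int N} \<and> {- int N..int N} \<subseteq> UNIV"
    unfolding eventually_sequentially by auto
qed

text \<open>\<open>V_bounds\<close> controls all finite partial sums by one integrable function. It
  speaks of the size constant at the origin only; other positions are reached by reindexing the
  symbols.\<close>

locale orbit_process =
  fixes T :: "'a::{banach, second_countable_topology} \<Rightarrow> 'a" and v :: "nat \<Rightarrow> int \<Rightarrow> 'a"
    and C :: "nat \<Rightarrow> real" and \<alpha> :: real and p :: "nat pmf" and V :: "(int \<Rightarrow> nat) \<Rightarrow> real"
  assumes T: "bounded_linear T" and T_v: "\<And>n k. T (v n k) = v n (k + 1)"
    and v_le: "\<And>n k. norm (v n k) \<le> C n * (1 + \<bar>real_of_int k\<bar>) powr (- \<alpha>)"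
    and v_0: "v 0 = (\<lambda>_. 0)" and C_nonneg: "\<And>n. C n \<ge> 0"
    and dense: "closure (range (\<lambda>n. v n 0)) = UNIV"
    and p_pos: "\<And>n. pmf p n > 0"
    and V_int: "integrable (iid (measure_pmf p)) V"
    and V_bounds: "AE w in iid (measure_pmf p). (\<lambda>k. v (w k) k) summable_on UNIV \<and>
      (\<forall>A. finite A \<longrightarrow> exp (4 * norm (\<Sum>k\<in>A. v (w k) k)) \<le> V w) \<and> C (w 0) ^ 4 \<le> V w"
begin

abbreviation P :: "(int \<Rightarrow> nat) measure" where "P \<equiv> iid (measure_pmf p)"

lemma Mp: "prob_space (measure_pmf p)"
  by (rule measure_pmf.prob_space_axioms)

sublocale P: prob_space P
  by (rule prob_space_iid[OF Mp])

lemma space_P: "space P = UNIV"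
  by (simp add: space_PiM)

definition psum :: "int set \<Rightarrow> (int \<Rightarrow> nat) \<Rightarrow> 'a" where
  "psum A w = (\<Sum>k\<in>A. v (w k) k)"

text \<open>As a sequential limit of finite sums this is measurable; wherever the series converges
  unconditionally it equals the unordered sum.\<close>

definition \<Phi> :: "(int \<Rightarrow> nat) \<Rightarrow> 'a" where
  "\<Phi> w = lim (\<lambda>N. psum {- int N..int N} w)"

lemma measurable_symbol: "(\<lambda>w. h (w k)) \<in> measurable P borel" for h :: "nat \<Rightarrow> 'c::topological_space"
  by (rule measurable_compose[OF measurable_iid_component]) simp

lemma psum_measurable [measurable]: "psum A \<in> borel_measurable P"
  unfolding psum_def[abs_def] by (rule borel_measurable_sum) (rule measurable_symbol)

lemma Phi_measurable [measurable]: "\<Phi> \<in> borel_measurable P"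
  unfolding \<Phi>_def[abs_def] by (rule borel_measurable_lim_metric) (rule psum_measurable)

lemma has_sum_imp_Phi_eq:
  assumes "((\<lambda>k. v (w k) k) has_sum s) UNIV"
  shows "\<Phi> w = s" "(\<lambda>N. psum {- int N..int N} w) \<longlonglongrightarrow> s"
proof -
  show "(\<lambda>N. psum {- int N..int N} w) \<longlonglongrightarrow> s"
    using filterlim_compose[OF assms[unfolded has_sum_def] filterlim_symmetric_intervals]
    unfolding psum_def .
  then show "\<Phi> w = s" unfolding \<Phi>_def by (rule limI)
qed

text \<open>The pathwise form of \<open>V_bounds\<close>, named so that it can be transported to
  shifted and resampled sequences.\<close>

definition tame :: "(int \<Rightarrow> nat) \<Rightarrow> bool" where
  "tame w \<longleftrightarrow> (\<lambda>k. v (w k) k) summable_on UNIV \<and>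
      (\<forall>A. finite A \<longrightarrow> exp (4 * norm (psum A w)) \<le> V w) \<and> C (w 0) ^ 4 \<le> V w"

lemma AE_tame: "AE w in P. tame w"
  using V_bounds unfolding tame_def psum_def .

lemma tame_has_sum:
  assumes "tame w"
  shows "((\<lambda>k. v (w k) k) has_sum \<Phi> w) UNIV"
proof -
  from assms obtain s where s: "((\<lambda>k. v (w k) k) has_sum s) UNIV"
    unfolding tame_def summable_on_def by blast
  with has_sum_imp_Phi_eq(1)[OF s] show ?thesis by simp
qed

lemma tame_psum_tendsto: "tame w \<Longrightarrow> (\<lambda>N. psum {- int N..int N} w) \<longlonglongrightarrow> \<Phi> w"
  by (rule has_sum_imp_Phi_eq(2)[OF tame_has_sum])

lemma tame_psum_le: "tame w \<Longrightarrow> finite A \<Longrightarrow> exp (4 * norm (psum A w)) \<le> V w"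
  unfolding tame_def by blast

lemma tame_V_ge_1: "tame w \<Longrightarrow> V w \<ge> 1"
  using tame_psum_le[of w "{}"] by (simp add: psum_def)

lemma tame_Phi_le: "tame w \<Longrightarrow> exp (4 * norm (\<Phi> w)) \<le> V w"
  by (rule tendsto_upperbound[where F=sequentially and f="\<lambda>N. exp (4 * norm (psum {- int N..int N} w))"])
    (auto intro!: tendsto_intros tame_psum_tendsto always_eventually tame_psum_le)

lemma AE_reindex:
  assumes "inj f" and "AE w in P. Q w"
  shows "AE w in iid (measure_pmf p). Q (\<lambda>k. w (f k))"
proof -
  have "AE w in distr (iid (measure_pmf p)) P (\<lambda>w k. w (f k)). Q w"
    unfolding distr_iid_reindex[OF Mp assms(1)] by (rule assms(2))
  then show ?thesis by (rule AE_distrD[OF measurable_iid_reindex])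
qed

lemma T_power_v: "(T ^^ n) (v m k) = v m (k + int n)"
  by (induction n) (auto simp: T_v ac_simps)

lemma bounded_linear_T_power: "bounded_linear (T ^^ n)"
  by (induction n) (auto intro: bounded_linear_compose[OF T] bounded_linear_ident simp: o_def id_def)

text \<open>The power of T carries the term at k to k + n, and renaming positions gives the series
  of the shifted symbols. That series converges as the image of a convergent one, so tameness of w
  itself suffices.\<close>

lemma T_power_Phi:
  assumes w: "tame w"
  shows "(T ^^ n) (\<Phi> w) = \<Phi> (shift_seq n w)"
proof -
  have "((\<lambda>k. v (w k) (k + int n)) has_sum (T ^^ n) (\<Phi> w)) UNIV"
    using has_sum_bounded_linear[OF bounded_linear_T_power[of n] tame_has_sum[OF w]]
    by (simp add: T_power_v o_def)
  moreover have "bij_betw (\<lambda>k. k - int n) UNIV UNIV"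
    by (rule bij_betwI[where g="\<lambda>k. k + int n"]) auto
  ultimately have "((\<lambda>k. v (w (k - int n)) (k - int n + int n)) has_sum (T ^^ n) (\<Phi> w)) UNIV"
    using has_sum_reindex_bij_betw[of "\<lambda>k. k - int n" UNIV UNIV "\<lambda>k. v (w k) (k + int n)"] by simp
  then have "((\<lambda>k. v (shift_seq n w k) k) has_sum (T ^^ n) (\<Phi> w)) UNIV"
    by (simp add: shift_seq_def)
  from has_sum_imp_Phi_eq(1)[OF this] show ?thesis by simp
qed

section \<open>The law of the random series: invariance, mixing, full support\<close>

definition \<mu> :: "'a measure" where "\<mu> = distr P borel \<Phi>"

lemma sets_mu: "sets \<mu> = sets borel"
  by (simp add: \<mu>_def)

lemma space_mu: "space \<mu> = UNIV"
  by (simp add: \<mu>_def)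

lemma prob_space_mu: "prob_space \<mu>"
  unfolding \<mu>_def by (rule P.prob_space_distr) measurable

lemma T_power_measurable [measurable]: "T ^^ n \<in> borel_measurable borel"
  by (rule borel_measurable_continuous_onI) (rule linear_continuous_on[OF bounded_linear_T_power])

lemma measurable_shift_P: "shift_seq n \<in> measurable P P"
  by (rule measurable_shift)

lemma AE_T_power_Phi: "AE w in P. (T ^^ n) (\<Phi> w) = \<Phi> (shift_seq n w)"
  using AE_tame by eventually_elim (rule T_power_Phi)

lemma distr_T_power: "distr \<mu> borel (T ^^ n) = \<mu>"
proof -
  have "distr \<mu> borel (T ^^ n) = distr P borel ((T ^^ n) \<circ> \<Phi>)"
    unfolding \<mu>_def by (rule distr_distr) measurable
  also have "\<dots> = distr P borel (\<Phi> \<circ> shift_seq n)"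
  proof (rule distr_cong_AE)
    show "AE w in P. ((T ^^ n) \<circ> \<Phi>) w = (\<Phi> \<circ> shift_seq n) w" using AE_T_power_Phi[of n] by simp
    show "(T ^^ n) \<circ> \<Phi> \<in> borel_measurable P" by (rule measurable_comp[OF Phi_measurable]) measurable
    show "\<Phi> \<circ> shift_seq n \<in> borel_measurable P"
      by (rule measurable_comp[OF measurable_shift_P Phi_measurable])
  qed simp_all
  also have "\<dots> = distr (distr P P (shift_seq n)) borel \<Phi>"
    by (rule distr_distr[symmetric]) (rule Phi_measurable measurable_shift_P)+
  also have "\<dots> = \<mu>" unfolding \<mu>_def distr_shift[OF Mp] ..
  finally show ?thesis .
qed

lemma mu_invariant:
  assumes A: "A \<in> sets borel"
  shows "emeasure \<mu> (T -` A) = emeasure \<mu> A"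
proof -
  have "emeasure \<mu> A = emeasure (distr \<mu> borel (T ^^ 1)) A" by (simp only: distr_T_power)
  also have "\<dots> = emeasure \<mu> ((T ^^ 1) -` A \<inter> space \<mu>)"
    using T_power_measurable[of 1] A by (intro emeasure_distr) (simp_all add: \<mu>_def)
  finally show ?thesis by (simp add: space_mu)
qed

lemma measure_mu: "A \<in> sets borel \<Longrightarrow> measure \<mu> A = measure P (\<Phi> -` A)"
  unfolding \<mu>_def by (subst measure_distr) (simp_all add: space_P)

lemma mu_mixing:
  assumes A: "A \<in> sets borel" and B: "B \<in> sets borel"
  shows "(\<lambda>n. measure \<mu> (A \<inter> (T ^^ n) -` B)) \<longlonglongrightarrow> measure \<mu> A * measure \<mu> B"
proof -
  have PA: "\<Phi> -` X \<in> sets P" if "X \<in> sets borel" for X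
    using measurable_sets[OF Phi_measurable that] by (simp add: space_P)
  have TB: "(T ^^ n) -` B \<in> sets borel" for n
    using measurable_sets[OF T_power_measurable B, of n] by simp
  have "measure \<mu> (A \<inter> (T ^^ n) -` B) = measure P (\<Phi> -` A \<inter> shift_seq n -` (\<Phi> -` B))" for n
  proof -
    have "measure \<mu> (A \<inter> (T ^^ n) -` B) = measure P (\<Phi> -` (A \<inter> (T ^^ n) -` B))"
      by (rule measure_mu) (rule sets.Int[OF A TB])
    also have "\<dots> = measure P (\<Phi> -` A \<inter> shift_seq n -` (\<Phi> -` B))"
    proof (rule measure_eq_AE)
      show "AE w in P. (w \<in> \<Phi> -` (A \<inter> (T ^^ n) -` B)) = (w \<in> \<Phi> -` A \<inter> shift_seq n -` (\<Phi> -` B))"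
        using AE_T_power_Phi[of n] by eventually_elim simp
      show "\<Phi> -` (A \<inter> (T ^^ n) -` B) \<in> sets P" by (rule PA) (rule sets.Int[OF A TB])
      have "shift_seq n -` (\<Phi> -` B) \<in> sets P"
        using measurable_sets[OF measurable_shift_P PA[OF B], of n] by (simp add: space_P)
      then show "\<Phi> -` A \<inter> shift_seq n -` (\<Phi> -` B) \<in> sets P" by (rule sets.Int[OF PA[OF A]])
    qed
    finally show ?thesis .
  qed
  then show ?thesis
    using iid_shift_mixing[OF PA[OF A] PA[OF B]] by (simp add: measure_mu A B)
qed

text \<open>As the orbit of symbol 0 vanishes, writing 0 into the window deletes its terms:
  \<open>\<Phi> (cut K w)\<close> is the tail of the series, and it depends only on the symbols
  outside the window.\<close>

definition cut :: "nat \<Rightarrow> (int \<Rightarrow> nat) \<Rightarrow> int \<Rightarrow> nat" where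
  "cut K w = (\<lambda>k. if k \<in> {- int K..int K} then 0 else w k)"

lemma measurable_cut: "cut K \<in> measurable P P"
proof (rule measurable_PiM_single')
  show "(\<lambda>w. cut K w k) \<in> measurable P (measure_pmf p)" for k
    unfolding cut_def by (cases "k \<in> {- int K..int K}") (simp_all add: measurable_iid_component)
qed (simp add: space_PiM)

lemma tame_Phi_cut:
  assumes w: "tame w"
  shows "\<Phi> (cut K w) = \<Phi> w - psum {- int K..int K} w"
proof -
  let ?I = "{- int K..int K}"
  have "((\<lambda>k. - v (w k) k) has_sum (- psum ?I w)) ?I"
    using has_sum_finite[of ?I "\<lambda>k. - v (w k) k"] by (simp add: psum_def sum_negf)
  then have "((\<lambda>k. if k \<in> ?I then - v (w k) k else 0) has_sum (- psum ?I w)) UNIV"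
    by (subst has_sum_cong_neutral[where T="?I" and g="\<lambda>k. - v (w k) k"]) auto
  from has_sum_add[OF tame_has_sum[OF w] this]
  have "((\<lambda>k. v (cut K w k) k) has_sum (\<Phi> w - psum ?I w)) UNIV"
    unfolding diff_conv_add_uminus
    by (rule has_sum_cong[THEN iffD1, rotated]) (auto simp: cut_def v_0)
  from has_sum_imp_Phi_eq(1)[OF this] show ?thesis .
qed

text \<open>Some \<open>v n 0\<close> lies in U. Inside a window the symbol n is prescribed at 0 and
  the symbol 0 elsewhere; outside, the tail is asked to be small. The two events are independent,
  both have positive probability, and together they force the sum into U.\<close>

lemma mu_full_support:
  assumes U: "open U" "U \<noteq> {}"
  shows "emeasure \<mu> U > 0"
proof -
  have "U \<inter> range (\<lambda>n. v n 0) \<noteq> {}"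
    using open_Int_closure_eq_empty[OF U(1), of "range (\<lambda>n. v n 0)"] dense U(2) by simp
  then obtain n where n: "v n 0 \<in> U" by blast
  obtain e where e: "e > 0" "ball (v n 0) e \<subseteq> U" using openE[OF U(1) n] by blast
  define R where "R K = {w. norm (\<Phi> (cut K w)) < e}" for K
  have cutm: "(\<lambda>w. norm (\<Phi> (cut K w))) \<in> borel_measurable P" for K
    by (rule measurable_compose[OF measurable_compose[OF measurable_cut Phi_measurable] borel_measurable_norm])
  have Rs: "R K \<in> sets P" for K
    using borel_measurable_less[OF cutm borel_measurable_const[of e]] by (simp add: R_def space_P)
  \<comment> \<open>Otherwise almost every sequence would have no small tail at all, against the
    convergence of the series.\<close>
  have "\<exists>K. measure P (R K) > 0"
  proof (rule ccontr)
    assume "\<nexists>K. measure P (R K) > 0"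
    then have "measure P (R K) = 0" for K using measure_nonneg[of P "R K"] by (metis order_less_le)
    then have "AE w in P. w \<notin> R K" for K
      using Rs by (intro AE_not_in) (simp add: null_setsI P.emeasure_eq_measure)
    then have "AE w in P. \<forall>K. w \<notin> R K" by (simp add: AE_all_countable)
    then have "AE w in P. False"
      using AE_tame
    proof eventually_elim
      case (elim w)
      have "(\<lambda>K. norm (\<Phi> w - psum {- int K..int K} w)) \<longlonglongrightarrow> norm (\<Phi> w - \<Phi> w)"
        by (intro tendsto_intros tame_psum_tendsto elim)
      then have "eventually (\<lambda>K. norm (\<Phi> w - psum {- int K..int K} w) < e) sequentially"
        using e(1) by (intro order_tendstoD(2)) simp_all
      then obtain K where "norm (\<Phi> (cut K w)) < e"
        unfolding tame_Phi_cut[OF elim(2)] eventually_sequentially by blast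
      then show ?case using elim(1) by (simp add: R_def)
    qed
    then show False by simp
  qed
  then obtain K where K: "measure P (R K) > 0" by blast
  let ?I = "{- int K..int K}"
  define G where "G = {w. \<forall>k\<in>?I. w k \<in> (if k = 0 then {n} else {0})}"
  interpret PP: product_prob_space "\<lambda>_::int. measure_pmf p" UNIV by unfold_locales
  have Gm: "emeasure P G = (\<Prod>k\<in>?I. emeasure (measure_pmf p) (if k = 0 then {n} else {0}))"
    using PP.emeasure_PiM_Collect[of ?I "\<lambda>k. if k = 0 then {n} else {0}"] by (simp add: G_def space_P)
  have pos: "emeasure (measure_pmf p) (if k = 0 then {n} else {0}) \<noteq> 0" for k :: int
    using p_pos[of n] p_pos[of 0] by (simp add: emeasure_pmf_single)
  have "emeasure P G \<noteq> 0" unfolding Gm using pos by (simp add: prod_zero_iff)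
  then have Gpos: "measure P G > 0"
    using measure_nonneg[of P G] by (simp add: P.emeasure_eq_measure order_less_le)
  have Gs: "G \<in> sets P"
  proof -
    have "G = (\<Inter>k\<in>?I. (\<lambda>w. w k) -` (if k = 0 then {n} else {0}) \<inter> space P)"
      by (auto simp: G_def space_P)
    also have "\<dots> \<in> sets P"
      by (intro sets.finite_INT measurable_sets[OF measurable_iid_component]) auto
    finally show ?thesis .
  qed
  have "measure P (G \<inter> R K) = measure P G * measure P (R K)"
  proof (rule measure_iid_Int_indep[OF Mp Gs _ Rs])
    show "depends_on (\<lambda>w. w \<in> G) ?I" unfolding depends_on_def G_def by simp
    show "depends_on (\<lambda>w. w \<in> R K) (- ?I)"
      unfolding depends_on_def
    proof (intro allI impI)
      fix w w' :: "int \<Rightarrow> nat" assume "\<forall>i\<in>- ?I. w i = w' i"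
      then have "cut K w = cut K w'" by (auto simp: cut_def fun_eq_iff)
      then show "(w \<in> R K) = (w' \<in> R K)" by (simp add: R_def)
    qed
  qed auto
  then have "measure P (G \<inter> R K) > 0" using K Gpos by simp
  also have "measure P (G \<inter> R K) \<le> measure P (\<Phi> -` U)"
  proof (rule P.finite_measure_mono_AE)
    show "AE w in P. w \<in> G \<inter> R K \<longrightarrow> w \<in> \<Phi> -` U"
      using AE_tame
    proof eventually_elim
      case (elim w)
      show ?case
      proof
        assume w: "w \<in> G \<inter> R K"
        have "psum ?I w = (\<Sum>k\<in>?I. if k = 0 then v n 0 else 0)"
          unfolding psum_def using w by (intro sum.cong) (auto simp: G_def v_0 split: if_splits)
        also have "\<dots> = v n 0" by simp
        finally have "\<Phi> w = v n 0 + \<Phi> (cut K w)" using tame_Phi_cut[OF elim, of K] by simp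
        then show "w \<in> \<Phi> -` U" using w e(2) by (auto simp: R_def dist_norm)
      qed
    qed
    show "\<Phi> -` U \<in> sets P"
      using measurable_sets[OF Phi_measurable, of U] U(1) by (simp add: space_P)
  qed
  finally have "measure \<mu> U > 0" using U(1) by (simp add: measure_mu)
  then show ?thesis by (simp add: finite_measure.emeasure_eq_measure[OF prob_space.axioms(1)[OF prob_space_mu]])
qed

lemma integrable_exp_2_Phi: "integrable P (\<lambda>w. exp (2 * norm (\<Phi> w)))"
proof (rule Bochner_Integration.integrable_bound[OF V_int])
  show "(\<lambda>w. exp (2 * norm (\<Phi> w))) \<in> borel_measurable P" by measurable
  show "AE w in P. norm (exp (2 * norm (\<Phi> w))) \<le> norm (V w)"
    using AE_tame
  proof eventually_elim
    case (elim w)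
    have "exp (2 * norm (\<Phi> w)) \<le> exp (4 * norm (\<Phi> w))" by simp
    also have "\<dots> \<le> V w" by (rule tame_Phi_le[OF elim])
    finally show ?case using tame_V_ge_1[OF elim] by simp
  qed
qed

lemma good_measure_mu:
  assumes \<omega>: "\<forall>k. \<omega> k > 1"
  shows "good_measure \<omega> T \<mu>"
  unfolding good_measure_def
proof (intro conjI ballI allI impI)
  fix f :: "'a \<Rightarrow> real" assume f: "f \<in> E_omega \<omega>"
  obtain M where M: "M > 0" "\<And>x. \<bar>f x\<bar> \<le> M * exp (norm x)"
    "\<And>x y. \<bar>f x - f y\<bar> \<le> M * norm (x - y) * (exp (norm x) + exp (norm y))"
    using E_omega_growth[OF f \<omega>] by blast
  have fb: "f \<in> borel_measurable borel"
    by (rule borel_measurable_continuous_onI[OF continuous_of_exp_lipschitz[OF M(3)]])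
  then show "f \<in> borel_measurable \<mu>" by (simp add: \<mu>_def)
  have fP: "(\<lambda>w. f (\<Phi> w)) \<in> borel_measurable P" by (rule measurable_compose[OF Phi_measurable fb])
  have "integrable P (\<lambda>w. (f (\<Phi> w))\<^sup>2)"
  proof (rule Bochner_Integration.integrable_bound)
    show "integrable P (\<lambda>w. M\<^sup>2 * exp (2 * norm (\<Phi> w)))"
      by (rule integrable_mult_right) (rule integrable_exp_2_Phi)
    show "(\<lambda>w. (f (\<Phi> w))\<^sup>2) \<in> borel_measurable P" by (rule borel_measurable_power[OF fP])
    show "AE w in P. norm ((f (\<Phi> w))\<^sup>2) \<le> norm (M\<^sup>2 * exp (2 * norm (\<Phi> w)))"
    proof (rule AE_I2)
      fix w
      have "\<bar>f (\<Phi> w)\<bar>\<^sup>2 \<le> (M * exp (norm (\<Phi> w)))\<^sup>2" by (rule power_mono[OF M(2)]) simp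
      then show "norm ((f (\<Phi> w))\<^sup>2) \<le> norm (M\<^sup>2 * exp (2 * norm (\<Phi> w)))"
        by (simp add: power_mult_distrib abs_mult flip: exp_double)
    qed
  qed
  then show "integrable \<mu> (\<lambda>x. (f x)\<^sup>2)"
    unfolding \<mu>_def by (subst integrable_distr_eq) (auto intro: borel_measurable_power fb)
qed (use prob_space_mu sets_mu mu_invariant mu_full_support mu_mixing in auto)

end

subsection \<open>Convolution of power weights\<close>

text \<open>Comparison with the integral of z powr (- \<beta>) over [t, t + 1], expressed through an
  antiderivative and the mean value theorem.\<close>

lemma powr_neg_le_diff:
  fixes t \<beta> :: real
  assumes t: "t \<ge> 1" and \<beta>: "\<beta> > 0" "\<beta> \<noteq> 1"
  shows "(1 + t) powr (- \<beta>) \<le> (1 + t) powr (1 - \<beta>) / (1 - \<beta>) - t powr (1 - \<beta>) / (1 - \<beta>)"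
proof -
  have "\<exists>z. t < z \<and> z < 1 + t \<and> (1 + t) powr (1 - \<beta>) / (1 - \<beta>) - t powr (1 - \<beta>) / (1 - \<beta>)
      = (1 + t - t) * (z powr (- \<beta>))"
  proof (rule MVT2)
    fix x assume x: "t \<le> x" "x \<le> 1 + t"
    have "((\<lambda>x. x powr (1 - \<beta>)) has_real_derivative (1 - \<beta>) * x powr (1 - \<beta> - 1)) (at x)"
      using x t by (intro has_real_derivative_powr) simp
    from DERIV_cdivide[OF this, of "1 - \<beta>"]
    show "((\<lambda>x. x powr (1 - \<beta>) / (1 - \<beta>)) has_real_derivative x powr (- \<beta>)) (at x)"
      using \<beta> by simp
  qed simp
  then obtain z where z: "t < z" "z < 1 + t"
    "(1 + t) powr (1 - \<beta>) / (1 - \<beta>) - t powr (1 - \<beta>) / (1 - \<beta>) = z powr (- \<beta>)" by auto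
  have "(1 + t) powr (- \<beta>) \<le> z powr (- \<beta>)"
    using z t \<beta> by (intro powr_mono2') auto
  then show ?thesis using z(3) by simp
qed

lemma sum_powr_neg_le:
  fixes \<beta> :: real
  assumes ab: "1 \<le> a" "a \<le> b" and \<beta>: "\<beta> > 0" "\<beta> \<noteq> 1"
  shows "(\<Sum>t\<in>{a..<b}. (1 + real t) powr (- \<beta>))
    \<le> real b powr (1 - \<beta>) / (1 - \<beta>) - real a powr (1 - \<beta>) / (1 - \<beta>)"
  using ab(2)
proof (induction b rule: dec_induct)
  case (step b)
  then show ?case using powr_neg_le_diff[of "real b" \<beta>] ab(1) \<beta> by (simp add: ac_simps)
qed simp

text \<open>The integral comparison starts at t = 1, so the term t = 0, which is 1, is split
  off.\<close>

lemma sum_powr_neg_first_le: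
  fixes \<beta> :: real
  assumes n: "n \<ge> 1" and \<beta>: "\<beta> > 0" "\<beta> \<noteq> 1"
  shows "(\<Sum>t<n. (1 + real t) powr (- \<beta>)) \<le> 1 + real n powr (1 - \<beta>) / (1 - \<beta>) - 1 / (1 - \<beta>)"
proof -
  have "{..<n} = insert 0 {1..<n}" using n by auto
  then have "(\<Sum>t<n. (1 + real t) powr (- \<beta>)) = 1 + (\<Sum>t\<in>{1..<n}. (1 + real t) powr (- \<beta>))"
    by simp
  then show ?thesis using sum_powr_neg_le[of 1 n \<beta>] n \<beta> by simp
qed

lemma ln_2_ge_half: "ln (2::real) \<ge> 1/2"
proof -
  have "1 - 1 / 2 \<le> ln (2::real)" using ln_one_minus_pos_upper_bound[of "1/2"] by (simp add: ln_div)
  then show ?thesis by simp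
qed

text \<open>The factor 3 is generous: the start needs 1 \<le> 3 ln 2, and in the step 1/(n + 1) is
  at most three times 1/(n + 2), which is itself at most the increment of the logarithm.\<close>

lemma harmonic_le_ln:
  assumes n: "n \<ge> 1"
  shows "(\<Sum>t<n. (1 + real t) powr (- 1)) \<le> 3 * ln (real n + 1)"
  using n
proof (induction n rule: dec_induct)
  case base
  then show ?case using ln_2_ge_half by simp
next
  case (step n)
  have "1 - (real n + 1) / (real n + 2) \<le> - ln ((real n + 1) / (real n + 2))"
    using ln_le_minus_one[of "(real n + 1) / (real n + 2)"] by simp
  then have "1 / (real n + 2) \<le> ln (real n + 2) - ln (real n + 1)"
    by (simp add: ln_div field_simps)
  moreover have "1 / (1 + real n) \<le> 3 * (1 / (real n + 2))" using step by (simp add: field_simps)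
  moreover have "(\<Sum>t<Suc n. (1 + real t) powr (- 1))
      = (\<Sum>t<n. (1 + real t) powr (- 1)) + 1 / (1 + real n)" by (simp add: powr_minus_divide)
  moreover have "real (Suc n) + 1 = real n + 2" by simp
  ultimately show ?case using step.IH by (simp only:)
qed

text \<open>Every natural number is the modulus of at most two integers.\<close>

lemma sum_over_abs_le:
  fixes h :: "nat \<Rightarrow> real"
  assumes h: "\<And>t. h t \<ge> 0" and B: "finite B" "\<And>k. k \<in> B \<Longrightarrow> nat \<bar>k\<bar> < N"
  shows "(\<Sum>k\<in>B. h (nat \<bar>k\<bar>)) \<le> 2 * (\<Sum>t<N. h t)"
proof -
  have sub: "B \<subseteq> int ` {..<N} \<union> (\<lambda>t. - int t) ` {..<N}"
  proof
    fix k assume k: "k \<in> B"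
    then show "k \<in> int ` {..<N} \<union> (\<lambda>t. - int t) ` {..<N}"
      using B(2)[OF k] by (cases "k \<ge> 0") (auto intro!: image_eqI[of _ _ "nat \<bar>k\<bar>"])
  qed
  have "(\<Sum>k\<in>B. h (nat \<bar>k\<bar>)) \<le> (\<Sum>k\<in>int ` {..<N} \<union> (\<lambda>t. - int t) ` {..<N}. h (nat \<bar>k\<bar>))"
    by (rule sum_mono2[OF _ sub]) (auto simp: h)
  also have "\<dots> \<le> (\<Sum>k\<in>int ` {..<N}. h (nat \<bar>k\<bar>)) + (\<Sum>k\<in>(\<lambda>t. - int t) ` {..<N}. h (nat \<bar>k\<bar>))"
    by (subst sum_Un) (auto simp: h intro!: sum_nonneg)
  also have "\<dots> = 2 * (\<Sum>t<N. h t)"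
    by (subst (1 2) sum.reindex) (auto simp: inj_on_def)
  finally show ?thesis .
qed

text \<open>The larger of |k| and |k + n| is at least n/2. With t the smaller one, the term is at
  most \<open>h t\<close>. The sum of h below n is of order n powr (- \<alpha>) times a partial sum
  of the weights, the sum from n on of order n powr (1 - 2 \<alpha>); the dominant one gives the
  rate.\<close>

lemma convolution_powr_le:
  fixes \<alpha> :: real
  assumes \<alpha>: "\<alpha> > 1/2"
  obtains K where "K \<ge> 0" "\<And>n B. n \<ge> 1 \<Longrightarrow> finite B \<Longrightarrow>
    (\<Sum>k\<in>B. (1 + \<bar>real_of_int (k + int n)\<bar>) powr (- \<alpha>) * (1 + \<bar>real_of_int k\<bar>) powr (- \<alpha>))
      \<le> K * cov_rate \<alpha> n"
proof -
  define K0 where "K0 = (if \<alpha> < 1 then 2 powr \<alpha> / (1 - \<alpha>) + 1 / (2 * \<alpha> - 1)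
    else if \<alpha> = 1 then 8 else 2 powr \<alpha> * (1 + 1 / (\<alpha> - 1)) + 1 / (2 * \<alpha> - 1))"
  have K0: "K0 \<ge> 0" using \<alpha> by (auto simp: K0_def intro!: add_nonneg_nonneg mult_nonneg_nonneg)
  \<comment> \<open>The factor 4 counts the two choices of the index of smaller modulus and the two
    signs it may have.\<close>
  have main: "(\<Sum>k\<in>B. (1 + \<bar>real_of_int (k + int n)\<bar>) powr (- \<alpha>) * (1 + \<bar>real_of_int k\<bar>) powr (- \<alpha>))
      \<le> 4 * K0 * cov_rate \<alpha> n" if n: "n \<ge> 1" and B: "finite B" for n B
  proof -
    define h where "h t = (1 + real t) powr (- \<alpha>) * (1 + max (real n / 2) (real t)) powr (- \<alpha>)" for t
    have h0: "h t \<ge> 0" for t by (simp add: h_def)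
    have pt: "(1 + \<bar>real_of_int (k + int n)\<bar>) powr (- \<alpha>) * (1 + \<bar>real_of_int k\<bar>) powr (- \<alpha>)
        \<le> h (nat \<bar>k\<bar>) + h (nat \<bar>k + int n\<bar>)" for k
    proof (cases "\<bar>k\<bar> \<le> \<bar>k + int n\<bar>")
      case True
      then have "(1 + \<bar>real_of_int (k + int n)\<bar>) powr (- \<alpha>) \<le> (1 + max (real n / 2) \<bar>real_of_int k\<bar>) powr (- \<alpha>)"
        using \<alpha> by (intro powr_mono2') (auto simp: abs_if split: if_splits)
      then have "(1 + \<bar>real_of_int (k + int n)\<bar>) powr (- \<alpha>) * (1 + \<bar>real_of_int k\<bar>) powr (- \<alpha>) \<le> h (nat \<bar>k\<bar>)"
        unfolding h_def by (subst mult.commute) (simp add: mult_left_mono)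
      then show ?thesis using h0[of "nat \<bar>k + int n\<bar>"] by linarith
    next
      case False
      then have "(1 + \<bar>real_of_int k\<bar>) powr (- \<alpha>) \<le> (1 + max (real n / 2) \<bar>real_of_int (k + int n)\<bar>) powr (- \<alpha>)"
        using \<alpha> by (intro powr_mono2') (auto simp: abs_if split: if_splits)
      then have "(1 + \<bar>real_of_int (k + int n)\<bar>) powr (- \<alpha>) * (1 + \<bar>real_of_int k\<bar>) powr (- \<alpha>) \<le> h (nat \<bar>k + int n\<bar>)"
        unfolding h_def by (simp add: mult_left_mono)
      then show ?thesis using h0[of "nat \<bar>k\<bar>"] by linarith
    qed
    define N where "N = n + 1 + (\<Sum>k\<in>B. nat \<bar>k\<bar> + nat \<bar>k + int n\<bar>)"
    have bd: "nat \<bar>k\<bar> < N" "nat \<bar>k + int n\<bar> < N" if "k \<in> B" for k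
      using member_le_sum[of k B "\<lambda>k. nat \<bar>k\<bar> + nat \<bar>k + int n\<bar>"] that B unfolding N_def by simp_all
    have "(\<Sum>k\<in>B. (1 + \<bar>real_of_int (k + int n)\<bar>) powr (- \<alpha>) * (1 + \<bar>real_of_int k\<bar>) powr (- \<alpha>))
        \<le> (\<Sum>k\<in>B. h (nat \<bar>k\<bar>)) + (\<Sum>k\<in>B. h (nat \<bar>k + int n\<bar>))"
      unfolding sum.distrib[symmetric] by (rule sum_mono) (rule pt)
    also have "(\<Sum>k\<in>B. h (nat \<bar>k\<bar>)) \<le> 2 * (\<Sum>t<N. h t)"
      using h0 B bd by (intro sum_over_abs_le) auto
    also have "(\<Sum>k\<in>B. h (nat \<bar>k + int n\<bar>)) = (\<Sum>k\<in>(\<lambda>k. k + int n) ` B. h (nat \<bar>k\<bar>))"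
      by (subst sum.reindex) (auto simp: inj_on_def)
    also have "\<dots> \<le> 2 * (\<Sum>t<N. h t)"
      using h0 B bd by (intro sum_over_abs_le) auto
    also have "(\<Sum>t<N. h t) \<le> K0 * cov_rate \<alpha> n"
    proof -
      have "{..<N} = {..<n} \<union> {n..<N}" by (auto simp: N_def)
      then have "(\<Sum>t<N. h t) = (\<Sum>t<n. h t) + (\<Sum>t\<in>{n..<N}. h t)"
        by (simp add: sum.union_disjoint ivl_disj_int)
      also have "(\<Sum>t<n. h t) \<le> (\<Sum>t<n. (1 + real t) powr (- \<alpha>) * (real n / 2) powr (- \<alpha>))"
        unfolding h_def using n \<alpha> by (intro sum_mono mult_left_mono powr_mono2') auto
      also have "\<dots> = 2 powr \<alpha> * real n powr (- \<alpha>) * (\<Sum>t<n. (1 + real t) powr (- \<alpha>))"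
        by (simp add: sum_distrib_left powr_divide powr_minus field_simps)
      also have "(\<Sum>t\<in>{n..<N}. h t) \<le> (\<Sum>t\<in>{n..<N}. (1 + real t) powr (- (2 * \<alpha>)))"
      proof (rule sum_mono)
        fix t assume "t \<in> {n..<N}"
        then have "max (real n / 2) (real t) = real t" by auto
        then show "h t \<le> (1 + real t) powr (- (2 * \<alpha>))"
          by (simp add: h_def flip: powr_add)
      qed
      also have "\<dots> \<le> real N powr (1 - 2 * \<alpha>) / (1 - 2 * \<alpha>) - real n powr (1 - 2 * \<alpha>) / (1 - 2 * \<alpha>)"
        using n \<alpha> by (intro sum_powr_neg_le) (auto simp: N_def)
      also have "\<dots> \<le> 1 / (2 * \<alpha> - 1) * real n powr (1 - 2 * \<alpha>)"
      proof -
        have "real N powr (1 - 2 * \<alpha>) / (1 - 2 * \<alpha>) \<le> 0" using \<alpha> by (simp add: divide_nonneg_neg)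
        moreover have "- (real n powr (1 - 2 * \<alpha>) / (1 - 2 * \<alpha>)) = 1 / (2 * \<alpha> - 1) * real n powr (1 - 2 * \<alpha>)"
          using \<alpha> by (simp add: field_simps)
        ultimately show ?thesis by linarith
      qed
      finally have le: "(\<Sum>t<N. h t) \<le> 2 powr \<alpha> * real n powr (- \<alpha>) * (\<Sum>t<n. (1 + real t) powr (- \<alpha>))
          + 1 / (2 * \<alpha> - 1) * real n powr (1 - 2 * \<alpha>)" by simp
      consider "\<alpha> < 1" | "\<alpha> = 1" | "\<alpha> > 1" by linarith
      then show ?thesis
      proof cases
        case 1
        have "(\<Sum>t<n. (1 + real t) powr (- \<alpha>)) \<le> 1 + real n powr (1 - \<alpha>) / (1 - \<alpha>) - 1 / (1 - \<alpha>)"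
          using sum_powr_neg_first_le[OF n, of \<alpha>] 1 \<alpha> by simp
        also have "\<dots> \<le> real n powr (1 - \<alpha>) / (1 - \<alpha>)"
        proof -
          have "1 \<le> 1 / (1 - \<alpha>)" using 1 \<alpha> by simp
          then show ?thesis by linarith
        qed
        finally have "2 powr \<alpha> * real n powr (- \<alpha>) * (\<Sum>t<n. (1 + real t) powr (- \<alpha>))
            \<le> 2 powr \<alpha> * real n powr (- \<alpha>) * (real n powr (1 - \<alpha>) / (1 - \<alpha>))"
          by (intro mult_left_mono) auto
        also have "\<dots> = 2 powr \<alpha> / (1 - \<alpha>) * (real n powr (- \<alpha>) * real n powr (1 - \<alpha>))" by simp
        also have "real n powr (- \<alpha>) * real n powr (1 - \<alpha>) = real n powr (1 - 2 * \<alpha>)"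
          by (simp flip: powr_add)
        finally show ?thesis using le 1 by (simp add: K0_def cov_rate_def algebra_simps)
      next
        case 2
        \<comment> \<open>The part from n on is of order 1/n and is absorbed into the logarithmic
          term; the constant 8 is 6 from the first part plus 2 from this one.\<close>
        have ln1: "1 \<le> 2 * ln (real n + 1)"
        proof -
          have "ln 2 \<le> ln (real n + 1)" using n by simp
          then show ?thesis using ln_2_ge_half by linarith
        qed
        have "2 powr \<alpha> * real n powr (- \<alpha>) * (\<Sum>t<n. (1 + real t) powr (- \<alpha>))
            \<le> 2 * real n powr (- 1) * (3 * ln (real n + 1))"
          unfolding 2 using harmonic_le_ln[OF n] by (intro mult_mono) (auto intro: sum_nonneg)
        moreover have "real n powr (- 1) * 1 \<le> real n powr (- 1) * (2 * ln (real n + 1))"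
          using ln1 by (intro mult_left_mono) auto
        moreover have "1 / (2 * \<alpha> - 1) * real n powr (1 - 2 * \<alpha>) = real n powr (- 1)" by (simp add: 2)
        ultimately have "(\<Sum>t<N. h t) \<le> 8 * (ln (real n + 1) * real n powr (- 1))" using le by simp
        also have "real n powr (- 1) = 1 / real n" using n by (simp add: powr_minus_divide)
        finally show ?thesis by (simp add: K0_def cov_rate_def 2)
      next
        case 3
        have "(\<Sum>t<n. (1 + real t) powr (- \<alpha>)) \<le> 1 + real n powr (1 - \<alpha>) / (1 - \<alpha>) - 1 / (1 - \<alpha>)"
          using sum_powr_neg_first_le[OF n, of \<alpha>] 3 by simp
        also have "\<dots> \<le> 1 + 1 / (\<alpha> - 1)"
        proof -
          have "real n powr (1 - \<alpha>) / (1 - \<alpha>) \<le> 0" using 3 by (simp add: divide_nonneg_neg)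
          moreover have "- (1 / (1 - \<alpha>)) = 1 / (\<alpha> - 1)" using 3 by (simp add: field_simps)
          ultimately show ?thesis by linarith
        qed
        finally have "2 powr \<alpha> * real n powr (- \<alpha>) * (\<Sum>t<n. (1 + real t) powr (- \<alpha>))
            \<le> 2 powr \<alpha> * real n powr (- \<alpha>) * (1 + 1 / (\<alpha> - 1))"
          by (intro mult_left_mono) auto
        moreover have "1 / (2 * \<alpha> - 1) * real n powr (1 - 2 * \<alpha>) \<le> 1 / (2 * \<alpha> - 1) * real n powr (- \<alpha>)"
          using 3 n by (intro mult_left_mono powr_mono) auto
        ultimately show ?thesis using le 3 by (simp add: K0_def cov_rate_def algebra_simps)
      qed
    qed
    finally show ?thesis by simp
  qed
  show thesis by (rule that[of "4 * K0"]) (use K0 main in auto)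
qed

subsection \<open>Decay of covariances\<close>

text \<open>All that is retained of a function in \<open>E_omega\<close> from here on.\<close>

definition exp_lipschitz :: "real \<Rightarrow> ('a::real_normed_vector \<Rightarrow> real) \<Rightarrow> bool" where
  "exp_lipschitz M f \<longleftrightarrow> M > 0 \<and> (\<forall>x. \<bar>f x\<bar> \<le> M * exp (norm x)) \<and>
     (\<forall>x y. \<bar>f x - f y\<bar> \<le> M * norm (x - y) * (exp (norm x) + exp (norm y)))"

lemma E_omega_exp_lipschitz:
  assumes "f \<in> E_omega \<omega>" "\<forall>k. \<omega> k > 1"
  obtains M where "exp_lipschitz M f"
  using E_omega_growth[OF assms] unfolding exp_lipschitz_def by metis

lemma exp_lipschitz_borel: "exp_lipschitz M f \<Longrightarrow> f \<in> borel_measurable borel"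
  unfolding exp_lipschitz_def
  by (intro borel_measurable_continuous_onI continuous_of_exp_lipschitz[of f M]) blast

lemma exp_lipschitz_tendsto:
  assumes "exp_lipschitz M f" "(X \<longlongrightarrow> x) F"
  shows "((\<lambda>n. f (X n)) \<longlongrightarrow> f x) F"
proof -
  have "continuous_on UNIV f"
    using assms(1) continuous_of_exp_lipschitz[of f M] unfolding exp_lipschitz_def by blast
  then show ?thesis using continuous_on_tendsto_compose[OF _ assms(2), of UNIV f] by simp
qed

text \<open>It separates the size constants of the symbols from the exponentials and leaves fourth
  powers, each of which V dominates along a suitable reindexing.\<close>

lemma square_of_product_le:
  fixes a b c d :: real
  shows "((a + b) * (c + d))\<^sup>2 \<le> 4 * (a ^ 4 + b ^ 4 + c ^ 4 + d ^ 4)"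
proof -
  have sq: "(x + y)\<^sup>2 \<le> 2 * (x\<^sup>2 + y\<^sup>2)" for x y :: real
    using zero_le_power2[of "x - y"] by (simp add: power2_sum power2_diff)
  have am: "2 * (x * y) \<le> x\<^sup>2 + y\<^sup>2" for x y :: real
    using zero_le_power2[of "x - y"] by (simp add: power2_diff)
  have "((a + b) * (c + d))\<^sup>2 \<le> (2 * (a\<^sup>2 + b\<^sup>2)) * (2 * (c\<^sup>2 + d\<^sup>2))"
    unfolding power_mult_distrib by (intro mult_mono sq) auto
  also have "\<dots> = 2 * (2 * ((a\<^sup>2 + b\<^sup>2) * (c\<^sup>2 + d\<^sup>2)))" by (simp only: mult_ac)
  also have "\<dots> \<le> 2 * ((a\<^sup>2 + b\<^sup>2)\<^sup>2 + (c\<^sup>2 + d\<^sup>2)\<^sup>2)" by (intro mult_left_mono am) simp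
  also have "\<dots> \<le> 2 * (2 * ((a\<^sup>2)\<^sup>2 + (b\<^sup>2)\<^sup>2) + 2 * ((c\<^sup>2)\<^sup>2 + (d\<^sup>2)\<^sup>2))"
    by (intro mult_left_mono add_mono sq) auto
  also have "\<dots> = 4 * (a ^ 4 + b ^ 4 + c ^ 4 + d ^ 4)" by (simp flip: power_mult)
  finally show ?thesis .
qed

section \<open>Truncated observables and the influence of one symbol\<close>

context orbit_process
begin

definition wt :: "int \<Rightarrow> real" where "wt k = (1 + \<bar>real_of_int k\<bar>) powr (- \<alpha>)"

lemma wt_nonneg: "wt k \<ge> 0"
  by (simp add: wt_def)

text \<open>\<open>obs f A j\<close> is \<open>f \<circ> T^j\<close> evaluated on the random series, truncated to those terms that \<open>T^j\<close> moves into
  the window \<open>A\<close>.\<close>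

definition obs :: "('a \<Rightarrow> real) \<Rightarrow> int set \<Rightarrow> nat \<Rightarrow> (int \<Rightarrow> nat) \<Rightarrow> real" where
  "obs f A j w = f (psum A (shift_seq j w))"

text \<open>The size of one influence: \<open>obs_oscillation\<close> produces 4 M^2 times the
  squared weight times four integrals of V, and this is its square root without the weight.\<close>

definition \<kappa> :: "real \<Rightarrow> real" where "\<kappa> M = 4 * M * sqrt (\<integral>w. V w \<partial>P)"

lemma V_measurable: "V \<in> borel_measurable P"
  using V_int by simp

lemma V_reindex:
  assumes "inj f"
  shows "integrable (iid (measure_pmf p)) (\<lambda>x. V (\<lambda>i. x (f i)))"
    "(\<integral>x. V (\<lambda>i. x (f i)) \<partial>(iid (measure_pmf p))) = (\<integral>w. V w \<partial>P)"
  using integrable_iid_reindex[OF Mp assms V_measurable] integral_iid_reindex[OF Mp assms V_measurable] V_int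
  by simp_all

lemma V_shift: "integrable P (\<lambda>w. V (shift_seq j w))" "(\<integral>w. V (shift_seq j w) \<partial>P) = (\<integral>w. V w \<partial>P)"
  using V_reindex[OF inj_shift, of j] unfolding shift_seq_def by simp_all

lemma AE_tame_shift: "AE w in P. tame (shift_seq j w)"
  using AE_reindex[OF inj_shift AE_tame, of j] unfolding shift_seq_def .

lemma EV_nonneg: "(\<integral>w. V w \<partial>P) \<ge> 0"
proof (rule integral_nonneg_AE)
  show "AE w in P. 0 \<le> V w" using AE_tame by eventually_elim (use tame_V_ge_1 in force)
qed

lemma kappa_nonneg: "M > 0 \<Longrightarrow> \<kappa> M \<ge> 0"
  using EV_nonneg by (simp add: \<kappa>_def)

lemma obs_measurable: "exp_lipschitz M f \<Longrightarrow> obs f A j \<in> borel_measurable P"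
  unfolding obs_def[abs_def]
  by (rule measurable_compose[OF measurable_compose[OF measurable_shift_P psum_measurable] exp_lipschitz_borel])

lemma obs_depends_on: "depends_on (obs f A j) ((\<lambda>k. k - int j) ` A)"
  unfolding depends_on_def obs_def psum_def shift_seq_def by (auto intro!: arg_cong[where f=f] sum.cong)

text \<open>The bounds do not involve the window A, so they dominate all truncations at
  once.\<close>

lemma abs_obs_le:
  assumes "exp_lipschitz M f" "tame (shift_seq j w)" "finite A"
  shows "\<bar>obs f A j w\<bar> \<le> M * V (shift_seq j w)" "(obs f A j w)\<^sup>2 \<le> M\<^sup>2 * V (shift_seq j w)"
proof -
  let ?a = "norm (psum A (shift_seq j w))"
  have M: "M > 0" and f: "\<bar>obs f A j w\<bar> \<le> M * exp ?a"
    using assms(1) unfolding exp_lipschitz_def obs_def by blast+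
  have V: "exp (4 * ?a) \<le> V (shift_seq j w)" by (rule tame_psum_le[OF assms(2,3)])
  have "exp ?a \<le> V (shift_seq j w)" by (rule order_trans[OF _ V]) simp
  then have "M * exp ?a \<le> M * V (shift_seq j w)" using M by simp
  then show "\<bar>obs f A j w\<bar> \<le> M * V (shift_seq j w)" using f by linarith
  have "(obs f A j w)\<^sup>2 \<le> (M * exp ?a)\<^sup>2" using power_mono[OF f, of 2] by simp
  also have "\<dots> = M\<^sup>2 * exp (2 * ?a)" by (simp add: power_mult_distrib flip: exp_double)
  also have "\<dots> \<le> M\<^sup>2 * exp (4 * ?a)" by (intro mult_left_mono) auto
  also have "\<dots> \<le> M\<^sup>2 * V (shift_seq j w)" using V by (intro mult_left_mono) auto
  finally show "(obs f A j w)\<^sup>2 \<le> M\<^sup>2 * V (shift_seq j w)" .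
qed

lemma obs_square_integrable:
  assumes f: "exp_lipschitz M f" and A: "finite A"
  shows "integrable P (\<lambda>w. (obs f A j w)\<^sup>2)"
proof (rule Bochner_Integration.integrable_bound)
  show "integrable P (\<lambda>w. M\<^sup>2 * V (shift_seq j w))" by (rule integrable_mult_right[OF V_shift(1)])
  show "(\<lambda>w. (obs f A j w)\<^sup>2) \<in> borel_measurable P" by (rule borel_measurable_power[OF obs_measurable[OF f]])
  show "AE w in P. norm ((obs f A j w)\<^sup>2) \<le> norm (M\<^sup>2 * V (shift_seq j w))"
    using AE_tame_shift[of j]
  proof eventually_elim
    case (elim w)
    have "(obs f A j w)\<^sup>2 \<le> M\<^sup>2 * V (shift_seq j w)" by (rule abs_obs_le(2)[OF f elim A])
    then show ?case by simp
  qed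
qed

text \<open>Resampling the symbol at k changes a single term of the shifted series, the one at k +
  j, by at most (c + c') \<open>wt (k + j)\<close> for the size constants of the old and the new
  symbol. The Lipschitz bound and \<open>square_of_product_le\<close> do the rest.\<close>

lemma obs_oscillation:
  assumes f: "exp_lipschitz M f" and A: "finite A"
  shows "(\<integral>x. (obs f A j (\<lambda>i. x (i, False)) - obs f A j (\<lambda>i. x (i, i = k)))\<^sup>2 \<partial>(iid (measure_pmf p)))
    \<le> (\<kappa> M * wt (k + int j))\<^sup>2"
proof -
  let ?Q = "iid (measure_pmf p) :: (int \<times> bool \<Rightarrow> nat) measure"
  \<comment> \<open>f1 and f2 read the original and the resampled sequence, shifted by j, to bound
    the exponentials. f3 and f4 are centred at k in either version, so that the bound on
    \<open>C (w 0)\<close> speaks of the old and the new symbol.\<close>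
  define f1 f2 f3 f4 where "f1 i = (i - int j, False)" and "f2 i = (i - int j, i - int j = k)"
    and "f3 i = (i + k, False)" and "f4 i = (i + k, True)" for i
  have inj: "inj f1" "inj f2" "inj f3" "inj f4"
    by (auto intro!: injI simp: f1_def f2_def f3_def f4_def)
  let ?R = "\<lambda>x. V (\<lambda>i. x (f3 i)) + V (\<lambda>i. x (f4 i)) + V (\<lambda>i. x (f1 i)) + V (\<lambda>i. x (f2 i))"
  let ?c = "4 * M\<^sup>2 * (wt (k + int j))\<^sup>2"
  have M: "M > 0" using f by (simp add: exp_lipschitz_def)
  have le: "(obs f A j (\<lambda>i. x (i, False)) - obs f A j (\<lambda>i. x (i, i = k)))\<^sup>2 \<le> ?c * ?R x"
    if t: "tame (\<lambda>i. x (f1 i))" "tame (\<lambda>i. x (f2 i))" "tame (\<lambda>i. x (f3 i))" "tame (\<lambda>i. x (f4 i))" for x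
  proof -
    define y1 y2 where "y1 = psum A (\<lambda>i. x (f1 i))" and "y2 = psum A (\<lambda>i. x (f2 i))"
    define c c' where "c = C (x (k, False))" and "c' = C (x (k, True))"
    have o: "obs f A j (\<lambda>i. x (i, False)) = f y1" "obs f A j (\<lambda>i. x (i, i = k)) = f y2"
      by (simp_all add: obs_def shift_seq_def y1_def y2_def f1_def f2_def)
    have c: "c \<ge> 0" "c' \<ge> 0" using C_nonneg by (simp_all add: c_def c'_def)
    have "y1 - y2 = (\<Sum>i\<in>A. v (x (f1 i)) i - v (x (f2 i)) i)"
      by (simp add: y1_def y2_def psum_def sum_subtractf)
    also have "\<dots> = (\<Sum>i\<in>A. if i = k + int j then v (x (k, False)) i - v (x (k, True)) i else 0)"
      by (intro sum.cong refl) (auto simp: f1_def f2_def)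
    also have "\<dots> = (if k + int j \<in> A then v (x (k, False)) (k + int j) - v (x (k, True)) (k + int j) else 0)"
      using A by (simp add: sum.delta)
    finally have "norm (y1 - y2) \<le> norm (v (x (k, False)) (k + int j)) + norm (v (x (k, True)) (k + int j))"
      by (simp add: norm_triangle_ineq4)
    also have "\<dots> \<le> c * wt (k + int j) + c' * wt (k + int j)"
      unfolding c_def c'_def wt_def by (intro add_mono v_le)
    finally have ny: "norm (y1 - y2) \<le> (c + c') * wt (k + int j)" by (simp add: algebra_simps)
    have "\<bar>f y1 - f y2\<bar> \<le> M * norm (y1 - y2) * (exp (norm y1) + exp (norm y2))"
      using f unfolding exp_lipschitz_def by blast
    also have "\<dots> \<le> M * ((c + c') * wt (k + int j)) * (exp (norm y1) + exp (norm y2))"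
      using M ny by (intro mult_right_mono mult_left_mono) (auto intro: add_nonneg_nonneg)
    finally have "\<bar>f y1 - f y2\<bar>\<^sup>2 \<le> (M * ((c + c') * wt (k + int j)) * (exp (norm y1) + exp (norm y2)))\<^sup>2"
      by (rule power_mono) simp
    also have "\<dots> = M\<^sup>2 * (wt (k + int j))\<^sup>2 * ((c + c') * (exp (norm y1) + exp (norm y2)))\<^sup>2"
      by (simp add: power_mult_distrib ac_simps)
    also have "\<dots> \<le> M\<^sup>2 * (wt (k + int j))\<^sup>2 * (4 * (c ^ 4 + c' ^ 4 + exp (norm y1) ^ 4 + exp (norm y2) ^ 4))"
      by (intro mult_left_mono square_of_product_le) auto
    also have "\<dots> = ?c * (c ^ 4 + c' ^ 4 + exp (norm y1) ^ 4 + exp (norm y2) ^ 4)" by simp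
    also have "\<dots> \<le> ?c * ?R x"
    proof (intro mult_left_mono add_mono)
      show "c ^ 4 \<le> V (\<lambda>i. x (f3 i))" using t(3) unfolding tame_def c_def f3_def by simp
      show "c' ^ 4 \<le> V (\<lambda>i. x (f4 i))" using t(4) unfolding tame_def c'_def f4_def by simp
      show "exp (norm y1) ^ 4 \<le> V (\<lambda>i. x (f1 i))"
        using tame_psum_le[OF t(1) A] unfolding y1_def by (simp flip: exp_of_nat_mult)
      show "exp (norm y2) ^ 4 \<le> V (\<lambda>i. x (f2 i))"
        using tame_psum_le[OF t(2) A] unfolding y2_def by (simp flip: exp_of_nat_mult)
    qed auto
    finally show ?thesis unfolding o by simp
  qed
  note AEt = AE_reindex[OF inj(1) AE_tame] AE_reindex[OF inj(2) AE_tame]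
    AE_reindex[OF inj(3) AE_tame] AE_reindex[OF inj(4) AE_tame]
  note I = V_reindex(1)[OF inj(1)] V_reindex(1)[OF inj(2)] V_reindex(1)[OF inj(3)] V_reindex(1)[OF inj(4)]
  note I34 = Bochner_Integration.integrable_add[OF I(3) I(4)]
  note I341 = Bochner_Integration.integrable_add[OF I34 I(1)]
  note Rint = Bochner_Integration.integrable_add[OF I341 I(2)]
  have RI: "(\<integral>x. ?R x \<partial>?Q) = 4 * (\<integral>w. V w \<partial>P)"
    unfolding Bochner_Integration.integral_add[OF I341 I(2)] Bochner_Integration.integral_add[OF I34 I(1)]
      Bochner_Integration.integral_add[OF I(3) I(4)] V_reindex(2)[OF inj(1)] V_reindex(2)[OF inj(2)]
      V_reindex(2)[OF inj(3)] V_reindex(2)[OF inj(4)] by simp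
  have "(\<integral>x. (obs f A j (\<lambda>i. x (i, False)) - obs f A j (\<lambda>i. x (i, i = k)))\<^sup>2 \<partial>?Q) \<le> (\<integral>x. ?c * ?R x \<partial>?Q)"
  proof (rule integral_mono_AE')
    show "integrable ?Q (\<lambda>x. ?c * ?R x)" by (rule integrable_mult_right[OF Rint])
    show "AE x in ?Q. (obs f A j (\<lambda>i. x (i, False)) - obs f A j (\<lambda>i. x (i, i = k)))\<^sup>2 \<le> ?c * ?R x"
      using AEt by eventually_elim (rule le)
    show "AE x in ?Q. 0 \<le> ?c * ?R x"
      using AEt by eventually_elim (rule order_trans[OF zero_le_power2 le])
  qed
  also have "\<dots> = ?c * (4 * (\<integral>w. V w \<partial>P))"
    unfolding integral_mult_right_zero RI ..
  also have "\<dots> = (\<kappa> M * wt (k + int j))\<^sup>2"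
    using EV_nonneg by (simp add: \<kappa>_def power_mult_distrib)
  finally show ?thesis .
qed

lemma obs_covariance_le:
  assumes f: "exp_lipschitz M f" and g: "exp_lipschitz N g" and A: "finite A" and B: "finite B"
  shows "\<bar>(\<integral>w. obs f A i w * obs g B j w \<partial>P) - (\<integral>w. obs f A i w \<partial>P) * (\<integral>w. obs g B j w \<partial>P)\<bar>
    \<le> (\<Sum>k\<in>(\<lambda>k. k - int j) ` B. (\<kappa> M * wt (k + int i)) * (\<kappa> N * wt (k + int j)))"
  by (rule iid_covariance_le[OF Mp])
    (use f g A B in \<open>auto intro!: obs_measurable obs_square_integrable obs_depends_on obs_oscillation
      mult_nonneg_nonneg wt_nonneg kappa_nonneg simp: exp_lipschitz_def\<close>)

lemma obs_tendsto:
  assumes "exp_lipschitz M f" "tame (shift_seq j w)"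
  shows "(\<lambda>m. obs f {- int m..int m} j w) \<longlonglongrightarrow> f (\<Phi> (shift_seq j w))"
  unfolding obs_def by (rule exp_lipschitz_tendsto[OF assms(1) tame_psum_tendsto[OF assms(2)]])

lemma Phi_shift_measurable: "(\<lambda>w. \<Phi> (shift_seq j w)) \<in> borel_measurable P"
  by (rule measurable_compose[OF measurable_shift_P Phi_measurable])

lemma f_Phi_shift_measurable:
  "exp_lipschitz M f \<Longrightarrow> (\<lambda>w. f (\<Phi> (shift_seq j w))) \<in> borel_measurable P"
  by (rule measurable_compose[OF Phi_shift_measurable exp_lipschitz_borel])

lemma integral_obs_tendsto:
  assumes f: "exp_lipschitz M f"
  shows "(\<lambda>m. \<integral>w. obs f {- int m..int m} j w \<partial>P) \<longlonglongrightarrow> (\<integral>w. f (\<Phi> (shift_seq j w)) \<partial>P)"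
proof (rule integral_dominated_convergence)
  show "(\<lambda>w. f (\<Phi> (shift_seq j w))) \<in> borel_measurable P" by (rule f_Phi_shift_measurable[OF f])
  show "obs f {- int m..int m} j \<in> borel_measurable P" for m by (rule obs_measurable[OF f])
  show "integrable P (\<lambda>w. M * V (shift_seq j w))" by (rule integrable_mult_right[OF V_shift(1)])
  show "AE w in P. (\<lambda>m. obs f {- int m..int m} j w) \<longlonglongrightarrow> f (\<Phi> (shift_seq j w))"
    using AE_tame_shift[of j] by eventually_elim (rule obs_tendsto[OF f])
  show "AE w in P. norm (obs f {- int m..int m} j w) \<le> M * V (shift_seq j w)" for m
    using AE_tame_shift[of j] by eventually_elim (use abs_obs_le(1)[OF f] in simp)
qed

lemma integral_obs_mult_tendsto:
  assumes f: "exp_lipschitz M f" and g: "exp_lipschitz N g"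
  shows "(\<lambda>m. \<integral>w. obs f {- int m..int m} i w * obs g {- int m..int m} j w \<partial>P)
    \<longlonglongrightarrow> (\<integral>w. f (\<Phi> (shift_seq i w)) * g (\<Phi> (shift_seq j w)) \<partial>P)"
proof (rule integral_dominated_convergence)
  show "(\<lambda>w. f (\<Phi> (shift_seq i w)) * g (\<Phi> (shift_seq j w))) \<in> borel_measurable P"
    by (rule borel_measurable_times[OF f_Phi_shift_measurable[OF f] f_Phi_shift_measurable[OF g]])
  show "(\<lambda>w. obs f {- int m..int m} i w * obs g {- int m..int m} j w) \<in> borel_measurable P" for m
    by (rule borel_measurable_times[OF obs_measurable[OF f] obs_measurable[OF g]])
  show "integrable P (\<lambda>w. M\<^sup>2 * V (shift_seq i w) + N\<^sup>2 * V (shift_seq j w))"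
    by (intro Bochner_Integration.integrable_add integrable_mult_right V_shift)
  show "AE w in P. (\<lambda>m. obs f {- int m..int m} i w * obs g {- int m..int m} j w)
      \<longlonglongrightarrow> f (\<Phi> (shift_seq i w)) * g (\<Phi> (shift_seq j w))"
    using AE_tame_shift[of i] AE_tame_shift[of j]
    by eventually_elim (intro tendsto_mult obs_tendsto[OF f] obs_tendsto[OF g])
  show "AE w in P. norm (obs f {- int m..int m} i w * obs g {- int m..int m} j w)
      \<le> M\<^sup>2 * V (shift_seq i w) + N\<^sup>2 * V (shift_seq j w)" for m
    using AE_tame_shift[of i] AE_tame_shift[of j]
  proof eventually_elim
    case (elim w)
    let ?a = "obs f {- int m..int m} i w" and ?b = "obs g {- int m..int m} j w"
    have "0 \<le> (\<bar>?a\<bar> - \<bar>?b\<bar>)\<^sup>2" by simp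
    then have "2 * (\<bar>?a\<bar> * \<bar>?b\<bar>) \<le> ?a\<^sup>2 + ?b\<^sup>2" by (simp add: power2_diff)
    moreover have "0 \<le> \<bar>?a\<bar> * \<bar>?b\<bar>" by (intro mult_nonneg_nonneg) auto
    ultimately have "\<bar>?a\<bar> * \<bar>?b\<bar> \<le> ?a\<^sup>2 + ?b\<^sup>2" by linarith
    also have "\<dots> \<le> M\<^sup>2 * V (shift_seq i w) + N\<^sup>2 * V (shift_seq j w)"
      by (intro add_mono abs_obs_le(2) f g elim) auto
    finally show ?case by (simp add: abs_mult)
  qed
qed

lemma integral_mu_T_power:
  fixes f :: "'a \<Rightarrow> real"
  assumes f: "f \<in> borel_measurable borel"
  shows "(\<integral>y. f ((T ^^ n) y) \<partial>\<mu>) = (\<integral>w. f (\<Phi> (shift_seq n w)) \<partial>P)"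
proof -
  have fT: "(\<lambda>y. f ((T ^^ n) y)) \<in> borel_measurable borel"
    by (rule measurable_compose[OF T_power_measurable f])
  have "(\<integral>y. f ((T ^^ n) y) \<partial>\<mu>) = (\<integral>w. f ((T ^^ n) (\<Phi> w)) \<partial>P)"
    unfolding \<mu>_def by (rule integral_distr[OF Phi_measurable fT])
  also have "\<dots> = (\<integral>w. f (\<Phi> (shift_seq n w)) \<partial>P)"
    by (rule integral_cong_AE[OF measurable_compose[OF Phi_measurable fT]
        measurable_compose[OF Phi_shift_measurable f]])
      (use AE_T_power_Phi[of n] in eventually_elim, simp)
  finally show ?thesis .
qed

lemma shift_seq_0: "shift_seq 0 w = w"
  by (simp add: shift_seq_def)

text \<open>The bound for truncated observables is uniform in the window, because the convolution
  estimate holds for every finite index set. Letting the window grow gives the claim.\<close>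

lemma covariance_decay:
  assumes f: "exp_lipschitz M f" and g: "exp_lipschitz N g" and \<alpha>: "\<alpha> > 1/2"
  shows "\<exists>D. \<forall>n\<ge>1. \<bar>covariance \<mu> (\<lambda>y. f ((T ^^ n) y)) g\<bar> \<le> D * cov_rate \<alpha> n"
proof -
  obtain K where K: "K \<ge> 0" "\<And>n B. n \<ge> 1 \<Longrightarrow> finite B \<Longrightarrow>
    (\<Sum>k\<in>B. (1 + \<bar>real_of_int (k + int n)\<bar>) powr (- \<alpha>) * (1 + \<bar>real_of_int k\<bar>) powr (- \<alpha>))
      \<le> K * cov_rate \<alpha> n" using convolution_powr_le[OF \<alpha>] by blast
  have MN: "M > 0" "N > 0" using f g by (simp_all add: exp_lipschitz_def)
  have fb: "f \<in> borel_measurable borel" and gb: "g \<in> borel_measurable borel"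
    using f g by (auto intro: exp_lipschitz_borel)
  have "\<bar>covariance \<mu> (\<lambda>y. f ((T ^^ n) y)) g\<bar> \<le> (\<kappa> M * \<kappa> N * K) * cov_rate \<alpha> n" if n: "n \<ge> 1" for n
  proof -
    let ?I = "\<lambda>m::nat. {- int m..int m}"
    have fT: "(\<lambda>y. f ((T ^^ n) y)) \<in> borel_measurable borel"
      by (rule measurable_compose[OF T_power_measurable fb])
    have "(\<integral>y. f ((T ^^ n) y) * g y \<partial>\<mu>) = (\<integral>w. f ((T ^^ n) (\<Phi> w)) * g (\<Phi> w) \<partial>P)"
      unfolding \<mu>_def by (rule integral_distr[OF Phi_measurable borel_measurable_times[OF fT gb]])
    also have "\<dots> = (\<integral>w. f (\<Phi> (shift_seq n w)) * g (\<Phi> (shift_seq 0 w)) \<partial>P)"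
      unfolding shift_seq_0
      by (rule integral_cong_AE[OF measurable_compose[OF Phi_measurable borel_measurable_times[OF fT gb]]
          borel_measurable_times[OF f_Phi_shift_measurable[OF f] measurable_compose[OF Phi_measurable gb]]])
        (use AE_T_power_Phi[of n] in eventually_elim, simp)
    finally have e1: "(\<integral>y. f ((T ^^ n) y) * g y \<partial>\<mu>) = \<dots>" .
    have e2: "(\<integral>y. g y \<partial>\<mu>) = (\<integral>w. g (\<Phi> (shift_seq 0 w)) \<partial>P)"
      using integral_mu_T_power[OF gb, of 0] by simp
    have lim: "(\<lambda>m. \<bar>(\<integral>w. obs f (?I m) n w * obs g (?I m) 0 w \<partial>P)
        - (\<integral>w. obs f (?I m) n w \<partial>P) * (\<integral>w. obs g (?I m) 0 w \<partial>P)\<bar>)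
      \<longlonglongrightarrow> \<bar>covariance \<mu> (\<lambda>y. f ((T ^^ n) y)) g\<bar>"
      unfolding covariance_def e1 e2 integral_mu_T_power[OF fb]
      by (intro tendsto_rabs tendsto_diff tendsto_mult integral_obs_mult_tendsto[OF f g]
          integral_obs_tendsto[OF f] integral_obs_tendsto[OF g])
    show ?thesis
    proof (rule tendsto_upperbound[OF lim])
      show "\<forall>\<^sub>F m in sequentially. \<bar>(\<integral>w. obs f (?I m) n w * obs g (?I m) 0 w \<partial>P)
          - (\<integral>w. obs f (?I m) n w \<partial>P) * (\<integral>w. obs g (?I m) 0 w \<partial>P)\<bar> \<le> (\<kappa> M * \<kappa> N * K) * cov_rate \<alpha> n"
      proof (rule always_eventually, rule allI)
        fix m
        have "\<bar>(\<integral>w. obs f (?I m) n w * obs g (?I m) 0 w \<partial>P)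
            - (\<integral>w. obs f (?I m) n w \<partial>P) * (\<integral>w. obs g (?I m) 0 w \<partial>P)\<bar>
          \<le> (\<Sum>k\<in>?I m. (\<kappa> M * wt (k + int n)) * (\<kappa> N * wt k))"
          using obs_covariance_le[OF f g, of "?I m" "?I m" n 0] by simp
        also have "\<dots> = \<kappa> M * \<kappa> N * (\<Sum>k\<in>?I m. wt (k + int n) * wt k)"
          by (simp add: sum_distrib_left ac_simps)
        also have "\<dots> \<le> \<kappa> M * \<kappa> N * (K * cov_rate \<alpha> n)"
          using K(2)[OF n, of "?I m"] kappa_nonneg MN unfolding wt_def by (intro mult_left_mono) auto
        finally show "\<bar>(\<integral>w. obs f (?I m) n w * obs g (?I m) 0 w \<partial>P)
            - (\<integral>w. obs f (?I m) n w \<partial>P) * (\<integral>w. obs g (?I m) 0 w \<partial>P)\<bar> \<le> (\<kappa> M * \<kappa> N * K) * cov_rate \<alpha> n"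
          by (simp only: mult.assoc)
      qed
    qed simp
  qed
  then show ?thesis by blast
qed

end

subsection \<open>Variance of sums\<close>

lemma power2_add_le: "(x + y)\<^sup>2 \<le> 2 * x\<^sup>2 + 2 * (y::real)\<^sup>2"
  using zero_le_power2[of "x - y"] by (simp add: power2_sum power2_diff)

lemma power2_diff_le: "(x - y)\<^sup>2 \<le> 2 * x\<^sup>2 + 2 * (y::real)\<^sup>2"
  using power2_add_le[of x "- y"] by simp

lemma weighted_sum_square_le:
  fixes a c :: "'i \<Rightarrow> real"
  assumes "\<And>i. i \<in> B \<Longrightarrow> a i \<ge> 0"
  shows "(\<Sum>i\<in>B. a i * c i)\<^sup>2 \<le> (\<Sum>i\<in>B. a i) * (\<Sum>i\<in>B. a i * (c i)\<^sup>2)"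
proof -
  have "(\<Sum>i\<in>B. sqrt (a i) * (sqrt (a i) * c i))\<^sup>2
      \<le> (\<Sum>i\<in>B. (sqrt (a i))\<^sup>2) * (\<Sum>i\<in>B. (sqrt (a i) * c i)\<^sup>2)"
    by (rule Cauchy_Schwarz_ineq_sum)
  moreover have "(\<Sum>i\<in>B. sqrt (a i) * (sqrt (a i) * c i)) = (\<Sum>i\<in>B. a i * c i)"
    using assms by (intro sum.cong refl) (simp flip: mult.assoc)
  moreover have "(\<Sum>i\<in>B. (sqrt (a i))\<^sup>2) = (\<Sum>i\<in>B. a i)"
    using assms by (intro sum.cong refl) simp
  moreover have "(\<Sum>i\<in>B. (sqrt (a i) * c i)\<^sup>2) = (\<Sum>i\<in>B. a i * (c i)\<^sup>2)"
    using assms by (intro sum.cong refl) (simp add: power_mult_distrib)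
  ultimately show ?thesis by simp
qed

text \<open>Expanding the square leaves a triple sum of \<open>q (k + i)\<close> times
  \<open>q (k + j)\<close>. Summing over i costs S, summing over k another S, and only the sum over
  j produces \<open>card J\<close>: the growth is linear, not quadratic.\<close>

lemma iid_variance_sum_le:
  fixes H :: "nat \<Rightarrow> (int \<Rightarrow> 'b) \<Rightarrow> real" and q :: "int \<Rightarrow> real"
  assumes M: "prob_space M"
    and meas: "\<And>j. H j \<in> borel_measurable (iid M)"
    and sq: "\<And>j. integrable (iid M) (\<lambda>w. (H j w)\<^sup>2)"
    and dep: "\<And>j. finite (A j)" "\<And>j. depends_on (H j) (A j)"
    and osc: "\<And>j k. (\<integral>x. (H j (\<lambda>i. x (i, False)) - H j (\<lambda>i. x (i, i = k)))\<^sup>2 \<partial>(iid M)) \<le> (q (k + int j))\<^sup>2"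
    and q: "\<And>k. q k \<ge> 0" "\<And>B. finite B \<Longrightarrow> (\<Sum>k\<in>B. q k) \<le> S"
    and J: "finite J"
  shows "(\<integral>w. (\<Sum>j\<in>J. H j w - (\<integral>w. H j w \<partial>(iid M)))\<^sup>2 \<partial>(iid M)) \<le> real (card J) * S\<^sup>2"
proof -
  let ?P = "iid M :: (int \<Rightarrow> 'b) measure"
  interpret P: prob_space ?P by (rule prob_space_iid[OF M])
  define e where "e j = (\<integral>w. H j w \<partial>?P)" for j
  have I1: "integrable ?P (H j)" for j by (rule P.square_integrable_imp_integrable[OF meas sq])
  have I2: "integrable ?P (\<lambda>w. H i w * H j w)" for i j
    by (rule integrable_mult_of_squares[OF meas meas sq sq])
  have I3: "integrable ?P (\<lambda>w. (H i w - e i) * (H j w - e j))" for i j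
  proof -
    have "integrable ?P (\<lambda>w. H i w * H j w - e j * H i w - (e i * H j w - e i * e j))"
      by (intro Bochner_Integration.integrable_diff I2 integrable_mult_right I1 P.integrable_const)
    then show ?thesis by (simp add: algebra_simps)
  qed
  have cov: "(\<integral>w. (H i w - e i) * (H j w - e j) \<partial>?P) = (\<integral>w. H i w * H j w \<partial>?P) - e i * e j" for i j
  proof -
    have "(\<integral>w. (H i w - e i) * (H j w - e j) \<partial>?P)
        = (\<integral>w. H i w * H j w - e j * H i w - (e i * H j w - e i * e j) \<partial>?P)"
      by (intro Bochner_Integration.integral_cong refl) (simp add: algebra_simps)
    also have "\<dots> = (\<integral>w. H i w * H j w \<partial>?P) - e j * e i - (e i * e j - e i * e j)"
      using I1 I2 by (simp add: e_def P.prob_space)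
    finally show ?thesis by simp
  qed
  have S0: "S \<ge> 0" using q(2)[of "{}"] by simp
  have le: "(\<integral>w. H i w * H j w \<partial>?P) - e i * e j \<le> (\<Sum>k\<in>A j. q (k + int i) * q (k + int j))" for i j
  proof -
    have "\<bar>(\<integral>w. H i w * H j w \<partial>?P) - e i * e j\<bar> \<le> (\<Sum>k\<in>A j. q (k + int i) * q (k + int j))"
      unfolding e_def by (rule iid_covariance_le[OF M meas meas sq sq dep]) (rule q osc)+
    then show ?thesis by linarith
  qed
  have shiftq: "(\<Sum>i\<in>B. q (f i)) \<le> S" if "finite B" "inj_on f B" for f and B :: "'c set"
    using q(2)[of "f ` B"] that by (simp add: sum.reindex)
  have "(\<integral>w. (\<Sum>j\<in>J. H j w - e j)\<^sup>2 \<partial>?P) = (\<integral>w. (\<Sum>j\<in>J. \<Sum>i\<in>J. (H i w - e i) * (H j w - e j)) \<partial>?P)"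
    by (simp add: power2_eq_square sum_product mult.commute)
  also have "\<dots> = (\<Sum>j\<in>J. \<Sum>i\<in>J. (\<integral>w. H i w * H j w \<partial>?P) - e i * e j)"
    using I3 by (simp add: cov)
  also have "\<dots> \<le> (\<Sum>j\<in>J. \<Sum>i\<in>J. \<Sum>k\<in>A j. q (k + int i) * q (k + int j))"
    by (intro sum_mono le)
  also have "\<dots> = (\<Sum>j\<in>J. \<Sum>k\<in>A j. (\<Sum>i\<in>J. q (k + int i)) * q (k + int j))"
    by (subst sum.swap) (simp add: sum_distrib_right)
  also have "\<dots> \<le> (\<Sum>j\<in>J. \<Sum>k\<in>A j. S * q (k + int j))"
    using J by (intro sum_mono mult_right_mono shiftq q) (auto simp: inj_on_def)
  also have "\<dots> \<le> (\<Sum>j\<in>J. S * S)"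
    unfolding sum_distrib_left[symmetric]
    using dep(1) S0 by (intro sum_mono mult_left_mono shiftq) (auto simp: inj_on_def)
  also have "\<dots> = real (card J) * S\<^sup>2" by (simp add: power2_eq_square)
  finally show ?thesis by (simp add: e_def)
qed

section \<open>Truncation errors for summable weights\<close>

context orbit_process
begin

abbreviation I :: "nat \<Rightarrow> int set" where "I m \<equiv> {- int m..int m}"

lemma wt_summable:
  assumes \<alpha>: "\<alpha> > 1"
  shows "wt summable_on UNIV"
proof (rule nonneg_bdd_above_summable_on)
  have "sum wt B \<le> 2 * (1 + 1 / (\<alpha> - 1))" if B: "finite B" for B
  proof -
    define N where "N = Suc (\<Sum>k\<in>B. nat \<bar>k\<bar>)"
    have "nat \<bar>k\<bar> < N" if "k \<in> B" for k
      using member_le_sum[of k B "\<lambda>k. nat \<bar>k\<bar>"] that B by (simp add: N_def)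
    then have "(\<Sum>k\<in>B. (1 + real (nat \<bar>k\<bar>)) powr (- \<alpha>)) \<le> 2 * (\<Sum>t<N. (1 + real t) powr (- \<alpha>))"
      using B by (intro sum_over_abs_le) auto
    also have "(\<Sum>t<N. (1 + real t) powr (- \<alpha>)) \<le> 1 + real N powr (1 - \<alpha>) / (1 - \<alpha>) - 1 / (1 - \<alpha>)"
      using \<alpha> by (intro sum_powr_neg_first_le) (auto simp: N_def)
    also have "\<dots> \<le> 1 + 1 / (\<alpha> - 1)"
    proof -
      have "real N powr (1 - \<alpha>) / (1 - \<alpha>) \<le> 0" using \<alpha> by (simp add: divide_nonneg_neg)
      moreover have "- (1 / (1 - \<alpha>)) = 1 / (\<alpha> - 1)" using \<alpha> by (simp add: field_simps)
      ultimately show ?thesis by linarith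
    qed
    finally show ?thesis by (simp add: wt_def)
  qed
  then show "bdd_above (sum wt ` {F. F \<subseteq> UNIV \<and> finite F})" by (auto intro!: bdd_aboveI2)
qed (simp add: wt_nonneg)

definition total :: real where "total = infsum wt UNIV"

lemma sum_wt_le_total: "\<alpha> > 1 \<Longrightarrow> finite B \<Longrightarrow> sum wt B \<le> total"
  unfolding total_def by (rule finite_sum_le_infsum[OF wt_summable]) (auto simp: wt_nonneg)

lemma small_tails:
  assumes \<alpha>: "\<alpha> > 1" and e: "e > 0"
  obtains m where "\<And>B. finite B \<Longrightarrow> B \<inter> I m = {} \<Longrightarrow> sum wt B \<le> e"
proof -
  obtain X where X: "finite X" "\<And>Y. finite Y \<Longrightarrow> Y \<inter> X = {} \<Longrightarrow> norm (sum wt Y) < e"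
    using summable_on_imp_small_sums[OF wt_summable[OF \<alpha>] e] by metis
  define m where "m = (\<Sum>k\<in>X. nat \<bar>k\<bar>)"
  have sub: "X \<subseteq> I m"
  proof
    fix k assume "k \<in> X"
    then have "nat \<bar>k\<bar> \<le> m" unfolding m_def using X(1) by (intro member_le_sum) auto
    then show "k \<in> I m" by auto
  qed
  show thesis
  proof (rule that)
    fix B assume B: "finite B" "B \<inter> I m = {}"
    then have "B \<inter> X = {}" using sub by blast
    from X(2)[OF B(1) this] show "sum wt B \<le> e" by simp
  qed
qed

text \<open>The truncations differ by the terms in the ring between the windows. Cauchy-Schwarz with
  the weights \<open>wt\<close> puts the total weight of the ring in front and keeps the weights
  inside the sum, so each term is averaged separately, with V centred at its position.\<close>

lemma obs_diff_square_le:
  assumes f: "exp_lipschitz M f" and mm: "m \<le> m'"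
  shows "(\<integral>w. (obs f (I m') j w - obs f (I m) j w)\<^sup>2 \<partial>P) \<le> (\<kappa> M * sum wt (I m' - I m))\<^sup>2"
proof -
  let ?B = "I m' - I m"
  have M: "M > 0" using f by (simp add: exp_lipschitz_def)
  define sh where "sh k i = i + k - int j" for k i :: int
  have inj: "inj (sh k)" for k by (auto intro!: injI simp: sh_def)
  define R where "R w = M\<^sup>2 * sum wt ?B * (\<Sum>k\<in>?B. wt k * (4 * (V (\<lambda>i. w (sh k i)) + V (shift_seq j w) + V (shift_seq j w))))" for w
  have Rint: "integrable P R"
    unfolding R_def
    by (intro integrable_mult_right Bochner_Integration.integrable_sum
      Bochner_Integration.integrable_add V_shift(1) V_reindex(1)[OF inj])
  have EV: "(\<integral>w. V (\<lambda>i. w (sh k i)) + V (shift_seq j w) + V (shift_seq j w) \<partial>P) = 3 * (\<integral>w. V w \<partial>P)" for k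
  proof -
    note a = V_reindex(1)[OF inj[of k]] and b = V_shift(1)[of j]
    show ?thesis
      unfolding Bochner_Integration.integral_add[OF Bochner_Integration.integrable_add[OF a b] b]
        Bochner_Integration.integral_add[OF a b] V_reindex(2)[OF inj] V_shift(2) by simp
  qed
  have ER: "(\<integral>w. R w \<partial>P) = M\<^sup>2 * sum wt ?B * (\<Sum>k\<in>?B. wt k * (4 * (3 * (\<integral>w. V w \<partial>P))))"
  proof -
    have "integrable P (\<lambda>w. wt k * (4 * (V (\<lambda>i. w (sh k i)) + V (shift_seq j w) + V (shift_seq j w))))" for k
      by (intro integrable_mult_right Bochner_Integration.integrable_add V_shift(1) V_reindex(1)[OF inj])
    then show ?thesis
      unfolding R_def by (simp only: integral_mult_right_zero Bochner_Integration.integral_sum EV)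
  qed
  have le: "(obs f (I m') j w - obs f (I m) j w)\<^sup>2 \<le> R w"
    if t: "tame (shift_seq j w)" "\<And>k. tame (\<lambda>i. w (sh k i))" for w
  proof -
    define w' where "w' = shift_seq j w"
    define y1 y2 where "y1 = psum (I m') w'" and "y2 = psum (I m) w'"
    have V1: "exp (norm y1) ^ 4 \<le> V w'" "exp (norm y2) ^ 4 \<le> V w'"
      using tame_psum_le[OF t(1), of "I m'"] tame_psum_le[OF t(1), of "I m"]
      unfolding y1_def y2_def w'_def by (simp_all flip: exp_of_nat_mult)
    have "y1 - y2 = psum ?B w'"
      unfolding y1_def y2_def psum_def using mm by (subst sum_diff) auto
    then have "norm (y1 - y2) \<le> (\<Sum>k\<in>?B. norm (v (w' k) k))"
      unfolding psum_def by (simp add: norm_sum)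
    also have "\<dots> \<le> (\<Sum>k\<in>?B. wt k * C (w' k))"
      unfolding wt_def by (intro sum_mono) (use v_le in \<open>simp add: mult.commute\<close>)
    finally have ny: "norm (y1 - y2) \<le> (\<Sum>k\<in>?B. wt k * C (w' k))" .
    define E where "E = exp (norm y1) + exp (norm y2)"
    have E0: "E \<ge> 0" by (simp add: E_def)
    have "\<bar>f y1 - f y2\<bar> \<le> M * norm (y1 - y2) * E"
      using f unfolding exp_lipschitz_def E_def by blast
    also have "\<dots> \<le> M * (\<Sum>k\<in>?B. wt k * C (w' k)) * E"
      using M ny E0 by (intro mult_right_mono mult_left_mono) auto
    also have "\<dots> = M * (\<Sum>k\<in>?B. wt k * (C (w' k) * E))"
      by (simp add: sum_distrib_right mult.assoc)
    finally have "\<bar>f y1 - f y2\<bar>\<^sup>2 \<le> (M * (\<Sum>k\<in>?B. wt k * (C (w' k) * E)))\<^sup>2"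
      by (rule power_mono) simp
    also have "\<dots> = M\<^sup>2 * (\<Sum>k\<in>?B. wt k * (C (w' k) * E))\<^sup>2" by (simp add: power_mult_distrib)
    also have "\<dots> \<le> M\<^sup>2 * (sum wt ?B * (\<Sum>k\<in>?B. wt k * (C (w' k) * E)\<^sup>2))"
      by (intro mult_left_mono weighted_sum_square_le wt_nonneg) simp
    also have "\<dots> \<le> M\<^sup>2 * (sum wt ?B * (\<Sum>k\<in>?B. wt k * (4 * (V (\<lambda>i. w (sh k i)) + V w' + V w'))))"
    proof (intro mult_left_mono sum_mono wt_nonneg sum_nonneg)
      fix k
      \<comment> \<open>A single size constant occurs, so the second slot of the product inequality
        is 0.\<close>
      have "(C (w' k) * E)\<^sup>2 \<le> 4 * (C (w' k) ^ 4 + 0 ^ 4 + exp (norm y1) ^ 4 + exp (norm y2) ^ 4)"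
        using square_of_product_le[of "C (w' k)" 0 "exp (norm y1)" "exp (norm y2)"] by (simp add: E_def)
      also have "\<dots> \<le> 4 * (V (\<lambda>i. w (sh k i)) + V w' + V w')"
      proof -
        have "C (w' k) ^ 4 \<le> V (\<lambda>i. w (sh k i))"
          using t(2)[of k] unfolding tame_def w'_def shift_seq_def sh_def by simp
        then show ?thesis using V1 by simp
      qed
      finally show "(C (w' k) * E)\<^sup>2 \<le> 4 * (V (\<lambda>i. w (sh k i)) + V w' + V w')" .
    qed simp
    finally show ?thesis
      unfolding R_def by (simp add: obs_def w'_def y1_def y2_def mult.assoc)
  qed
  have AEs: "AE w in P. \<forall>k. tame (\<lambda>i. w (sh k i))"
    unfolding AE_all_countable using AE_reindex[OF inj AE_tame] by blast
  have "(\<integral>w. (obs f (I m') j w - obs f (I m) j w)\<^sup>2 \<partial>P) \<le> (\<integral>w. R w \<partial>P)"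
  proof (rule integral_mono_AE'[OF Rint])
    show "AE w in P. (obs f (I m') j w - obs f (I m) j w)\<^sup>2 \<le> R w"
      using AE_tame_shift[of j] AEs by eventually_elim (rule le, blast+)
    show "AE w in P. 0 \<le> R w"
      using AE_tame_shift[of j] AEs by eventually_elim (rule order_trans[OF zero_le_power2 le], blast+)
  qed
  also have "\<dots> = 12 * (M\<^sup>2 * (sum wt ?B)\<^sup>2 * (\<integral>w. V w \<partial>P))"
    unfolding ER by (simp add: power2_eq_square sum_distrib_right[symmetric])
  \<comment> \<open>Only three integrals of V occur, giving 12; raising it to 16 makes the bound a
    square in terms of \<open>\<kappa> M\<close>.\<close>
  also have "\<dots> \<le> 16 * (M\<^sup>2 * (sum wt ?B)\<^sup>2 * (\<integral>w. V w \<partial>P))"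
    using EV_nonneg by (intro mult_right_mono mult_nonneg_nonneg) auto
  also have "\<dots> = (\<kappa> M * sum wt ?B)\<^sup>2"
    using EV_nonneg by (simp add: \<kappa>_def power_mult_distrib)
  finally show ?thesis .
qed

end

subsection \<open>Characteristic functions and approximation\<close>

lemma char_distr_eq:
  fixes X :: "'a \<Rightarrow> real"
  assumes "X \<in> borel_measurable M"
  shows "char (distr M borel X) t = (\<integral>x. iexp (t * X x) \<partial>M)"
  unfolding char_def by (rule integral_distr[OF assms]) measurable

lemma iexp_lipschitz: "cmod (iexp x - iexp y) \<le> \<bar>x - y\<bar>"
proof -
  have "iexp x - iexp y = iexp y * (iexp (x - y) - 1)"
    by (simp add: algebra_simps flip: exp_add)
  then have "cmod (iexp x - iexp y) = cmod (iexp (x - y) - 1)"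
    by (simp add: norm_mult)
  also have "\<dots> \<le> \<bar>x - y\<bar>" using iexp_approx1[of "x - y" 0] by simp
  finally show ?thesis .
qed

text \<open>As \<open>iexp\<close> is 1-Lipschitz, the difference is at most |t| times the mean of
  |X - Y|, and Cauchy-Schwarz against the constant 1 bounds that mean by e.\<close>

lemma (in prob_space) char_distr_diff_le:
  fixes X Y :: "'a \<Rightarrow> real"
  assumes X [measurable]: "X \<in> borel_measurable M" and Y [measurable]: "Y \<in> borel_measurable M"
    and sq: "integrable M (\<lambda>x. (X x - Y x)\<^sup>2)" and le: "expectation (\<lambda>x. (X x - Y x)\<^sup>2) \<le> e\<^sup>2" and e: "e \<ge> 0"
  shows "cmod (char (distr M borel X) t - char (distr M borel Y) t) \<le> \<bar>t\<bar> * e"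
proof -
  have iX: "integrable M (\<lambda>x. iexp (t * Z x))" if [measurable]: "Z \<in> borel_measurable M" for Z :: "'a \<Rightarrow> real"
    by (rule integrable_const_bound[where B=1]) auto
  have i1: "integrable M (\<lambda>x. X x - Y x)"
    by (rule square_integrable_imp_integrable[OF _ sq]) measurable
  have "char (distr M borel X) t - char (distr M borel Y) t = (\<integral>x. iexp (t * X x) - iexp (t * Y x) \<partial>M)"
    unfolding char_distr_eq[OF X] char_distr_eq[OF Y]
    by (rule Bochner_Integration.integral_diff[OF iX[OF X] iX[OF Y], symmetric])
  also have "cmod \<dots> \<le> (\<integral>x. cmod (iexp (t * X x) - iexp (t * Y x)) \<partial>M)"
    by (rule integral_norm_bound)
  also have "\<dots> \<le> (\<integral>x. \<bar>t\<bar> * \<bar>X x - Y x\<bar> \<partial>M)"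
  proof (rule integral_mono)
    show "integrable M (\<lambda>x. cmod (iexp (t * X x) - iexp (t * Y x)))"
      by (intro integrable_norm Bochner_Integration.integrable_diff iX X Y)
    show "integrable M (\<lambda>x. \<bar>t\<bar> * \<bar>X x - Y x\<bar>)" using i1 by (intro integrable_mult_right integrable_abs)
    show "cmod (iexp (t * X x) - iexp (t * Y x)) \<le> \<bar>t\<bar> * \<bar>X x - Y x\<bar>" for x
      using iexp_lipschitz[of "t * X x" "t * Y x"] by (simp flip: right_diff_distrib abs_mult)
  qed
  also have "\<dots> = \<bar>t\<bar> * (\<integral>x. \<bar>X x - Y x\<bar> * 1 \<partial>M)" by simp
  also have "(\<integral>x. \<bar>X x - Y x\<bar> * 1 \<partial>M) \<le> \<bar>\<integral>x. \<bar>X x - Y x\<bar> * 1 \<partial>M\<bar>" by simp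
  also have "\<dots> \<le> e * 1"
    by (rule integral_mult_le_L2) (use sq le e in \<open>auto simp: prob_space\<close>)
  finally show ?thesis by (simp add: mult_left_mono)
qed

lemma real_distribution_centered_gaussian:
  assumes "\<sigma> \<ge> 0"
  shows "real_distribution (centered_gaussian \<sigma>)"
proof (cases "\<sigma> = 0")
  case True
  then show ?thesis
    by (simp add: centered_gaussian_def real_distribution_def real_distribution_axioms_def prob_space_return)
next
  case False
  then show ?thesis
    using assms prob_space_normal_density[of \<sigma> 0]
    by (simp add: centered_gaussian_def real_distribution_def real_distribution_axioms_def)
qed

lemma char_centered_gaussian:
  assumes \<sigma>: "\<sigma> \<ge> 0"
  shows "char (centered_gaussian \<sigma>) t = complex_of_real (exp (- (\<sigma>\<^sup>2 * t\<^sup>2) / 2))"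
proof (cases "\<sigma> = 0")
  case True
  then show ?thesis by (simp add: centered_gaussian_def char_def integral_return)
next
  case False
  with \<sigma> have \<sigma>: "\<sigma> > 0" by simp
  interpret N: prob_space "std_normal_distribution"
    using prob_space_normal_density[of 1 0] by simp
  have "distributed std_normal_distribution lborel (\<lambda>x. x) std_normal_density"
    unfolding distributed_def by (simp add: distr_id2)
  from N.normal_density_affine[OF this, of \<sigma> 0]
  have "distributed std_normal_distribution lborel (\<lambda>x. \<sigma> * x) (normal_density 0 \<sigma>)"
    using \<sigma> by simp
  then have "density lborel (normal_density 0 \<sigma>) = distr std_normal_distribution lborel (\<lambda>x. \<sigma> * x)"
    by (simp add: distributed_def)
  also have "\<dots> = distr std_normal_distribution borel (\<lambda>x. \<sigma> * x)" by (rule distr_cong) simp_all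
  finally have "char (centered_gaussian \<sigma>) t = char (distr std_normal_distribution borel (\<lambda>x. \<sigma> * x)) t"
    using \<sigma> by (simp add: centered_gaussian_def)
  also have "\<dots> = (\<integral>x. iexp (t * (\<sigma> * x)) \<partial>std_normal_distribution)"
    by (rule char_distr_eq) simp
  also have "\<dots> = char std_normal_distribution (t * \<sigma>)" by (simp add: char_def mult.assoc)
  also have "\<dots> = complex_of_real (exp (- (\<sigma>\<^sup>2 * t\<^sup>2) / 2))"
    by (simp add: char_std_normal_distribution power_mult_distrib mult.commute)
  finally show ?thesis .
qed

text \<open>The central limit theorem divides by a positive standard deviation; evaluating the
  characteristic functions at t sqrt s undoes this. If s = 0, all variables vanish almost surely,
  and the characteristic functions and their limit are 1.\<close>

lemma (in prob_space) iid_char_tendsto: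
  fixes X :: "nat \<Rightarrow> 'a \<Rightarrow> real"
  assumes indep: "indep_vars (\<lambda>i. borel) X UNIV" and mean: "\<And>n. expectation (X n) = 0"
    and sq: "\<And>n. integrable M (\<lambda>x. (X n x)\<^sup>2)" and var: "\<And>n. expectation (\<lambda>x. (X n x)\<^sup>2) = s"
    and distr: "\<And>n. distr M borel (X n) = \<nu>"
  shows "(\<lambda>n. char (distr M borel (\<lambda>x. (\<Sum>i<n. X i x) / sqrt (real n))) t)
    \<longlonglongrightarrow> complex_of_real (exp (- (s * t\<^sup>2) / 2))"
proof -
  have X [measurable]: "X n \<in> borel_measurable M" for n
    using indep unfolding indep_vars_def2 by simp
  have s0: "s \<ge> 0" unfolding var[of 0, symmetric] by (rule Bochner_Integration.integral_nonneg) simp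
  show ?thesis
  proof (cases "s = 0")
    case True
    have "AE x in M. X n x = 0" for n
    proof -
      have "(\<integral>x. (X n x)\<^sup>2 \<partial>M) = 0" using var[of n] True by simp
      then have "AE x in M. (X n x)\<^sup>2 = 0"
        using integral_nonneg_eq_0_iff_AE[OF sq[of n]] by simp
      then show ?thesis by simp
    qed
    then have "AE x in M. \<forall>n. X n x = 0" by (simp add: AE_all_countable)
    then have ae: "AE x in M. iexp (t * ((\<Sum>i<n. X i x) / sqrt (real n))) = 1" for n
      by eventually_elim simp
    have "char (distr M borel (\<lambda>x. (\<Sum>i<n. X i x) / sqrt (real n))) t = 1" for n
    proof -
      have "char (distr M borel (\<lambda>x. (\<Sum>i<n. X i x) / sqrt (real n))) t
          = (\<integral>x. iexp (t * ((\<Sum>i<n. X i x) / sqrt (real n))) \<partial>M)"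
        by (rule char_distr_eq) measurable
      also have "\<dots> = (\<integral>x. 1 \<partial>M)" by (rule integral_cong_AE) (use ae in auto)
      finally show ?thesis by (simp add: prob_space)
    qed
    then show ?thesis using True by simp
  next
    case False
    with s0 have s: "s > 0" by simp
    have "variance (X n) = (sqrt s)\<^sup>2" for n using mean[of n] var[of n] s by simp
    then have "weak_conv_m (\<lambda>n. distr M borel (\<lambda>x. (\<Sum>i<n. X i x) / sqrt (real n * (sqrt s)\<^sup>2)))
        std_normal_distribution"
      using central_limit_theorem_zero_mean[OF indep mean _ sq _ distr, of "sqrt s"] s by simp
    then have "(\<lambda>n. char (distr M borel (\<lambda>x. (\<Sum>i<n. X i x) / sqrt (real n * (sqrt s)\<^sup>2))) (t * sqrt s))
        \<longlonglongrightarrow> char std_normal_distribution (t * sqrt s)"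
      by (intro levy_continuity1 real_distribution_distr real_dist_normal_dist) (simp_all, measurable)
    moreover have "char (distr M borel (\<lambda>x. (\<Sum>i<n. X i x) / sqrt (real n * (sqrt s)\<^sup>2))) (t * sqrt s)
        = char (distr M borel (\<lambda>x. (\<Sum>i<n. X i x) / sqrt (real n))) t" for n
    proof -
      have m1: "(\<lambda>x. (\<Sum>i<n. X i x) / sqrt (real n)) \<in> borel_measurable M" by measurable
      have m2: "(\<lambda>x. (\<Sum>i<n. X i x) / sqrt (real n * (sqrt s)\<^sup>2)) \<in> borel_measurable M" by measurable
      have "t * sqrt s * ((\<Sum>i<n. X i x) / sqrt (real n * (sqrt s)\<^sup>2)) = t * ((\<Sum>i<n. X i x) / sqrt (real n))" for x
        using s by (simp add: real_sqrt_mult)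
      then show ?thesis unfolding char_distr_eq[OF m1] char_distr_eq[OF m2] by (simp only:)
    qed
    moreover have "char std_normal_distribution (t * sqrt s) = complex_of_real (exp (- (s * t\<^sup>2) / 2))"
      using s by (simp add: char_std_normal_distribution power_mult_distrib mult.commute)
    ultimately show ?thesis by simp
  qed
qed

text \<open>No convergence of the approximating variances is assumed: they stay in a compact interval, and
  the limit along a subsequence already determines the limit of the characteristic functions.\<close>

lemma (in prob_space) clt_by_approximation:
  fixes S :: "nat \<Rightarrow> 'a \<Rightarrow> real"
  assumes S: "\<And>n. S n \<in> borel_measurable M"
    and approx: "\<And>e. e > 0 \<Longrightarrow> \<exists>s R. 0 \<le> s \<and> s \<le> b \<and> (\<forall>n. R n \<in> borel_measurable M) \<and>
      (\<forall>t. (\<lambda>n. char (distr M borel (R n)) t) \<longlonglongrightarrow> complex_of_real (exp (- (s * t\<^sup>2) / 2))) \<and>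
      eventually (\<lambda>n. integrable M (\<lambda>x. (S n x - R n x)\<^sup>2) \<and> expectation (\<lambda>x. (S n x - R n x)\<^sup>2) \<le> e\<^sup>2) sequentially"
  shows "\<exists>\<sigma>\<ge>0. weak_conv_m (\<lambda>n. distr M borel (S n)) (centered_gaussian \<sigma>)"
proof -
  define e where "e k = 1 / (real k + 1)" for k
  have e: "e k > 0" for k by (simp add: e_def)
  define Q where "Q k s R \<longleftrightarrow> 0 \<le> s \<and> s \<le> b \<and> (\<forall>n. R n \<in> borel_measurable M) \<and>
      (\<forall>t. (\<lambda>n. char (distr M borel (R n)) t) \<longlonglongrightarrow> complex_of_real (exp (- (s * t\<^sup>2) / 2))) \<and>
      eventually (\<lambda>n. integrable M (\<lambda>x. (S n x - R n x)\<^sup>2) \<and> expectation (\<lambda>x. (S n x - R n x)\<^sup>2) \<le> (e k)\<^sup>2) sequentially"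
    for k s and R :: "nat \<Rightarrow> 'a \<Rightarrow> real"
  have "\<forall>k. \<exists>s R. Q k s R" unfolding Q_def using approx[OF e] by (rule allI)
  from choice[OF this] obtain s where "\<forall>k. \<exists>R. Q k (s k) R" by (rule exE)
  from choice[OF this] obtain R where "\<forall>k. Q k (s k) (R k)" by (rule exE)
  then have QR: "Q k (s k) (R k)" for k by (rule spec)
  have s: "0 \<le> s k" "s k \<le> b" for k
    using QR[of k] unfolding Q_def by simp_all
  have R: "R k n \<in> borel_measurable M" for k n
    using QR[of k] unfolding Q_def by simp
  have lim: "(\<lambda>n. char (distr M borel (R k n)) t) \<longlonglongrightarrow> complex_of_real (exp (- (s k * t\<^sup>2) / 2))" for k t
    using QR[of k] unfolding Q_def by simp
  have ev: "eventually (\<lambda>n. integrable M (\<lambda>x. (S n x - R k n x)\<^sup>2)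
      \<and> expectation (\<lambda>x. (S n x - R k n x)\<^sup>2) \<le> (e k)\<^sup>2) sequentially" for k
    using QR[of k] unfolding Q_def by simp
  have "compact {0..b}" by simp
  moreover have "\<forall>k. s k \<in> {0..b}" using s by simp
  ultimately obtain l r where l: "l \<in> {0..b}" and r: "strict_mono r" "(s \<circ> r) \<longlonglongrightarrow> l"
    unfolding compact_eq_seq_compact_metric seq_compact_def by blast
  have conv: "(\<lambda>n. char (distr M borel (S n)) t) \<longlonglongrightarrow> complex_of_real (exp (- (l * t\<^sup>2) / 2))" for t
  proof (rule tendstoI)
    fix \<epsilon> :: real assume \<epsilon>: "\<epsilon> > 0"
    let ?g = "\<lambda>s. complex_of_real (exp (- (s * t\<^sup>2) / 2))"
    have "(\<lambda>k. ?g (s (r k))) \<longlonglongrightarrow> ?g l"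
      by (intro tendsto_intros r(2)[unfolded o_def]) simp
    from tendstoD[OF this, of "\<epsilon> / 3"] \<epsilon>
    have 1: "eventually (\<lambda>k. dist (?g (s (r k))) (?g l) < \<epsilon> / 3) sequentially" by simp
    have "(\<lambda>k. \<bar>t\<bar> * e k) \<longlonglongrightarrow> \<bar>t\<bar> * 0"
      unfolding e_def by (intro tendsto_intros) real_asymp
    then have "(\<lambda>k. \<bar>t\<bar> * e (r k)) \<longlonglongrightarrow> 0"
      using LIMSEQ_subseq_LIMSEQ[OF _ r(1), of "\<lambda>k. \<bar>t\<bar> * e k" 0] by (simp add: o_def)
    from order_tendstoD(2)[OF this, of "\<epsilon> / 3"] \<epsilon>
    have 2: "eventually (\<lambda>k. \<bar>t\<bar> * e (r k) < \<epsilon> / 3) sequentially" by simp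
    \<comment> \<open>One fixed k on the subsequence makes both the distance of its Gaussian to the
      limit and its approximation error small; only then does n tend to infinity.\<close>
    obtain k where k: "dist (?g (s (r k))) (?g l) < \<epsilon> / 3" "\<bar>t\<bar> * e (r k) < \<epsilon> / 3"
      using eventually_happens'[OF _ eventually_conj[OF 1 2]] by auto
    have "eventually (\<lambda>n. dist (char (distr M borel (R (r k) n)) t) (?g (s (r k))) < \<epsilon> / 3) sequentially"
      using tendstoD[OF lim[of "r k" t], of "\<epsilon> / 3"] \<epsilon> by simp
    with ev[of "r k"] show "eventually (\<lambda>n. dist (char (distr M borel (S n)) t) (?g l) < \<epsilon>) sequentially"
    proof eventually_elim
      case (elim n)
      have "dist (char (distr M borel (S n)) t) (char (distr M borel (R (r k) n)) t) \<le> \<bar>t\<bar> * e (r k)"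
        unfolding dist_norm using elim(1) e by (intro char_distr_diff_le S R) (auto simp: less_imp_le)
      then show ?case
        using k elim(2) dist_triangle[of "char (distr M borel (S n)) t" "?g l" "char (distr M borel (R (r k) n)) t"]
          dist_triangle[of "char (distr M borel (R (r k) n)) t" "?g l" "?g (s (r k))"] by linarith
    qed
  qed
  have l0: "sqrt l \<ge> 0" using l by simp
  have "weak_conv_m (\<lambda>n. distr M borel (S n)) (centered_gaussian (sqrt l))"
  proof (rule levy_continuity)
    show "real_distribution (distr M borel (S n))" for n by (rule real_distribution_distr[OF S])
    show "real_distribution (centered_gaussian (sqrt l))" by (rule real_distribution_centered_gaussian[OF l0])
    show "(\<lambda>n. char (distr M borel (S n)) t) \<longlonglongrightarrow> char (centered_gaussian (sqrt l)) t" for t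
      using conv[of t] l by (simp add: char_centered_gaussian[OF l0])
  qed
  with l0 show ?thesis by blast
qed

subsection \<open>Approximation by finitely many symbols\<close>

definition L2 :: "'a measure \<Rightarrow> ('a \<Rightarrow> real) \<Rightarrow> bool" where
  "L2 M U \<longleftrightarrow> U \<in> borel_measurable M \<and> integrable M (\<lambda>x. (U x)\<^sup>2)"

lemma L2_mult: "L2 M U \<Longrightarrow> L2 M (\<lambda>x. c * U x)"
  unfolding L2_def power_mult_distrib by (auto intro: borel_measurable_times)

lemma L2_add: "L2 M U \<Longrightarrow> L2 M V \<Longrightarrow> L2 M (\<lambda>x. U x + V x)"
  unfolding L2_def
proof (intro conjI; elim conjE)
  assume UV: "U \<in> borel_measurable M" "V \<in> borel_measurable M"
    and sq: "integrable M (\<lambda>x. (U x)\<^sup>2)" "integrable M (\<lambda>x. (V x)\<^sup>2)"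
  show "(\<lambda>x. U x + V x) \<in> borel_measurable M" by (rule borel_measurable_add[OF UV])
  have "integrable M (\<lambda>x. (U x)\<^sup>2 + (V x)\<^sup>2 + 2 * (U x * V x))"
    by (intro Bochner_Integration.integrable_add sq integrable_mult_right integrable_mult_of_squares UV)
  then show "integrable M (\<lambda>x. (U x + V x)\<^sup>2)" by (simp add: power2_sum mult.assoc)
qed

lemma L2_diff: "L2 M U \<Longrightarrow> L2 M V \<Longrightarrow> L2 M (\<lambda>x. U x - V x)"
  using L2_add[of M U "\<lambda>x. (- 1) * V x"] L2_mult[of M V "- 1"] by simp

lemma L2_sum: "finite J \<Longrightarrow> (\<And>j. j \<in> J \<Longrightarrow> L2 M (U j)) \<Longrightarrow> L2 M (\<lambda>x. \<Sum>j\<in>J. U j x)"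
proof (induction J rule: finite_induct)
  case empty
  then show ?case by (simp add: L2_def)
next
  case (insert j J)
  then show ?case using L2_add[of M "U j" "\<lambda>x. \<Sum>j\<in>J. U j x"] by simp
qed

lemma (in finite_measure) L2_const: "L2 M (\<lambda>x. c)"
  by (simp add: L2_def)

lemma integral_square_add_le:
  assumes "L2 M U" "L2 M V"
  shows "(\<integral>x. (U x + V x)\<^sup>2 \<partial>M) \<le> 2 * (\<integral>x. (U x)\<^sup>2 \<partial>M) + 2 * (\<integral>x. (V x)\<^sup>2 \<partial>M)"
proof -
  have sq: "integrable M (\<lambda>x. (U x)\<^sup>2)" "integrable M (\<lambda>x. (V x)\<^sup>2)" using assms by (simp_all add: L2_def)
  have "(\<integral>x. (U x + V x)\<^sup>2 \<partial>M) \<le> (\<integral>x. 2 * (U x)\<^sup>2 + 2 * (V x)\<^sup>2 \<partial>M)"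
    by (rule integral_mono) (use L2_add[OF assms] sq power2_add_le in \<open>auto simp: L2_def\<close>)
  then show ?thesis using sq by simp
qed

lemma integral_square_diff_le:
  assumes "L2 M U" "L2 M V"
  shows "(\<integral>x. (U x - V x)\<^sup>2 \<partial>M) \<le> 2 * (\<integral>x. (U x)\<^sup>2 \<partial>M) + 2 * (\<integral>x. (V x)\<^sup>2 \<partial>M)"
  using integral_square_add_le[OF assms(1) L2_mult[OF assms(2), of "- 1"]] by simp

lemma L2_iid_reindex:
  assumes "prob_space M" "inj f" "L2 (iid M) U"
  shows "L2 (iid M) (\<lambda>x. U (\<lambda>i. x (f i)))"
proof -
  have U: "U \<in> borel_measurable (iid M)" and sq: "integrable (iid M) (\<lambda>w. (U w)\<^sup>2)"
    using assms(3) by (simp_all add: L2_def)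
  show ?thesis
    unfolding L2_def
    using measurable_compose[OF measurable_iid_reindex U]
      integrable_iid_reindex[OF assms(1,2) borel_measurable_power[OF U, of 2]] sq by simp
qed

context orbit_process
begin

lemma L2_obs: "exp_lipschitz M f \<Longrightarrow> finite A \<Longrightarrow> L2 P (obs f A j)"
  unfolding L2_def by (intro conjI obs_measurable obs_square_integrable)

text \<open>By invariance under the shift every \<open>obs f A j\<close> has this mean, not only the
  one with j = 0.\<close>

definition cmean :: "('a \<Rightarrow> real) \<Rightarrow> int set \<Rightarrow> real" where
  "cmean f A = (\<integral>w. obs f A 0 w \<partial>P)"

lemma obs_shift: "obs f A (i + j) w = obs f A j (shift_seq i w)"
proof -
  have "shift_seq (i + j) w = shift_seq j (shift_seq i w)"
    by (simp add: shift_seq_def fun_eq_iff algebra_simps)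
  then show ?thesis by (simp add: obs_def)
qed

lemma integral_shift:
  fixes H :: "(int \<Rightarrow> nat) \<Rightarrow> real"
  shows "H \<in> borel_measurable P \<Longrightarrow> (\<integral>w. H (shift_seq i w) \<partial>P) = (\<integral>w. H w \<partial>P)"
  unfolding shift_seq_def by (rule integral_iid_reindex[OF Mp inj_shift])

lemma integral_obs: "exp_lipschitz M f \<Longrightarrow> (\<integral>w. obs f A j w \<partial>P) = cmean f A"
  using integral_shift[OF obs_measurable, of M f A 0 j] obs_shift[of f A j 0] by (simp add: cmean_def)

lemma abs_cmean_le:
  assumes f: "exp_lipschitz M f" and A: "finite A"
  shows "\<bar>cmean f A\<bar> \<le> M * (\<integral>w. V w \<partial>P)"
proof -
  have "\<bar>cmean f A\<bar> \<le> (\<integral>w. \<bar>obs f A 0 w\<bar> \<partial>P)" unfolding cmean_def by (rule integral_abs_bound)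
  also have "\<dots> \<le> (\<integral>w. M * V (shift_seq 0 w) \<partial>P)"
  proof (rule integral_mono_AE')
    show "integrable P (\<lambda>w. M * V (shift_seq 0 w))" by (rule integrable_mult_right[OF V_shift(1)])
    show "AE w in P. \<bar>obs f A 0 w\<bar> \<le> M * V (shift_seq 0 w)"
      using AE_tame_shift[of 0] by eventually_elim (rule abs_obs_le(1)[OF f _ A])
    show "AE w in P. 0 \<le> M * V (shift_seq 0 w)"
      using AE_tame_shift[of 0] by eventually_elim (rule order_trans[OF abs_ge_zero abs_obs_le(1)[OF f _ A]])
  qed
  also have "\<dots> = M * (\<integral>w. V w \<partial>P)" unfolding integral_mult_right_zero V_shift(2) ..
  finally show ?thesis .
qed

lemma variance_obs_le:
  assumes f: "exp_lipschitz M f" and A: "finite A" and \<alpha>: "\<alpha> > 1" and J: "finite J"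
  shows "(\<integral>w. (\<Sum>j\<in>J. obs f A j w - cmean f A)\<^sup>2 \<partial>P) \<le> real (card J) * (\<kappa> M * total)\<^sup>2"
proof -
  have M: "M > 0" using f by (simp add: exp_lipschitz_def)
  have "(\<integral>w. (\<Sum>j\<in>J. obs f A j w - (\<integral>w. obs f A j w \<partial>P))\<^sup>2 \<partial>P) \<le> real (card J) * (\<kappa> M * total)\<^sup>2"
  proof (rule iid_variance_sum_le[OF Mp obs_measurable[OF f] obs_square_integrable[OF f A]])
    show "finite ((\<lambda>k. k - int j) ` A)" for j using A by simp
    show "depends_on (obs f A j) ((\<lambda>k. k - int j) ` A)" for j by (rule obs_depends_on)
    show "(\<integral>x. (obs f A j (\<lambda>i. x (i, False)) - obs f A j (\<lambda>i. x (i, i = k)))\<^sup>2 \<partial>(iid (measure_pmf p)))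
        \<le> (\<kappa> M * wt (k + int j))\<^sup>2" for j k by (rule obs_oscillation[OF f A])
    show "0 \<le> \<kappa> M * wt k" for k by (intro mult_nonneg_nonneg kappa_nonneg M wt_nonneg)
    show "(\<Sum>k\<in>B. \<kappa> M * wt k) \<le> \<kappa> M * total" if "finite B" for B
      unfolding sum_distrib_left[symmetric]
      by (intro mult_left_mono sum_wt_le_total \<alpha> that kappa_nonneg M)
  qed (rule J)
  then show ?thesis by (simp only: integral_obs[OF f])
qed

text \<open>The influence of a coordinate on the truncation error is bounded both by its influence on the two
  truncations, which is summable, and by the norm of the error, which is small; the minimum of the two
  has a small sum.\<close>

lemma variance_obs_diff_le:
  assumes f: "exp_lipschitz M f" and \<alpha>: "\<alpha> > 1" and \<eta>: "\<eta> > 0"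
  shows "\<exists>m. \<forall>m'\<ge>m. \<forall>J. finite J \<longrightarrow>
    (\<integral>w. (\<Sum>j\<in>J. obs f (I m') j w - obs f (I m) j w - (cmean f (I m') - cmean f (I m)))\<^sup>2 \<partial>P)
      \<le> real (card J) * \<eta>\<^sup>2"
proof -
  have M: "M > 0" using f by (simp add: exp_lipschitz_def)
  \<comment> \<open>The summand 1 makes c positive, so that it can be divided by.\<close>
  define c where "c = 2 * \<kappa> M + 1"
  have c: "c > 0" "2 * \<kappa> M \<le> c" using kappa_nonneg[OF M] by (simp_all add: c_def)
  have "\<eta> / (2 * c) > 0" using c \<eta> by simp
  from small_tails[OF \<alpha> this] obtain r where
    r: "\<And>B. finite B \<Longrightarrow> B \<inter> I r = {} \<Longrightarrow> sum wt B \<le> \<eta> / (2 * c)" by metis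
  \<comment> \<open>The window \<open>I r\<close> has 2 r + 1 positions with influence at most c
    \<tau> each, which add up to \<eta>/2; r was chosen so that the influences outside add up to at
    most \<eta>/2.\<close>
  define \<tau> where "\<tau> = \<eta> / (2 * c * (2 * real r + 1))"
  have \<tau>: "\<tau> > 0" using c \<eta> by (simp add: \<tau>_def)
  from small_tails[OF \<alpha> this] obtain m where
    m: "\<And>B. finite B \<Longrightarrow> B \<inter> I m = {} \<Longrightarrow> sum wt B \<le> \<tau>" by metis
  \<comment> \<open>The factor 2 comes from squaring a difference: twice the sum of two squares of
    size at most a^2 is at most (2a)^2.\<close>
  define q where "q k = 2 * \<kappa> M * min (wt k) \<tau>" for k
  have q0: "q k \<ge> 0" for k using kappa_nonneg[OF M] wt_nonneg[of k] \<tau> by (simp add: q_def)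
  have qS: "(\<Sum>k\<in>B. q k) \<le> \<eta>" if B: "finite B" for B
  proof -
    have "(\<Sum>k\<in>B. q k) = (\<Sum>k\<in>B \<inter> I r. q k) + (\<Sum>k\<in>B - I r. q k)" by (rule sum.Int_Diff[OF B])
    also have "(\<Sum>k\<in>B \<inter> I r. q k) \<le> (\<Sum>k\<in>I r. c * \<tau>)"
    proof (rule order_trans[OF sum_mono2[where B="I r"]])
      show "(\<Sum>k\<in>I r. q k) \<le> (\<Sum>k\<in>I r. c * \<tau>)"
        unfolding q_def using c \<tau> wt_nonneg kappa_nonneg[OF M] by (intro sum_mono mult_mono) auto
    qed (use q0 in auto)
    also have "(\<Sum>k\<in>I r. c * \<tau>) = \<eta> / 2"
    proof -
      have "(2 * real r + 1) * (c * (\<eta> / (2 * c * (2 * real r + 1)))) = \<eta> / 2"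
      proof -
        have "y * (c * (\<eta> / (2 * c * y))) = \<eta> / 2" if "y > 0" for y :: real using that c(1) by simp
        then show ?thesis by simp
      qed
      then show ?thesis by (simp add: \<tau>_def)
    qed
    also have "(\<Sum>k\<in>B - I r. q k) \<le> (\<Sum>k\<in>B - I r. c * wt k)"
      unfolding q_def using c \<tau> wt_nonneg kappa_nonneg[OF M] by (intro sum_mono mult_mono) auto
    also have "\<dots> \<le> c * (\<eta> / (2 * c))"
      unfolding sum_distrib_left[symmetric] using B c by (intro mult_left_mono r) auto
    also have "\<dots> = \<eta> / 2" using c by simp
    finally show ?thesis by simp
  qed
  have "(\<integral>w. (\<Sum>j\<in>J. obs f (I m') j w - obs f (I m) j w - (cmean f (I m') - cmean f (I m)))\<^sup>2 \<partial>P)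
      \<le> real (card J) * \<eta>\<^sup>2" if m': "m' \<ge> m" and J: "finite J" for m' and J :: "nat set"
  proof -
    define H where "H j w = obs f (I m') j w - obs f (I m) j w" for j w
    have HL2: "L2 P (H j)" for j unfolding H_def by (intro L2_diff L2_obs[OF f]) auto
    have eH: "(\<integral>w. H j w \<partial>P) = cmean f (I m') - cmean f (I m)" for j
    proof -
      have "integrable P (obs f (I n) j)" for n
        by (rule P.square_integrable_imp_integrable[OF obs_measurable[OF f] obs_square_integrable[OF f]]) simp
      then show ?thesis unfolding H_def by (simp add: integral_obs[OF f])
    qed
    have tau: "(\<integral>w. (H j w)\<^sup>2 \<partial>P) \<le> (\<kappa> M * \<tau>)\<^sup>2" for j
    proof -
      have "(\<integral>w. (H j w)\<^sup>2 \<partial>P) \<le> (\<kappa> M * sum wt (I m' - I m))\<^sup>2"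
        unfolding H_def by (rule obs_diff_square_le[OF f m'])
      also have "\<dots> \<le> (\<kappa> M * \<tau>)\<^sup>2"
        using kappa_nonneg[OF M] by (intro power_mono mult_left_mono m mult_nonneg_nonneg sum_nonneg wt_nonneg) auto
      finally show ?thesis .
    qed
    have "(\<integral>w. (\<Sum>j\<in>J. H j w - (\<integral>w. H j w \<partial>P))\<^sup>2 \<partial>P) \<le> real (card J) * \<eta>\<^sup>2"
    proof (rule iid_variance_sum_le[OF Mp])
      show "H j \<in> borel_measurable P" "integrable P (\<lambda>w. (H j w)\<^sup>2)" for j
        using HL2[of j] by (simp_all add: L2_def)
      show "finite ((\<lambda>k. k - int j) ` I m')" for j by simp
      show "depends_on (H j) ((\<lambda>k. k - int j) ` I m')" for j
      proof -
        have "(\<lambda>k. k - int j) ` I m \<subseteq> (\<lambda>k. k - int j) ` I m'" using m' by (intro image_mono) auto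
        note sub = subsetD[OF this]
        show ?thesis
          unfolding depends_on_def H_def
        proof (intro allI impI)
          fix w w' :: "int \<Rightarrow> nat" assume eq: "\<forall>i\<in>(\<lambda>k. k - int j) ` I m'. w i = w' i"
          have "obs f (I m') j w = obs f (I m') j w'"
            by (rule depends_onD[OF obs_depends_on]) (rule bspec[OF eq])
          moreover have "obs f (I m) j w = obs f (I m) j w'"
            by (rule depends_onD[OF obs_depends_on]) (rule bspec[OF eq sub])
          ultimately show "obs f (I m') j w - obs f (I m) j w = obs f (I m') j w' - obs f (I m) j w'"
            by simp
        qed
      qed
      show "(\<integral>x. (H j (\<lambda>i. x (i, False)) - H j (\<lambda>i. x (i, i = k)))\<^sup>2 \<partial>(iid (measure_pmf p)))
          \<le> (q (k + int j))\<^sup>2" for j k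
      proof -
        let ?Q = "iid (measure_pmf p) :: (int \<times> bool \<Rightarrow> nat) measure"
        have inj: "inj (\<lambda>i::int. (i, False))" "inj (\<lambda>i::int. (i, i = k))" by (auto intro!: injI)
        note LI = L2_iid_reindex[OF Mp inj(1)] L2_iid_reindex[OF Mp inj(2)]
        let ?D = "\<lambda>n x. obs f (I n) j (\<lambda>i. x (i, False)) - obs f (I n) j (\<lambda>i. x (i, i = k))"
        have LD: "L2 ?Q (?D n)" for n by (intro L2_diff LI L2_obs[OF f]) auto
        have "(\<integral>x. (H j (\<lambda>i. x (i, False)) - H j (\<lambda>i. x (i, i = k)))\<^sup>2 \<partial>?Q) = (\<integral>x. (?D m' x - ?D m x)\<^sup>2 \<partial>?Q)"
          unfolding H_def by (intro Bochner_Integration.integral_cong refl) (simp add: algebra_simps)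
        also have "\<dots> \<le> 2 * (\<integral>x. (?D m' x)\<^sup>2 \<partial>?Q) + 2 * (\<integral>x. (?D m x)\<^sup>2 \<partial>?Q)"
          by (rule integral_square_diff_le[OF LD LD])
        also have "\<dots> \<le> 2 * (\<kappa> M * wt (k + int j))\<^sup>2 + 2 * (\<kappa> M * wt (k + int j))\<^sup>2"
          by (intro add_mono mult_left_mono obs_oscillation[OF f]) auto
        finally have 1: "(\<integral>x. (H j (\<lambda>i. x (i, False)) - H j (\<lambda>i. x (i, i = k)))\<^sup>2 \<partial>?Q) \<le> (2 * \<kappa> M * wt (k + int j))\<^sup>2"
          by (simp add: power_mult_distrib)
        have Hm: "(\<lambda>w. (H j w)\<^sup>2) \<in> borel_measurable P"
          using HL2[of j] unfolding L2_def by (intro borel_measurable_power) simp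
        have "(\<integral>x. (H j (\<lambda>i. x (i, False)) - H j (\<lambda>i. x (i, i = k)))\<^sup>2 \<partial>?Q)
            \<le> 2 * (\<integral>x. (H j (\<lambda>i. x (i, False)))\<^sup>2 \<partial>?Q) + 2 * (\<integral>x. (H j (\<lambda>i. x (i, i = k)))\<^sup>2 \<partial>?Q)"
          by (rule integral_square_diff_le[OF LI(1)[OF HL2] LI(2)[OF HL2]])
        also have "\<dots> = 4 * (\<integral>w. (H j w)\<^sup>2 \<partial>P)"
          unfolding integral_iid_reindex[OF Mp inj(1) Hm] integral_iid_reindex[OF Mp inj(2) Hm] by simp
        also have "\<dots> \<le> 4 * (\<kappa> M * \<tau>)\<^sup>2" using tau[of j] by simp
        finally have 2: "(\<integral>x. (H j (\<lambda>i. x (i, False)) - H j (\<lambda>i. x (i, i = k)))\<^sup>2 \<partial>?Q) \<le> (2 * \<kappa> M * \<tau>)\<^sup>2"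
          by (simp add: power_mult_distrib)
        show ?thesis using 1 2 unfolding q_def min_def by (simp split: if_split)
      qed
    qed (use q0 qS J in auto)
    then show ?thesis unfolding eH by (simp only: H_def)
  qed
  then show ?thesis by blast
qed

end

section \<open>Full observables as limits of truncated ones\<close>

context orbit_process
begin

definition F :: "('a \<Rightarrow> real) \<Rightarrow> nat \<Rightarrow> (int \<Rightarrow> nat) \<Rightarrow> real" where
  "F f j w = f (\<Phi> (shift_seq j w))"

lemma L2_F:
  assumes f: "exp_lipschitz M f"
  shows "L2 P (F f j)"
  unfolding L2_def
proof
  show m: "F f j \<in> borel_measurable P" unfolding F_def[abs_def] by (rule f_Phi_shift_measurable[OF f])
  show "integrable P (\<lambda>w. (F f j w)\<^sup>2)"
  proof (rule Bochner_Integration.integrable_bound)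
    show "integrable P (\<lambda>w. M\<^sup>2 * V (shift_seq j w))" by (rule integrable_mult_right[OF V_shift(1)])
    show "(\<lambda>w. (F f j w)\<^sup>2) \<in> borel_measurable P" by (rule borel_measurable_power[OF m])
    show "AE w in P. norm ((F f j w)\<^sup>2) \<le> norm (M\<^sup>2 * V (shift_seq j w))"
      using AE_tame_shift[of j]
    proof eventually_elim
      case (elim w)
      have "(obs f (I m) j w)\<^sup>2 \<le> M\<^sup>2 * V (shift_seq j w)" for m by (rule abs_obs_le(2)[OF f elim]) simp
      then have "(F f j w)\<^sup>2 \<le> M\<^sup>2 * V (shift_seq j w)"
        unfolding F_def
        by (intro tendsto_upperbound[OF tendsto_power[OF obs_tendsto[OF f elim], of 2]]) auto
      then show ?case by simp
    qed
  qed
qed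

text \<open>With the inner window fixed, the previous estimate does not depend on the outer one, so
  the outer window may grow to everything. Its centring constants tend to the mean of f, which is
  0.\<close>

lemma variance_F_minus_obs_le:
  assumes f: "exp_lipschitz M f" and \<alpha>: "\<alpha> > 1" and mean: "(\<integral>w. f (\<Phi> w) \<partial>P) = 0" and \<eta>: "\<eta> > 0"
  shows "\<exists>m. \<forall>J. finite J \<longrightarrow>
    (\<integral>w. (\<Sum>j\<in>J. F f j w - (obs f (I m) j w - cmean f (I m)))\<^sup>2 \<partial>P) \<le> real (card J) * \<eta>\<^sup>2"
proof -
  from variance_obs_diff_le[OF f \<alpha> \<eta>] obtain m where m: "\<forall>m'\<ge>m. \<forall>J. finite J \<longrightarrow>
    (\<integral>w. (\<Sum>j\<in>J. obs f (I m') j w - obs f (I m) j w - (cmean f (I m') - cmean f (I m)))\<^sup>2 \<partial>P)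
      \<le> real (card J) * \<eta>\<^sup>2" by (rule exE)
  have "(\<integral>w. (\<Sum>j\<in>J. F f j w - (obs f (I m) j w - cmean f (I m)))\<^sup>2 \<partial>P) \<le> real (card J) * \<eta>\<^sup>2"
    if J: "finite J" for J
  proof (rule tendsto_upperbound[where F=sequentially])
    let ?s = "\<lambda>n w. (\<Sum>j\<in>J. obs f (I n) j w - obs f (I m) j w - (cmean f (I n) - cmean f (I m)))\<^sup>2"
    let ?B = "M * (\<integral>w. V w \<partial>P)"
    have c0: "(\<lambda>n. cmean f (I n)) \<longlonglongrightarrow> 0"
      using integral_obs_tendsto[OF f, of 0] mean unfolding cmean_def shift_seq_0 by simp
    have sm: "?s n \<in> borel_measurable P" for n
    proof -
      have "L2 P (\<lambda>w. \<Sum>j\<in>J. obs f (I n) j w - obs f (I m) j w - (cmean f (I n) - cmean f (I m)))"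
        by (intro L2_sum J L2_diff L2_obs[OF f] P.L2_const) auto
      then show ?thesis unfolding L2_def by (intro borel_measurable_power) simp
    qed
    show "(\<lambda>n. \<integral>w. ?s n w \<partial>P) \<longlonglongrightarrow> (\<integral>w. (\<Sum>j\<in>J. F f j w - (obs f (I m) j w - cmean f (I m)))\<^sup>2 \<partial>P)"
    proof (rule integral_dominated_convergence[OF _ sm])
      have "L2 P (\<lambda>w. \<Sum>j\<in>J. F f j w - (obs f (I m) j w - cmean f (I m)))"
        by (intro L2_sum J L2_diff L2_F[OF f] L2_obs[OF f] P.L2_const) auto
      then show "(\<lambda>w. (\<Sum>j\<in>J. F f j w - (obs f (I m) j w - cmean f (I m)))\<^sup>2) \<in> borel_measurable P"
        unfolding L2_def by (intro borel_measurable_power) simp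
      \<comment> \<open>The squared sum is at most \<open>card J\<close> times the sum of squares,
        and the square of a signed sum of four terms at most four times the sum of their squares.
        Two of the four are bounded through V and two through the means, hence 8 twice.\<close>
      show "integrable P (\<lambda>w. (\<Sum>j\<in>J. 8 * M\<^sup>2 * V (shift_seq j w) + 8 * ?B\<^sup>2) * real (card J))"
        by (intro integrable_mult_left Bochner_Integration.integrable_sum Bochner_Integration.integrable_add
          integrable_mult_right V_shift(1) P.integrable_const)
      have AEs: "AE w in P. \<forall>j. tame (shift_seq j w)" unfolding AE_all_countable using AE_tame_shift by blast
      show "AE w in P. (\<lambda>n. ?s n w) \<longlonglongrightarrow> (\<Sum>j\<in>J. F f j w - (obs f (I m) j w - cmean f (I m)))\<^sup>2"
        using AEs
      proof eventually_elim
        case (elim w)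
        have "(\<lambda>n. ?s n w) \<longlonglongrightarrow> (\<Sum>j\<in>J. f (\<Phi> (shift_seq j w)) - obs f (I m) j w - (0 - cmean f (I m)))\<^sup>2"
          by (intro tendsto_power tendsto_sum tendsto_diff obs_tendsto[OF f] c0 tendsto_const elim[rule_format])
        then show ?case by (simp add: F_def diff_diff_eq2 add_diff_eq[symmetric] diff_add_eq)
      qed
      show "AE w in P. norm (?s n w) \<le> (\<Sum>j\<in>J. 8 * M\<^sup>2 * V (shift_seq j w) + 8 * ?B\<^sup>2) * real (card J)" for n
        using AEs
      proof eventually_elim
        case (elim w)
        have c2: "(cmean f (I k))\<^sup>2 \<le> ?B\<^sup>2" for k
          using power_mono[OF abs_cmean_le[OF f, of "I k"], of 2] by simp
        have "?s n w \<le> (\<Sum>j\<in>J. (obs f (I n) j w - obs f (I m) j w - (cmean f (I n) - cmean f (I m)))\<^sup>2) * real (card J)"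
          by (rule sum_squared_le_sum_of_squares)
        also have "\<dots> \<le> (\<Sum>j\<in>J. 8 * M\<^sup>2 * V (shift_seq j w) + 8 * ?B\<^sup>2) * real (card J)"
        proof (intro mult_right_mono sum_mono)
          fix j
          let ?a = "obs f (I n) j w" and ?b = "obs f (I m) j w" and ?c = "cmean f (I n)" and ?d = "cmean f (I m)"
          have ab: "?a\<^sup>2 \<le> M\<^sup>2 * V (shift_seq j w)" "?b\<^sup>2 \<le> M\<^sup>2 * V (shift_seq j w)"
            by (rule abs_obs_le(2)[OF f elim[rule_format]], simp)+
          have "(?a - ?b - (?c - ?d))\<^sup>2 \<le> 2 * (?a - ?b)\<^sup>2 + 2 * (?c - ?d)\<^sup>2" by (rule power2_diff_le)
          moreover have "(?a - ?b)\<^sup>2 \<le> 2 * ?a\<^sup>2 + 2 * ?b\<^sup>2" "(?c - ?d)\<^sup>2 \<le> 2 * ?c\<^sup>2 + 2 * ?d\<^sup>2"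
            by (rule power2_diff_le)+
          ultimately show "(?a - ?b - (?c - ?d))\<^sup>2 \<le> 8 * M\<^sup>2 * V (shift_seq j w) + 8 * ?B\<^sup>2"
            using ab c2[of n] c2[of m] by linarith
        qed simp
        finally show ?case by simp
      qed
    qed
    show "\<forall>\<^sub>F n in sequentially. (\<integral>w. ?s n w \<partial>P) \<le> real (card J) * \<eta>\<^sup>2"
      unfolding eventually_sequentially using m J by (intro exI[of _ m]) simp
  qed simp
  then show ?thesis by blast
qed

section \<open>Independent blocks separated by gaps\<close>

definition block :: "('a \<Rightarrow> real) \<Rightarrow> nat \<Rightarrow> nat \<Rightarrow> nat \<Rightarrow> nat \<Rightarrow> (int \<Rightarrow> nat) \<Rightarrow> real" where
  "block f m L q i w = (\<Sum>j<L. obs f (I m) (i * q + j) w - cmean f (I m))"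

lemma block_eq_shift: "block f m L q i w = block f m L q 0 (shift_seq (i * q) w)"
  unfolding block_def obs_shift[of f "I m" "i * q"] by simp

lemma L2_block: "exp_lipschitz M f \<Longrightarrow> L2 P (block f m L q i)"
  unfolding block_def[abs_def] by (intro L2_sum L2_diff L2_obs P.L2_const) auto

lemma block_mean:
  assumes f: "exp_lipschitz M f"
  shows "(\<integral>w. block f m L q i w \<partial>P) = 0"
proof -
  have "integrable P (obs f (I m) j)" for j
    by (rule P.square_integrable_imp_integrable[OF obs_measurable[OF f] obs_square_integrable[OF f]]) simp
  then show ?thesis
    unfolding block_def by (simp add: integral_obs[OF f] P.prob_space)
qed

text \<open>\<open>obs f (I m) j\<close> reads the symbols within distance m of -j, so a block reads
  an interval of L + 2 m positions. Consecutive blocks start exactly that far apart, which keeps the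
  intervals disjoint.\<close>

lemma block_indep:
  assumes f: "exp_lipschitz M f" and q: "q = L + 2 * m" "L > 0"
  shows "P.indep_vars (\<lambda>_. borel) (block f m L q) UNIV"
proof (rule indep_vars_iid_blocks[OF Mp])
  let ?A = "\<lambda>i. \<Union>j<L. (\<lambda>k. k - int (i * q + j)) ` I m"
  show "block f m L q i \<in> borel_measurable P" for i using L2_block[OF f] by (simp add: L2_def)
  show "depends_on (block f m L q i) (?A i)" for i
    unfolding depends_on_def
  proof (intro allI impI)
    fix w w' :: "int \<Rightarrow> nat" assume eq: "\<forall>k\<in>?A i. w k = w' k"
    have "obs f (I m) (i * q + j) w = obs f (I m) (i * q + j) w'" if "j < L" for j
    proof (rule depends_onD[OF obs_depends_on])
      fix k assume "k \<in> (\<lambda>k. k - int (i * q + j)) ` I m"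
      then have "k \<in> ?A i" using that by blast
      then show "w k = w' k" by (rule bspec[OF eq])
    qed
    then show "block f m L q i w = block f m L q i w'" unfolding block_def by simp
  qed
  have sub: "- int i * int q - int (L - 1) - int m \<le> k \<and> k \<le> - int i * int q + int m" if "k \<in> ?A i" for i k
    using that q(2) by (auto simp: of_nat_diff)
  have lt: "?A i \<inter> ?A i' = {}" if "i < i'" for i i'
  proof (rule ccontr)
    assume "?A i \<inter> ?A i' \<noteq> {}"
    then obtain k where "k \<in> ?A i" "k \<in> ?A i'" by blast
    then have "- int i * int q - int (L - 1) - int m \<le> - int i' * int q + int m"
      using sub[of k i] sub[of k i'] by linarith
    then have "int i' * int q \<le> int i * int q + int (L - 1) + 2 * int m" by linarith
    moreover have "(int i + 1) * int q \<le> int i' * int q" using that by (intro mult_right_mono) auto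
    moreover have "int (L - 1) + 2 * int m < int q" using q by simp
    ultimately show False by (simp add: algebra_simps)
  qed
  show "disjoint_family ?A"
    unfolding disjoint_family_on_def
  proof (intro ballI impI)
    fix i i' :: nat assume "i \<noteq> i'"
    then consider "i < i'" | "i' < i" by linarith
    then show "?A i \<inter> ?A i' = {}" by cases (use lt[of i i'] lt[of i' i] in \<open>simp_all only: Int_commute\<close>)
  qed
qed

lemma block_distr:
  assumes f: "exp_lipschitz M f"
  shows "distr P borel (\<lambda>w. c * block f m L q i w) = distr P borel (\<lambda>w. c * block f m L q 0 w)"
proof -
  have m0: "(\<lambda>w. c * block f m L q 0 w) \<in> borel_measurable P"
    using L2_mult[OF L2_block[OF f]] by (simp add: L2_def)
  have "(\<lambda>w. c * block f m L q i w) = (\<lambda>w. c * block f m L q 0 w) \<circ> shift_seq (i * q)"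
    by (simp add: fun_eq_iff block_eq_shift[of f m L q i])
  then have "distr P borel (\<lambda>w. c * block f m L q i w) = distr (distr P P (shift_seq (i * q))) borel (\<lambda>w. c * block f m L q 0 w)"
    by (simp add: distr_distr[OF m0 measurable_shift_P])
  then show ?thesis by (simp add: distr_shift[OF Mp])
qed

lemma block_sets_disjoint:
  fixes i i' q L :: nat
  assumes "L \<le> q" "i \<noteq> i'"
  shows "(+) (i * q) ` {..<L} \<inter> (+) (i' * q) ` {..<L} = {}"
proof (rule ccontr)
  assume "(+) (i * q) ` {..<L} \<inter> (+) (i' * q) ` {..<L} \<noteq> {}"
  then obtain a b where ab: "a < L" "b < L" "i * q + a = i' * q + b" by auto
  have dv: "(k * q + c) div q = k" if "c < L" for k c using that assms(1) by simp
  have "i = i'" using dv[OF ab(1), of i] dv[OF ab(2), of i'] ab(3) by simp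
  then show False using assms(2) by simp
qed

lemma sum_blocks: "(\<Sum>i<r. block f m L q i w) = (\<Sum>j\<in>(\<Union>i<r. (+) (i * q) ` {..<L}). obs f (I m) j w - cmean f (I m))"
  if q: "L \<le> q" for r
proof -
  have "(\<Sum>j\<in>(\<Union>i<r. (+) (i * q) ` {..<L}). obs f (I m) j w - cmean f (I m))
      = (\<Sum>i<r. \<Sum>j\<in>(+) (i * q) ` {..<L}. obs f (I m) j w - cmean f (I m))"
  proof (rule sum.UNION_disjoint)
    show "\<forall>i\<in>{..<r}. \<forall>j\<in>{..<r}. i \<noteq> j \<longrightarrow> (+) (i * q) ` {..<L} \<inter> (+) (j * q) ` {..<L} = {}"
      using block_sets_disjoint[OF q] by simp
  qed auto
  then show ?thesis by (simp add: block_def sum.reindex)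
qed

lemma card_blocks:
  assumes "L \<le> q"
  shows "card (\<Union>i<r. (+) (i * q) ` {..<L}) = r * L" "(\<Union>i<r. (+) (i * q) ` {..<L}) \<subseteq> {..<r * q}"
proof -
  have "card (\<Union>i<r. (+) (i * q) ` {..<L}) = (\<Sum>i<r. card ((+) (i * q) ` {..<L}))"
  proof (rule card_UN_disjoint)
    show "\<forall>i\<in>{..<r}. \<forall>j\<in>{..<r}. i \<noteq> j \<longrightarrow> (+) (i * q) ` {..<L} \<inter> (+) (j * q) ` {..<L} = {}"
      using block_sets_disjoint[OF assms] by simp
  qed auto
  then show "card (\<Union>i<r. (+) (i * q) ` {..<L}) = r * L" by (simp add: card_image)
  show "(\<Union>i<r. (+) (i * q) ` {..<L}) \<subseteq> {..<r * q}"
  proof clarsimp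
    fix i j assume "i < r" "j < L"
    then have "i * q + j < i * q + q" using assms by simp
    also have "\<dots> = (i + 1) * q" by simp
    also have "\<dots> \<le> r * q" using \<open>i < r\<close> by (intro mult_right_mono) auto
    finally show "i * q + j < r * q" .
  qed
qed

end

subsection \<open>The central limit theorem\<close>

lemma filterlim_div_at_top: "q > 0 \<Longrightarrow> filterlim (\<lambda>n::nat. n div q) sequentially sequentially"
  unfolding filterlim_at_top eventually_sequentially
proof
  fix Z :: nat assume q: "q > 0"
  have "Z \<le> n div q" if "n \<ge> Z * q" for n
    using div_le_mono[OF that, of q] q by simp
  then show "\<exists>N. \<forall>n\<ge>N. Z \<le> n div q" by blast
qed

context orbit_process
begin

lemma distr_birkhoff_sum:
  assumes f: "exp_lipschitz M f"
  shows "distr \<mu> borel (\<lambda>y. (\<Sum>j<n. f ((T ^^ j) y)) / sqrt (real n))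
    = distr P borel (\<lambda>w. (\<Sum>j<n. F f j w) / sqrt (real n))"
proof -
  have fb: "f \<in> borel_measurable borel" by (rule exp_lipschitz_borel[OF f])
  have m: "(\<lambda>y. (\<Sum>j<n. f ((T ^^ j) y)) / sqrt (real n)) \<in> borel_measurable borel"
    by (intro borel_measurable_divide borel_measurable_sum borel_measurable_const
      measurable_compose[OF T_power_measurable fb])
  have "L2 P (\<lambda>w. (1 / sqrt (real n)) * (\<Sum>j<n. F f j w))"
    by (intro L2_mult L2_sum L2_F[OF f]) auto
  then have m2: "(\<lambda>w. (\<Sum>j<n. F f j w) / sqrt (real n)) \<in> borel_measurable P"
    by (simp add: L2_def)
  have "distr \<mu> borel (\<lambda>y. (\<Sum>j<n. f ((T ^^ j) y)) / sqrt (real n))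
      = distr P borel ((\<lambda>y. (\<Sum>j<n. f ((T ^^ j) y)) / sqrt (real n)) \<circ> \<Phi>)"
    unfolding \<mu>_def by (rule distr_distr[OF m Phi_measurable])
  also have "\<dots> = distr P borel (\<lambda>w. (\<Sum>j<n. F f j w) / sqrt (real n))"
  proof (rule distr_cong_AE)
    have "AE w in P. \<forall>j. (T ^^ j) (\<Phi> w) = \<Phi> (shift_seq j w)"
      unfolding AE_all_countable using AE_T_power_Phi by blast
    then show "AE w in P. ((\<lambda>y. (\<Sum>j<n. f ((T ^^ j) y)) / sqrt (real n)) \<circ> \<Phi>) w
        = (\<Sum>j<n. F f j w) / sqrt (real n)"
      by eventually_elim (simp add: F_def)
    show "(\<lambda>y. (\<Sum>j<n. f ((T ^^ j) y)) / sqrt (real n)) \<circ> \<Phi> \<in> borel_measurable P"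
      by (rule measurable_comp[OF Phi_measurable m])
  qed (simp_all add: m2)
  finally show ?thesis .
qed

text \<open>X1 is what truncation loses, X2 collects the gaps and the terms after the last full
  period, and X3 is the sum of the blocks; its factor b is the mismatch between the normalizations
  by n and by N = r q. The variance of each part is at most linear in the number of its
  terms.\<close>

lemma block_approximation_error:
  assumes f: "exp_lipschitz M f" and \<alpha>: "\<alpha> > 1" and n: "n \<ge> q" and q: "q = L + 2 * m" "L > 0"
    and \<eta>: "\<And>J. finite J \<Longrightarrow>
      (\<integral>w. (\<Sum>j\<in>J. F f j w - (obs f (I m) j w - cmean f (I m)))\<^sup>2 \<partial>P) \<le> real (card J) * \<eta>\<^sup>2"
  defines "K \<equiv> \<kappa> M * total"
  defines "D \<equiv> \<lambda>w. (\<Sum>j<n. F f j w) / sqrt (real n)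
    - (\<Sum>i<n div q. (1 / sqrt (real q)) * block f m L q i w) / sqrt (real (n div q))"
  shows "L2 P D" "(\<integral>w. (D w)\<^sup>2 \<partial>P) \<le> 4 * \<eta>\<^sup>2 + 6 * K\<^sup>2 * real q / real n + 8 * real m * K\<^sup>2 / real q"
proof -
  define r where "r = n div q"
  have qp: "q > 0" using q by simp
  have r: "r > 0" using n qp by (simp add: r_def div_greater_zero_iff)
  have rq: "r * q \<le> n" unfolding r_def by simp
  have nrq: "n < r * q + q"
    unfolding r_def using div_mult_mod_eq[of n q] mod_less_divisor[OF qp, of n] by linarith
  have np: "n > 0" using n qp by simp
  define x where "x j w = obs f (I m) j w - cmean f (I m)" for j w
  define G where "G = (\<Union>i<r. (+) (i * q) ` {..<L})"
  have Lq: "L \<le> q" using q by simp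
  have G: "card G = r * L" "G \<subseteq> {..<n}" "finite G"
  proof -
    show "card G = r * L" unfolding G_def by (rule card_blocks(1)[OF Lq])
    have "{..<r * q} \<subseteq> {..<n}" using rq by simp
    then show "G \<subseteq> {..<n}" unfolding G_def by (rule order_trans[OF card_blocks(2)[OF Lq]])
    show "finite G" unfolding G_def by simp
  qed
  define X1 where "X1 w = (\<Sum>j<n. F f j w - x j w)" for w
  define X2 where "X2 w = (\<Sum>j\<in>{..<n} - G. x j w)" for w
  define X3 where "X3 w = (\<Sum>j\<in>G. x j w)" for w
  have Lx: "L2 P (x j)" for j unfolding x_def by (intro L2_diff L2_obs[OF f] P.L2_const) auto
  have LX: "L2 P X1" "L2 P X2" "L2 P X3"
    unfolding X1_def X2_def X3_def using G(3) by (intro L2_sum L2_diff L2_F[OF f] Lx; simp)+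
  define N where "N = real r * real q"
  have N: "N > 0" "N \<le> real n" "real n - N \<le> real q"
  proof -
    show "N > 0" using r qp by (simp add: N_def)
    show "N \<le> real n" using rq unfolding N_def by (simp flip: of_nat_mult)
    show "real n - N \<le> real q" using nrq unfolding N_def by (simp flip: of_nat_mult of_nat_add)
  qed
  define b where "b = 1 / sqrt (real n) - 1 / sqrt N"
  have D: "D w = (1 / sqrt (real n)) * (X1 w + X2 w) + b * X3 w" for w
  proof -
    have "(\<Sum>i<r. (1 / sqrt (real q)) * block f m L q i w) / sqrt (real r)
        = (1 / sqrt N) * (\<Sum>i<r. block f m L q i w)"
      unfolding sum_distrib_left[symmetric] by (simp add: N_def real_sqrt_mult)
    also have "(\<Sum>i<r. block f m L q i w) = X3 w"
      unfolding sum_blocks[OF Lq] X3_def G_def x_def ..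
    finally have 1: "D w = (1 / sqrt (real n)) * (\<Sum>j<n. F f j w) - (1 / sqrt N) * X3 w"
      unfolding D_def r_def[symmetric] by simp
    have "(\<Sum>j<n. x j w) = X2 w + X3 w"
      unfolding X2_def X3_def using sum.subset_diff[OF G(2), of "\<lambda>j. x j w"] by simp
    then have "(\<Sum>j<n. F f j w) = X1 w + X2 w + X3 w" by (simp add: X1_def sum_subtractf)
    then show ?thesis unfolding 1 b_def by (simp add: algebra_simps add_divide_distrib)
  qed
  have L12: "L2 P (\<lambda>w. X1 w + X2 w)" by (intro L2_add LX)
  show "L2 P D" unfolding D[abs_def] by (intro L2_add L2_mult L12 LX)
  have e1: "(\<integral>w. (X1 w)\<^sup>2 \<partial>P) \<le> real n * \<eta>\<^sup>2"
    using \<eta>[of "{..<n}"] unfolding X1_def x_def by simp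
  \<comment> \<open>At most q terms follow the last full period, and each of the at most n/q periods
    contains a gap of length 2 m.\<close>
  have e2: "(\<integral>w. (X2 w)\<^sup>2 \<partial>P) \<le> (real q + 2 * real m * real n / real q) * K\<^sup>2"
  proof -
    have "(\<integral>w. (X2 w)\<^sup>2 \<partial>P) \<le> real (card ({..<n} - G)) * K\<^sup>2"
      unfolding X2_def x_def K_def by (rule variance_obs_le[OF f _ \<alpha>]) auto
    also have "\<dots> \<le> (real q + 2 * real m * real n / real q) * K\<^sup>2"
    proof (rule mult_right_mono)
      have "real (card ({..<n} - G)) = real n - real r * real L"
      proof -
        have "r * L \<le> n" using card_mono[OF _ G(2)] G(1) by simp
        then show ?thesis using G by (simp add: card_Diff_subset of_nat_diff)
      qed
      also have "\<dots> = (real n - N) + 2 * real m * real r" unfolding N_def q(1) by (simp add: algebra_simps)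
      also have "\<dots> \<le> real q + 2 * real m * (real n / real q)"
        using N qp by (intro add_mono mult_left_mono) (auto simp: N_def field_simps)
      finally show "real (card ({..<n} - G)) \<le> real q + 2 * real m * real n / real q" by simp
    qed simp
    finally show ?thesis .
  qed
  have e3: "(\<integral>w. (X3 w)\<^sup>2 \<partial>P) \<le> N * K\<^sup>2"
  proof -
    have "(\<integral>w. (X3 w)\<^sup>2 \<partial>P) \<le> real (card G) * K\<^sup>2"
      unfolding X3_def x_def K_def by (rule variance_obs_le[OF f _ \<alpha> G(3)]) auto
    also have "\<dots> \<le> N * K\<^sup>2"
      unfolding G(1) N_def of_nat_mult using Lq by (intro mult_right_mono mult_left_mono) auto
    finally show ?thesis .
  qed
  \<comment> \<open>With c the ratio of the square roots, b^2 N = (c - 1)^2 \<le> 1 - c^2 because c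
    lies in [0, 1]. The right side is (n - N)/n, and n - N is at most q.\<close>
  have bN: "b\<^sup>2 * N \<le> real q / real n"
  proof -
    define c where "c = sqrt N / sqrt (real n)"
    have c: "0 \<le> c" "c \<le> 1" using N np by (auto simp: c_def)
    have "b * sqrt N = c - 1" using N by (simp add: b_def c_def algebra_simps)
    then have "b\<^sup>2 * N = (c - 1)\<^sup>2" using N by (metis power_mult_distrib real_sqrt_pow2 less_imp_le)
    also have "\<dots> \<le> 1 - c\<^sup>2"
    proof -
      have "(1 - c) * (1 - c) \<le> (1 - c) * (1 + c)" using c by (intro mult_left_mono) auto
      then show ?thesis by (simp add: power2_eq_square algebra_simps)
    qed
    also have "c\<^sup>2 = N / real n" using N by (simp add: c_def power_divide)
    also have "1 - N / real n = (real n - N) / real n" using np by (simp add: diff_divide_distrib)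
    also have "\<dots> \<le> real q / real n" using N(3) by (intro divide_right_mono) auto
    finally show ?thesis .
  qed
  have "(\<integral>w. (D w)\<^sup>2 \<partial>P) \<le> 2 * (\<integral>w. ((1 / sqrt (real n)) * (X1 w + X2 w))\<^sup>2 \<partial>P) + 2 * (\<integral>w. (b * X3 w)\<^sup>2 \<partial>P)"
    unfolding D by (rule integral_square_add_le) (intro L2_mult L12 LX)+
  also have "(\<integral>w. ((1 / sqrt (real n)) * (X1 w + X2 w))\<^sup>2 \<partial>P) = (1 / real n) * (\<integral>w. (X1 w + X2 w)\<^sup>2 \<partial>P)"
    unfolding power_mult_distrib integral_mult_right_zero by (simp add: power_divide)
  also have "(\<integral>w. (b * X3 w)\<^sup>2 \<partial>P) = b\<^sup>2 * (\<integral>w. (X3 w)\<^sup>2 \<partial>P)"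
    unfolding power_mult_distrib integral_mult_right_zero ..
  also have "b\<^sup>2 * (\<integral>w. (X3 w)\<^sup>2 \<partial>P) \<le> b\<^sup>2 * (N * K\<^sup>2)" by (intro mult_left_mono e3) auto
  also have "b\<^sup>2 * (N * K\<^sup>2) \<le> real q / real n * K\<^sup>2"
    using mult_right_mono[OF bN, of "K\<^sup>2"] by (simp add: mult.assoc)
  also have "(\<integral>w. (X1 w + X2 w)\<^sup>2 \<partial>P) \<le> 2 * (\<integral>w. (X1 w)\<^sup>2 \<partial>P) + 2 * (\<integral>w. (X2 w)\<^sup>2 \<partial>P)"
    by (rule integral_square_add_le[OF LX(1,2)])
  also have "\<dots> \<le> 2 * (real n * \<eta>\<^sup>2) + 2 * ((real q + 2 * real m * real n / real q) * K\<^sup>2)"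
    by (intro add_mono mult_left_mono e1 e2) auto
  finally have "(\<integral>w. (D w)\<^sup>2 \<partial>P) \<le> 2 * ((1 / real n) * (2 * (real n * \<eta>\<^sup>2)
      + 2 * ((real q + 2 * real m * real n / real q) * K\<^sup>2))) + 2 * (real q / real n * K\<^sup>2)"
    by (simp add: mult_left_mono divide_right_mono)
  \<comment> \<open>6 collects 4 from the incomplete period inside X2 and 2 from the mismatch of
    normalizations.\<close>
  also have "\<dots> = 4 * \<eta>\<^sup>2 + 6 * K\<^sup>2 * real q / real n + 8 * real m * K\<^sup>2 / real q"
    using np qp by (simp add: field_simps)
  finally show "(\<integral>w. (D w)\<^sup>2 \<partial>P) \<le> 4 * \<eta>\<^sup>2 + 6 * K\<^sup>2 * real q / real n + 8 * real m * K\<^sup>2 / real q" .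
qed

text \<open>The parameters are chosen in the order m, L, n: m makes the truncation harmless, L makes
  the gaps of length 2 m rare, and n makes the incomplete period and the mismatch of normalizations
  small. Each of the three errors receives e^2/4.\<close>

lemma central_limit:
  assumes f: "exp_lipschitz M f" and \<alpha>: "\<alpha> > 1" and mean: "(\<integral>y. f y \<partial>\<mu>) = 0"
  shows "\<exists>\<sigma>\<ge>0. weak_conv_m (\<lambda>n. distr \<mu> borel (\<lambda>y. (\<Sum>j<n. f ((T ^^ j) y)) / sqrt (real n)))
    (centered_gaussian \<sigma>)"
  unfolding distr_birkhoff_sum[OF f]
proof (rule P.clt_by_approximation[where b="(\<kappa> M * total)\<^sup>2"])
  define K where "K = \<kappa> M * total"
  show "(\<lambda>w. (\<Sum>j<n. F f j w) / sqrt (real n)) \<in> borel_measurable P" for n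
  proof -
    have "L2 P (\<lambda>w. (1 / sqrt (real n)) * (\<Sum>j<n. F f j w))"
      by (intro L2_mult L2_sum L2_F[OF f]) auto
    then show ?thesis by (simp add: L2_def)
  qed
  have mean0: "(\<integral>w. f (\<Phi> w) \<partial>P) = 0"
    using mean integral_distr[OF Phi_measurable exp_lipschitz_borel[OF f]] by (simp add: \<mu>_def)
  fix e :: real assume e: "e > 0"
  from variance_F_minus_obs_le[OF f \<alpha> mean0, of "e / 4"] e obtain m where
    m: "\<forall>J. finite J \<longrightarrow> (\<integral>w. (\<Sum>j\<in>J. F f j w - (obs f (I m) j w - cmean f (I m)))\<^sup>2 \<partial>P)
      \<le> real (card J) * (e / 4)\<^sup>2" by auto
  define L where "L = Suc (nat \<lceil>32 * real m * K\<^sup>2 / e\<^sup>2\<rceil>)"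
  define q where "q = L + 2 * m"
  have L0: "L > 0" by (simp add: L_def)
  have qp: "q > 0" using L0 by (simp add: q_def)
  have q2: "8 * real m * K\<^sup>2 / real q \<le> e\<^sup>2 / 4"
  proof -
    have "32 * real m * K\<^sup>2 / e\<^sup>2 \<le> real q" unfolding q_def L_def by linarith
    then have "32 * real m * K\<^sup>2 \<le> real q * e\<^sup>2" using e by (simp add: field_simps)
    then show ?thesis using qp by (simp add: field_simps)
  qed
  define X where "X i w = (1 / sqrt (real q)) * block f m L q i w" for i w
  have LX: "L2 P (X i)" for i unfolding X_def by (intro L2_mult L2_block[OF f])
  have ind: "P.indep_vars (\<lambda>_. borel) X UNIV"
    unfolding X_def[abs_def] by (rule P.indep_vars_compose2[OF block_indep[OF f q_def L0]]) simp
  have X0: "(\<integral>w. X i w \<partial>P) = 0" for i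
    unfolding X_def integral_mult_right_zero block_mean[OF f] by simp
  have dX: "distr P borel (X i) = distr P borel (X 0)" for i
    unfolding X_def[abs_def] by (rule block_distr[OF f])
  define s where "s = (\<integral>w. (X 0 w)\<^sup>2 \<partial>P)"
  have sX: "(\<integral>w. (X i w)\<^sup>2 \<partial>P) = s" for i
  proof -
    have "X i \<in> borel_measurable P" for i using LX by (simp add: L2_def)
    then have "(\<integral>w. (X i w)\<^sup>2 \<partial>P) = (\<integral>y. y\<^sup>2 \<partial>distr P borel (X i))" for i
      by (intro integral_distr[symmetric]) auto
    then show ?thesis unfolding s_def using dX[of i] by simp
  qed
  \<comment> \<open>A bound that depends neither on e nor on m and L keeps all approximating
    variances in one compact interval.\<close>
  have s: "0 \<le> s" "s \<le> K\<^sup>2"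
  proof -
    show "0 \<le> s" unfolding s_def by (rule Bochner_Integration.integral_nonneg) simp
    have "s = (1 / real q) * (\<integral>w. (block f m L q 0 w)\<^sup>2 \<partial>P)"
      unfolding s_def X_def power_mult_distrib integral_mult_right_zero by (simp add: power_divide)
    also have "\<dots> \<le> (1 / real q) * (real L * K\<^sup>2)"
      using variance_obs_le[OF f _ \<alpha>, of "I m" "{..<L}"]
      by (intro mult_left_mono) (auto simp: block_def K_def)
    also have "\<dots> = (real L / real q) * K\<^sup>2" by simp
    also have "\<dots> \<le> 1 * K\<^sup>2" using qp by (intro mult_right_mono) (auto simp: q_def)
    finally show "s \<le> K\<^sup>2" by simp
  qed
  define R where "R n w = (\<Sum>i<n div q. X i w) / sqrt (real (n div q))" for n w
  have "R n \<in> borel_measurable P" for n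
  proof -
    have "L2 P (\<lambda>w. (1 / sqrt (real (n div q))) * (\<Sum>i<n div q. X i w))" by (intro L2_mult L2_sum LX) auto
    then show ?thesis by (simp add: L2_def R_def[abs_def])
  qed
  moreover have "(\<lambda>n. char (distr P borel (R n)) t) \<longlonglongrightarrow> complex_of_real (exp (- (s * t\<^sup>2) / 2))" for t
  proof -
    have "(\<lambda>n. char (distr P borel (\<lambda>w. (\<Sum>i<n. X i w) / sqrt (real n))) t)
        \<longlonglongrightarrow> complex_of_real (exp (- (s * t\<^sup>2) / 2))"
      by (rule P.iid_char_tendsto[OF ind X0 _ sX dX]) (use LX in \<open>simp add: L2_def\<close>)
    from filterlim_compose[OF this filterlim_div_at_top[OF qp]] show ?thesis
      unfolding R_def[abs_def] .
  qed
  moreover have "eventually (\<lambda>n. integrable P (\<lambda>w. ((\<Sum>j<n. F f j w) / sqrt (real n) - R n w)\<^sup>2) \<and>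
      (\<integral>w. ((\<Sum>j<n. F f j w) / sqrt (real n) - R n w)\<^sup>2 \<partial>P) \<le> e\<^sup>2) sequentially"
    unfolding eventually_sequentially
  proof (intro exI allI impI)
    fix n assume n: "n \<ge> q + nat \<lceil>24 * K\<^sup>2 * real q / e\<^sup>2\<rceil>"
    then have nq: "n \<ge> q" by simp
    have n2: "6 * K\<^sup>2 * real q / real n \<le> e\<^sup>2 / 4"
    proof -
      have "24 * K\<^sup>2 * real q / e\<^sup>2 \<le> real n" using n by linarith
      then have "24 * K\<^sup>2 * real q \<le> real n * e\<^sup>2" using e by (simp add: field_simps)
      then show ?thesis using nq qp by (simp add: field_simps)
    qed
    note err = block_approximation_error[OF f \<alpha> nq q_def L0 m[rule_format]]
    have "(\<integral>w. ((\<Sum>j<n. F f j w) / sqrt (real n) - R n w)\<^sup>2 \<partial>P)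
        \<le> 4 * (e / 4)\<^sup>2 + 6 * K\<^sup>2 * real q / real n + 8 * real m * K\<^sup>2 / real q"
      using err(2) unfolding R_def X_def K_def by simp
    also have "\<dots> \<le> 4 * (e / 4)\<^sup>2 + e\<^sup>2 / 4 + e\<^sup>2 / 4" by (intro add_mono order_refl n2 q2)
    also have "\<dots> \<le> e\<^sup>2" by (simp add: power2_eq_square)
    finally show "integrable P (\<lambda>w. ((\<Sum>j<n. F f j w) / sqrt (real n) - R n w)\<^sup>2) \<and>
      (\<integral>w. ((\<Sum>j<n. F f j w) / sqrt (real n) - R n w)\<^sup>2 \<partial>P) \<le> e\<^sup>2"
      using err(1) unfolding L2_def R_def X_def by simp
  qed
  ultimately show "\<exists>s R. 0 \<le> s \<and> s \<le> (\<kappa> M * total)\<^sup>2 \<and> (\<forall>n. R n \<in> borel_measurable P) \<and>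
      (\<forall>t. (\<lambda>n. char (distr P borel (R n)) t) \<longlonglongrightarrow> complex_of_real (exp (- (s * t\<^sup>2) / 2))) \<and>
      eventually (\<lambda>n. integrable P (\<lambda>w. ((\<Sum>j<n. F f j w) / sqrt (real n) - R n w)\<^sup>2) \<and>
        P.expectation (\<lambda>w. ((\<Sum>j<n. F f j w) / sqrt (real n) - R n w)\<^sup>2) \<le> e\<^sup>2) sequentially"
    using s unfolding K_def by (intro exI[of _ s] exI[of _ R]) simp
qed

end

subsection \<open>Conclusion\<close>

lemma summable_on_imp_norm_bounded:
  fixes f :: "nat \<Rightarrow> 'a::real_normed_vector"
  assumes "f summable_on UNIV"
  obtains B where "\<And>n. norm (f n) \<le> B"
proof -
  have "f \<longlonglongrightarrow> 0" by (rule summable_LIMSEQ_zero[OF summable_on_imp_summable[OF assms]])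
  then have "Bseq f" by (intro convergent_imp_Bseq convergentI)
  then show thesis using that unfolding Bseq_def by blast
qed

lemma ex_orbit_process:
  fixes T :: "'a::{banach, second_countable_topology} \<Rightarrow> 'a"
  assumes K: "cplx \<Longrightarrow> complex_structure J" and T: "K_bounded_linear cplx J T"
    and adm: "admissible_data cplx J T \<omega>0 x \<epsilon> S" and \<alpha>: "\<alpha> \<ge> 0"
    and C: "\<And>m k. m \<ge> 1 \<Longrightarrow> norm ((T ^^ k) (x m)) \<le> C m / (1 + real k) powr \<alpha>"
      "\<And>m k. m \<ge> 1 \<Longrightarrow> norm (S k (x m)) \<le> C m / (1 + real k) powr \<alpha>"
  shows "\<exists>v C p V. orbit_process T v C \<alpha> p V"
proof -
  have bT: "bounded_linear T" using T unfolding K_bounded_linear_def by blast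
  have dense: "closure ((\<lambda>w. w 0) ` bi_orbits T \<alpha>) = UNIV"
    by (rule dense_bi_orbits[OF K T adm \<alpha> C])
  obtain v :: "nat \<Rightarrow> int \<Rightarrow> 'a" and c where v: "\<And>n k. T (v n k) = v n (k + 1)" "\<And>n. v n summable_on UNIV"
    "\<And>n k. norm (v n k) \<le> c n * (1 + \<bar>real_of_int k\<bar>) powr (- \<alpha>)" "\<And>n. c n \<ge> 0"
    "v 0 = (\<lambda>_. 0)" "c 0 = 0" "closure (range (\<lambda>n. v n 0)) = UNIV"
    by (rule countable_dense_bi_orbits[OF bounded_linear.linear[OF bT] dense])
      (rule that, assumption+)
  obtain p V where "\<And>n. pmf p n > 0" "integrable (iid (measure_pmf p)) V"
    "AE w in iid (measure_pmf p). (\<lambda>k. v (w k) k) summable_on UNIV \<and>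
      (\<forall>A. finite A \<longrightarrow> exp (4 * norm (\<Sum>k\<in>A. v (w k) k)) \<le> V w) \<and> c (w 0) ^ 4 \<le> V w"
    by (rule ex_symbol_law[of v c, OF v(2,5,4,6)]) (rule that, assumption+)
  with v bT have "orbit_process T v c \<alpha> p V" by (intro orbit_process.intro)
  then show ?thesis by blast
qed

theorem theorem2p2:
  fixes T :: "'a::{banach, second_countable_topology} \<Rightarrow> 'a"
    and J :: "'a \<Rightarrow> 'a" and cplx :: bool
    and \<omega> :: "nat \<Rightarrow> real"
  assumes K: "cplx \<Longrightarrow> complex_structure J"
    and T_lin: "K_bounded_linear cplx J T"
    and \<omega>_gt1: "\<forall>k. \<omega> k > 1" and \<omega>_lim: "filterlim \<omega> at_top sequentially"
    and H: "\<forall>\<omega>0. weight_function \<omega>0 \<longrightarrow> (\<exists>x \<epsilon> S. admissible_data cplx J T \<omega>0 x \<epsilon> S)"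
  shows "(\<exists>\<mu>. good_measure \<omega> T \<mu>) \<and>
    (\<forall>\<alpha>>1/2. (\<forall>\<omega>0. weight_function \<omega>0 \<longrightarrow>
                 (\<exists>x \<epsilon> S. admissible_data cplx J T \<omega>0 x \<epsilon> S \<and> decay_bound \<alpha> T \<omega>0 x S)) \<longrightarrow>
       (\<exists>\<mu>. good_measure \<omega> T \<mu> \<and>
          (\<forall>f\<in>E_omega \<omega>. \<forall>g\<in>E_omega \<omega>. \<exists>C. \<forall>n\<ge>1.
             \<bar>covariance \<mu> (\<lambda>y. f ((T ^^ n) y)) g\<bar> \<le> C * cov_rate \<alpha> n) \<and>
          (\<alpha> > 1 \<longrightarrow> (\<forall>f\<in>E_omega \<omega>. (\<integral>y. f y \<partial>\<mu>) = 0 \<longrightarrow>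
             (\<exists>\<sigma>\<ge>0. weak_conv_m (\<lambda>n. distr \<mu> borel (\<lambda>y. (\<Sum>j<n. f ((T ^^ j) y)) / sqrt (real n)))
                                  (centered_gaussian \<sigma>))))))"
proof (intro conjI allI impI)
  \<comment> \<open>An explicit function that exceeds 1 on [1, \<infinity>) and tends to infinity.
    In the second part it also supplies the orbit constants m + 1.\<close>
  let ?w = "\<lambda>t::real. t + 1"
  have w: "weight_function ?w"
    unfolding weight_function_def
    by (intro conjI filterlim_tendsto_add_at_top[OF tendsto_const filterlim_ident, of 1, simplified add.commute]) auto
  {
    obtain x \<epsilon> S where adm: "admissible_data cplx J T ?w x \<epsilon> S" using H w by blast
    have "\<exists>B. \<forall>k. norm ((T ^^ k) (x m)) \<le> B" if "m \<ge> 1" for m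
      using summable_on_imp_norm_bounded[OF admissible_dataD(1)[OF adm that]] by blast
    then obtain B1 where B1: "\<And>m k. m \<ge> 1 \<Longrightarrow> norm ((T ^^ k) (x m)) \<le> B1 m" by metis
    have "\<exists>B. \<forall>k. norm (S k (x m)) \<le> B" if "m \<ge> 1" for m
      using summable_on_imp_norm_bounded[OF admissible_dataD(2)[OF adm that]] by blast
    then obtain B2 where B2: "\<And>m k. m \<ge> 1 \<Longrightarrow> norm (S k (x m)) \<le> B2 m" by metis
    \<comment> \<open>With exponent 0 the decay condition is mere boundedness along each orbit,
      which the convergence in (i) and (ii) provides.\<close>
    have "\<exists>v C p V. orbit_process T v C 0 p V"
    proof (rule ex_orbit_process[OF K T_lin adm, where C="\<lambda>m. max (B1 m) (B2 m)"])
      show "norm ((T ^^ k) (x m)) \<le> max (B1 m) (B2 m) / (1 + real k) powr 0" if "m \<ge> 1" for m k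
        using B1[OF that, of k] by (simp add: le_max_iff_disj)
      show "norm (S k (x m)) \<le> max (B1 m) (B2 m) / (1 + real k) powr 0" if "m \<ge> 1" for m k
        using B2[OF that, of k] by (simp add: le_max_iff_disj)
    qed simp_all
    then obtain v C p V where "orbit_process T v C 0 p V" by blast
    from orbit_process.good_measure_mu[OF this \<omega>_gt1] show "\<exists>\<mu>. good_measure \<omega> T \<mu>" by blast
  }
  fix \<alpha> :: real
  assume \<alpha>: "1/2 < \<alpha>" and H': "\<forall>\<omega>0. weight_function \<omega>0 \<longrightarrow>
    (\<exists>x \<epsilon> S. admissible_data cplx J T \<omega>0 x \<epsilon> S \<and> decay_bound \<alpha> T \<omega>0 x S)"
  obtain x \<epsilon> S where adm: "admissible_data cplx J T ?w x \<epsilon> S" and decay: "decay_bound \<alpha> T ?w x S"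
    using H' w by blast
  have "\<exists>v C p V. orbit_process T v C \<alpha> p V"
    by (rule ex_orbit_process[OF K T_lin adm, where C="\<lambda>m. ?w (real m)"])
      (use \<alpha> decay in \<open>simp_all add: decay_bound_def\<close>)
  then obtain v C p V where O: "orbit_process T v C \<alpha> p V" by blast
  interpret orbit_process T v C \<alpha> p V by (rule O)
  show "\<exists>\<mu>. good_measure \<omega> T \<mu> \<and>
      (\<forall>f\<in>E_omega \<omega>. \<forall>g\<in>E_omega \<omega>. \<exists>C. \<forall>n\<ge>1.
         \<bar>covariance \<mu> (\<lambda>y. f ((T ^^ n) y)) g\<bar> \<le> C * cov_rate \<alpha> n) \<and>
      (\<alpha> > 1 \<longrightarrow> (\<forall>f\<in>E_omega \<omega>. (\<integral>y. f y \<partial>\<mu>) = 0 \<longrightarrow>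
         (\<exists>\<sigma>\<ge>0. weak_conv_m (\<lambda>n. distr \<mu> borel (\<lambda>y. (\<Sum>j<n. f ((T ^^ j) y)) / sqrt (real n)))
                              (centered_gaussian \<sigma>))))"
  proof (intro exI[of _ \<mu>] conjI ballI impI)
    show "good_measure \<omega> T \<mu>" by (rule good_measure_mu[OF \<omega>_gt1])
  next
    fix f g :: "'a \<Rightarrow> real" assume f: "f \<in> E_omega \<omega>" and g: "g \<in> E_omega \<omega>"
    obtain M where M: "exp_lipschitz M f" by (rule E_omega_exp_lipschitz[OF f \<omega>_gt1])
    obtain N where N: "exp_lipschitz N g" by (rule E_omega_exp_lipschitz[OF g \<omega>_gt1])
    show "\<exists>C. \<forall>n\<ge>1. \<bar>covariance \<mu> (\<lambda>y. f ((T ^^ n) y)) g\<bar> \<le> C * cov_rate \<alpha> n"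
      by (rule covariance_decay[OF M N \<alpha>])
  next
    fix f :: "'a \<Rightarrow> real" assume f: "f \<in> E_omega \<omega>" and mean: "(\<integral>y. f y \<partial>\<mu>) = 0" and \<alpha>1: "1 < \<alpha>"
    obtain M where M: "exp_lipschitz M f" by (rule E_omega_exp_lipschitz[OF f \<omega>_gt1])
    show "\<exists>\<sigma>\<ge>0. weak_conv_m (\<lambda>n. distr \<mu> borel (\<lambda>y. (\<Sum>j<n. f ((T ^^ j) y)) / sqrt (real n)))
        (centered_gaussian \<sigma>)"
      by (rule central_limit[OF M \<alpha>1 mean])
  qed
qed

end
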